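(* Let $\pi$ be a unitary representation of the real Lie group $G$ on a Hilbert space $\mathcal H$. Suppose $v\in\mathcal H$ satisfies $d\pi^{-\infty}(u)v\in\mathcal H$ for all $u\in U(\mathfrak g)$. Then $v$ is a smooth vector.
   Context: $G$ is the group of real points (or of points over an archimedean local field) of a simply connected, absolutely simple algebraic group, regarded as a real Lie group; $\mathfrak g$ is its Lie algebra and $U(\mathfrak g)$ the enveloping algebra. $\mathcal H^\infty\subset\mathcal H$ is the Fréchet space of smooth vectors ($v$ such that $g\mapsto\pi(g)v$ is smooth), with semi-norms $|v|_u=\|d\pi(u)v\|$, $u\in U(\mathfrak g)$. $\mathcal H^{-\infty}$ is the space of continuous linear functionals on $\mathcal H^\infty$, with bilinear pairing $\langle\ ,\ \rangle:\mathcal H^\infty\times\mathcal H^{-\infty}\to\mathbb C$. For $X\in\mathfrak g$ define $\langle w,d\pi^{-\infty}(X)v\rangle:=-\langle d\pi(X)w,v\rangle$ ($w\in\mathcal H^\infty$, $v\in\mathcal H^{-\infty}$), extended to an algebra homomorphism $d\pi^{-\infty}:U(\mathfrak g)\to\mathrm{End}_{\mathbb C}(\mathcal H^{-\infty})$. $\mathcal H$ is embedded (anti-linearly) in $\mathcal H^{-\infty}$ by $\langle w,v\rangle:=(w,v)_{\mathcal H}$; "$d\pi^{-\infty}(u)v\in\mathcal H$" means this functional lies in the image of $\mathcal H$. *)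

theory Defs
  imports
    "HOL-Analysis.Analysis"
    "HOL-Algebra.Coset"
    "HOL-Library.Poly_Mapping"
    "Jordan_Normal_Form.Determinant"
begin

no_notation Matrix.vec_index (infixl "$" 100)

section \<open>Linear algebraic groups over \<open>\<complex>\<close> and their rational points\<close>

text \<open>
  A linear algebraic group is given by its complex points, a Zariski closed subgroup of a general
  linear group. The definitions are relative to an ambient group \<open>\<Gamma>\<close> and its algebra \<open>R\<close> of
  regular functions, because two models of the general linear group are used: \<open>complex^'n^'n\<close>, which
  carries the topology needed for Lie theory, and \<open>complex mat\<close>, whose size can be quantified over
  in the definition of simple connectedness.
\<close>

inductive_set generated_algebra :: "complex set \<Rightarrow> ('x \<Rightarrow> complex) set \<Rightarrow> ('x \<Rightarrow> complex) set"
  for k :: "complex set" and C :: "('x \<Rightarrow> complex) set" where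
  const: "c \<in> k \<Longrightarrow> (\<lambda>_. c) \<in> generated_algebra k C"
| gen: "f \<in> C \<Longrightarrow> f \<in> generated_algebra k C"
| add: "f \<in> generated_algebra k C \<Longrightarrow> g \<in> generated_algebra k C \<Longrightarrow>
    (\<lambda>x. f x + g x) \<in> generated_algebra k C"
| mult: "f \<in> generated_algebra k C \<Longrightarrow> g \<in> generated_algebra k C \<Longrightarrow>
    (\<lambda>x. f x * g x) \<in> generated_algebra k C"

definition GL :: "(complex^'n^'n) monoid" where
  "GL = \<lparr>carrier = {A. invertible A}, mult = (**), one = Finite_Cartesian_Product.mat 1\<rparr>"

definition GL_regular :: "complex set \<Rightarrow> (complex^'n^'n \<Rightarrow> complex) set" where
  "GL_regular k = generated_algebra k
     ({(\<lambda>A. A $ i $ j) | i j. True} \<union> {\<lambda>A. inverse (Determinants.det A)})"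

definition GLm :: "nat \<Rightarrow> complex Matrix.mat monoid" where
  "GLm m = \<lparr>carrier = {A \<in> carrier_mat m m. invertible_mat A}, mult = (*), one = 1\<^sub>m m\<rparr>"

definition GLm_regular :: "nat \<Rightarrow> complex set \<Rightarrow> (complex Matrix.mat \<Rightarrow> complex) set" where
  "GLm_regular m k = generated_algebra k
     ({(\<lambda>A. A $$ (i, j)) | i j. i < m \<and> j < m} \<union> {\<lambda>A. inverse (Determinant.det A)})"

definition zariski_closed :: "'x monoid \<Rightarrow> ('x \<Rightarrow> complex) set \<Rightarrow> 'x set \<Rightarrow> bool" where
  "zariski_closed \<Gamma> R S \<longleftrightarrow> (\<exists>P\<subseteq>R. S = {x \<in> carrier \<Gamma>. \<forall>f\<in>P. f x = 0})"

definition zariski_connected :: "'x monoid \<Rightarrow> ('x \<Rightarrow> complex) set \<Rightarrow> 'x set \<Rightarrow> bool" where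
  "zariski_connected \<Gamma> R S \<longleftrightarrow>
     \<not> (\<exists>A B. zariski_closed \<Gamma> R A \<and> zariski_closed \<Gamma> R B \<and> A \<noteq> {} \<and> B \<noteq> {} \<and>
            A \<inter> B = {} \<and> A \<union> B = S)"

text \<open>
  If \<open>R\<close> is the algebra of regular functions with coefficients in a subfield \<open>k\<close> of \<open>\<complex>\<close>, this says
  that the group is defined over \<open>k\<close>: in characteristic zero, being \<open>k\<close>-closed is the same as being
  defined over \<open>k\<close>.
\<close>

definition algebraic_subgroup :: "'x monoid \<Rightarrow> ('x \<Rightarrow> complex) set \<Rightarrow> 'x set \<Rightarrow> bool" where
  "algebraic_subgroup \<Gamma> R S \<longleftrightarrow> subgroup S \<Gamma> \<and> zariski_closed \<Gamma> R S"

text \<open>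
  Simplicity of algebraic groups is meant in the usual sense allowing a finite centre (so \<open>SL\<^sub>2\<close> is
  simple); for a group over \<open>k \<subseteq> \<complex>\<close>, absolute simplicity is simplicity of its complex points.
\<close>

definition simple_algebraic_group :: "'x monoid \<Rightarrow> ('x \<Rightarrow> complex) set \<Rightarrow> 'x set \<Rightarrow> bool" where
  "simple_algebraic_group \<Gamma> R S \<longleftrightarrow>
     algebraic_subgroup \<Gamma> R S \<and> zariski_connected \<Gamma> R S \<and>
     (\<exists>x\<in>S. \<exists>y\<in>S. x \<otimes>\<^bsub>\<Gamma>\<^esub> y \<noteq> y \<otimes>\<^bsub>\<Gamma>\<^esub> x) \<and>
     (\<forall>N. N \<lhd> (\<Gamma>\<lparr>carrier := S\<rparr>) \<and> zariski_closed \<Gamma> R N \<and> zariski_connected \<Gamma> R N \<longrightarrow>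
          N = {\<one>\<^bsub>\<Gamma>\<^esub>} \<or> N = S)"

definition regular_map ::
    "('x \<Rightarrow> complex) set \<Rightarrow> ('y \<Rightarrow> complex) set \<Rightarrow> 'x set \<Rightarrow> ('x \<Rightarrow> 'y) \<Rightarrow> bool" where
  "regular_map R R' S \<phi> \<longleftrightarrow> (\<forall>c\<in>R'. \<exists>f\<in>R. \<forall>x\<in>S. c (\<phi> x) = f x)"

definition isogeny ::
    "'x monoid \<Rightarrow> ('x \<Rightarrow> complex) set \<Rightarrow> 'x set \<Rightarrow>
     'y monoid \<Rightarrow> ('y \<Rightarrow> complex) set \<Rightarrow> 'y set \<Rightarrow> ('x \<Rightarrow> 'y) \<Rightarrow> bool" where
  "isogeny \<Gamma> R H \<Gamma>' R' S \<phi> \<longleftrightarrow>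
     \<phi> \<in> hom (\<Gamma>\<lparr>carrier := H\<rparr>) (\<Gamma>'\<lparr>carrier := S\<rparr>) \<and> regular_map R R' H \<phi> \<and>
     \<phi> ` H = S \<and> finite (kernel (\<Gamma>\<lparr>carrier := H\<rparr>) (\<Gamma>'\<lparr>carrier := S\<rparr>) \<phi>)"

text \<open>
  Every isogeny from a connected group is an isomorphism of algebraic groups. Centrality of the
  isogeny is automatic, since a finite normal subgroup of a connected group is central.
\<close>

definition simply_connected_group :: "'y monoid \<Rightarrow> ('y \<Rightarrow> complex) set \<Rightarrow> 'y set \<Rightarrow> bool" where
  "simply_connected_group \<Gamma>' R' S \<longleftrightarrow>
     (\<forall>m H \<phi>. algebraic_subgroup (GLm m) (GLm_regular m UNIV) H \<and>
        zariski_connected (GLm m) (GLm_regular m UNIV) H \<and>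
        isogeny (GLm m) (GLm_regular m UNIV) H \<Gamma>' R' S \<phi> \<longrightarrow>
        inj_on \<phi> H \<and> regular_map R' (GLm_regular m UNIV) S (inv_into H \<phi>))"

definition rational_points :: "complex set \<Rightarrow> (complex^'n^'n) set \<Rightarrow> (complex^'n^'n) set" where
  "rational_points k S = {g \<in> S. \<forall>i j. g $ i $ j \<in> k}"


section \<open>Closed linear groups as real Lie groups\<close>

definition matrix_exp :: "complex^'n^'n \<Rightarrow> complex^'n^'n" where
  "matrix_exp X = suminf (\<lambda>k. (1 / fact k) *\<^sub>R (((**) X ^^ k) (Finite_Cartesian_Product.mat 1)))"

definition lie_algebra :: "(complex^'n^'n) set \<Rightarrow> (complex^'n^'n) set" where
  "lie_algebra G = {X. \<forall>t::real. matrix_exp (t *\<^sub>R X) \<in> G}"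

primrec Ck_on ::
    "nat \<Rightarrow> ('a::real_normed_vector \<Rightarrow> 'b::real_normed_vector) \<Rightarrow> 'a set \<Rightarrow> bool" where
  "Ck_on 0 f U \<longleftrightarrow> continuous_on U f"
| "Ck_on (Suc k) f U \<longleftrightarrow>
     (\<forall>x\<in>U. f differentiable (at x)) \<and> (\<forall>h. Ck_on k (\<lambda>x. frechet_derivative f (at x) h) U)"

text \<open>
  A closed linear group is an embedded real submanifold of the matrix space, so a function on it is
  smooth iff it extends locally to a smooth function on an open set of matrices.
\<close>

definition smooth_on_group ::
    "(complex^'n^'n) set \<Rightarrow> (complex^'n^'n \<Rightarrow> 'b::real_normed_vector) \<Rightarrow> bool" where
  "smooth_on_group G f \<longleftrightarrow>
     (\<forall>g\<in>G. \<exists>U \<Phi>. open U \<and> g \<in> U \<and> (\<forall>k. Ck_on k \<Phi> U) \<and> (\<forall>x\<in>U \<inter> G. \<Phi> x = f x))"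


section \<open>The universal enveloping algebra\<close>

text \<open>
  Elements of the free associative real algebra on a set of matrices are finitely supported functions
  on words. The enveloping algebra of \<open>\<gg>\<close> is its quotient by the ideal which makes the
  inclusion of the generators linear and turns the commutator into the Lie bracket \<open>XY - YX\<close>, that
  is, the tensor algebra modulo the Lie relations.
\<close>

type_synonym 'a free_algebra = "'a list \<Rightarrow>\<^sub>0 real"

definition free_carrier :: "'a set \<Rightarrow> 'a free_algebra set" where
  "free_carrier \<gg> = {p. \<forall>w\<in>Poly_Mapping.keys p. set w \<subseteq> \<gg>}"

definition free_mult :: "'a free_algebra \<Rightarrow> 'a free_algebra \<Rightarrow> 'a free_algebra" where
  "free_mult p q = (\<Sum>a\<in>Poly_Mapping.keys p. \<Sum>b\<in>Poly_Mapping.keys q.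
     Poly_Mapping.single (a @ b) (Poly_Mapping.lookup p a * Poly_Mapping.lookup q b))"

inductive_set uea_ideal :: "(complex^'n^'n) set \<Rightarrow> (complex^'n^'n) free_algebra set"
  for \<gg> :: "(complex^'n^'n) set" where
  zero: "0 \<in> uea_ideal \<gg>"
| sum: "X \<in> \<gg> \<Longrightarrow> Y \<in> \<gg> \<Longrightarrow>
    Poly_Mapping.single [X + Y] 1 - Poly_Mapping.single [X] 1 - Poly_Mapping.single [Y] 1
      \<in> uea_ideal \<gg>"
| scale: "X \<in> \<gg> \<Longrightarrow>
    Poly_Mapping.single [r *\<^sub>R X] 1 - Poly_Mapping.single [X] r \<in> uea_ideal \<gg>"
| bracket: "X \<in> \<gg> \<Longrightarrow> Y \<in> \<gg> \<Longrightarrow>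
    Poly_Mapping.single [X, Y] 1 - Poly_Mapping.single [Y, X] 1
      - Poly_Mapping.single [X ** Y - Y ** X] 1 \<in> uea_ideal \<gg>"
| add: "p \<in> uea_ideal \<gg> \<Longrightarrow> q \<in> uea_ideal \<gg> \<Longrightarrow> p + q \<in> uea_ideal \<gg>"
| left: "p \<in> uea_ideal \<gg> \<Longrightarrow> a \<in> free_carrier \<gg> \<Longrightarrow> free_mult a p \<in> uea_ideal \<gg>"
| right: "p \<in> uea_ideal \<gg> \<Longrightarrow> a \<in> free_carrier \<gg> \<Longrightarrow> free_mult p a \<in> uea_ideal \<gg>"

definition enveloping_algebra :: "(complex^'n^'n) set \<Rightarrow> (complex^'n^'n) free_algebra set set" where
  "enveloping_algebra \<gg> = free_carrier \<gg> //
     {(p, q). p \<in> free_carrier \<gg> \<and> q \<in> free_carrier \<gg> \<and> p - q \<in> uea_ideal \<gg>}"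

text \<open>
  The map on the quotient induced by a map on the free algebra. It is only applied to maps that are
  constant on residue classes.
\<close>

definition quotient_lift :: "('p \<Rightarrow> 'b) \<Rightarrow> 'p set \<Rightarrow> 'b" where
  "quotient_lift f u = the_elem (f ` u)"


section \<open>Unitary representations, smooth vectors and distribution vectors\<close>

text \<open>The inner product is linear in the first and conjugate-linear in the second argument.\<close>

class complex_hilbert_space = banach +
  fixes scaleC :: "complex \<Rightarrow> 'a \<Rightarrow> 'a" (infixr "*\<^sub>C" 75)
    and cinner :: "'a \<Rightarrow> 'a \<Rightarrow> complex"
  assumes scaleC_of_real: "complex_of_real r *\<^sub>C x = r *\<^sub>R x"
    and scaleC_add_right: "c *\<^sub>C (x + y) = c *\<^sub>C x + c *\<^sub>C y"
    and scaleC_add_left: "(c + d) *\<^sub>C x = c *\<^sub>C x + d *\<^sub>C x"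
    and scaleC_scaleC: "c *\<^sub>C d *\<^sub>C x = (c * d) *\<^sub>C x"
    and cinner_add_left: "cinner (x + y) z = cinner x z + cinner y z"
    and cinner_scaleC_left: "cinner (c *\<^sub>C x) y = c * cinner x y"
    and cinner_commute: "cinner x y = cnj (cinner y x)"
    and norm_eq_sqrt_cinner: "norm x = sqrt (Re (cinner x x))"

type_synonym ('n, 'h) rep = "complex^'n^'n \<Rightarrow> 'h \<Rightarrow> 'h"

definition unitary_representation ::
    "(complex^'n^'n) set \<Rightarrow> ('n::finite, 'h::complex_hilbert_space) rep \<Rightarrow> bool" where
  "unitary_representation G \<pi> \<longleftrightarrow>
     (\<forall>g\<in>G. (\<forall>x y. \<pi> g (x + y) = \<pi> g x + \<pi> g y) \<and> (\<forall>c x. \<pi> g (c *\<^sub>C x) = c *\<^sub>C \<pi> g x) \<and>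
        surj (\<pi> g) \<and> (\<forall>x y. cinner (\<pi> g x) (\<pi> g y) = cinner x y)) \<and>
     (\<forall>g\<in>G. \<forall>h\<in>G. \<forall>x. \<pi> (g ** h) x = \<pi> g (\<pi> h x)) \<and>
     (\<forall>x. continuous_on G (\<lambda>g. \<pi> g x))"

definition smooth_vectors ::
    "(complex^'n^'n) set \<Rightarrow> ('n::finite, 'h::complex_hilbert_space) rep \<Rightarrow> 'h set" where
  "smooth_vectors G \<pi> = {v. smooth_on_group G (\<lambda>g. \<pi> g v)}"

definition dpi_lie :: "('n::finite, 'h::complex_hilbert_space) rep \<Rightarrow> complex^'n^'n \<Rightarrow> 'h \<Rightarrow> 'h" where
  "dpi_lie \<pi> X w = vector_derivative (\<lambda>t::real. \<pi> (matrix_exp (t *\<^sub>R X)) w) (at 0)"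

text \<open>
  Operators on smooth vectors, and functionals on them, are represented by functions that are
  \<open>undefined\<close> outside their domain, so that equality of functions is equality on the domain. A word
  \<open>[X\<^sub>1, \<dots>, X\<^sub>k]\<close> acts as the composition \<open>X\<^sub>1 \<circ> \<dots> \<circ> X\<^sub>k\<close>.
\<close>

definition dpi ::
    "(complex^'n^'n) set \<Rightarrow> ('n::finite, 'h::complex_hilbert_space) rep \<Rightarrow>
     (complex^'n^'n) free_algebra set \<Rightarrow> 'h \<Rightarrow> 'h" where
  "dpi G \<pi> = quotient_lift (\<lambda>p. \<lambda>w\<in>smooth_vectors G \<pi>.
     \<Sum>xs\<in>Poly_Mapping.keys p. Poly_Mapping.lookup p xs *\<^sub>R foldr (dpi_lie \<pi>) xs w)"

definition smooth_topology ::
    "(complex^'n^'n) set \<Rightarrow> ('n::finite, 'h::complex_hilbert_space) rep \<Rightarrow> 'h topology" where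
  "smooth_topology G \<pi> = topology_generated_by
     {{w \<in> smooth_vectors G \<pi>. norm (dpi G \<pi> u (w - w0)) < e} | u w0 e.
        u \<in> enveloping_algebra (lie_algebra G) \<and> w0 \<in> smooth_vectors G \<pi> \<and> e > 0}"

definition distribution_vectors ::
    "(complex^'n^'n) set \<Rightarrow> ('n::finite, 'h::complex_hilbert_space) rep \<Rightarrow> ('h \<Rightarrow> complex) set" where
  "distribution_vectors G \<pi> = {\<psi> \<in> extensional (smooth_vectors G \<pi>).
     (\<forall>x\<in>smooth_vectors G \<pi>. \<forall>y\<in>smooth_vectors G \<pi>. \<psi> (x + y) = \<psi> x + \<psi> y) \<and>
     (\<forall>c. \<forall>x\<in>smooth_vectors G \<pi>. \<psi> (c *\<^sub>C x) = c * \<psi> x) \<and>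
     continuous_map (smooth_topology G \<pi>) euclidean \<psi>}"

definition hilbert_embed ::
    "(complex^'n^'n) set \<Rightarrow> ('n::finite, 'h::complex_hilbert_space) rep \<Rightarrow> 'h \<Rightarrow> 'h \<Rightarrow> complex" where
  "hilbert_embed G \<pi> v = (\<lambda>w\<in>smooth_vectors G \<pi>. cinner w v)"

definition dpi_dist_lie ::
    "(complex^'n^'n) set \<Rightarrow> ('n::finite, 'h::complex_hilbert_space) rep \<Rightarrow>
     complex^'n^'n \<Rightarrow> ('h \<Rightarrow> complex) \<Rightarrow> 'h \<Rightarrow> complex" where
  "dpi_dist_lie G \<pi> X \<psi> = (\<lambda>w\<in>smooth_vectors G \<pi>. - \<psi> (dpi_lie \<pi> X w))"

definition dpi_dist ::
    "(complex^'n^'n) set \<Rightarrow> ('n::finite, 'h::complex_hilbert_space) rep \<Rightarrow>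
     (complex^'n^'n) free_algebra set \<Rightarrow> ('h \<Rightarrow> complex) \<Rightarrow> 'h \<Rightarrow> complex" where
  "dpi_dist G \<pi> = quotient_lift (\<lambda>p. \<lambda>\<psi>\<in>distribution_vectors G \<pi>. \<lambda>w\<in>smooth_vectors G \<pi>.
     \<Sum>xs\<in>Poly_Mapping.keys p. of_real (Poly_Mapping.lookup p xs) * foldr (dpi_dist_lie G \<pi>) xs \<psi> w)"

end

theory Submission
  imports Defs
begin

text \<open>
  There are enough smooth vectors: the derived representation acts on an average of \<open>\<pi>(g) v\<close> against
  a smooth density near the identity by differentiating the density, so such averages (Garding
  vectors) are smooth, and only \<open>0\<close> is orthogonal to all of them. Hence identities may be tested
  against smooth vectors. Now let all weak derivatives of \<open>v\<close> lie in the Hilbert space, let \<open>u\<close> be one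
  of them and \<open>u\<^sub>X\<close> its weak derivative along \<open>X\<close>. Pairing with smooth vectors gives
  \<open>\<pi>(exp tX) u - u = \<integral>\<^sub>0\<^sup>t \<pi>(exp sX) u\<^sub>X ds\<close>, so \<open>u\<close> is differentiable along one-parameter groups with
  derivative \<open>u\<^sub>X\<close>, which is linear in \<open>X\<close> and of the same kind. In coordinates the partial derivatives
  of \<open>g \<mapsto> \<pi>(g) u\<close> are therefore combinations, with smooth coefficients, of functions
  \<open>g \<mapsto> \<pi>(g) u\<^sub>X\<close>, and induction shows that these functions are \<open>C\<^sup>k\<close> for every \<open>k\<close>.
\<close>

section \<open>Functions of class \<open>C\<^sup>k\<close>\<close>

text \<open>The condition on \<open>v\<close> is tested only on smooth vectors, so it would say
  little in a representation with too few of them; this is why the Garding argument precedes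
  everything about \<open>v\<close>. The same density makes the enveloping algebra act: its elements
  are residue classes, and the bracket relation on smooth vectors is itself obtained by testing.
  Weak information about \<open>v\<close> cannot be differentiated directly. The integrated identity
  avoids this: paired with a smooth vector it is the fundamental theorem of calculus for a scalar
  function, and its integrand is norm continuous, so a strong derivative results. One criterion, the
  locale \<open>derivative_family\<close>, then serves twice: for Garding vectors with
  \<open>dpi_lie\<close>, and for vectors with all weak derivatives in the Hilbert space. Smoothness
  on the group means smoothness of local extensions to matrices; hence a smooth retraction onto the
  group is needed, and its existence rests on Cartan's theorem on closed subgroups.\<close>

lemma Ck_on_cong:
  assumes "Ck_on k q U" and U: "open U" and "\<And>x. x \<in> U \<Longrightarrow> p x = q x"
  shows "Ck_on k p U"
  using assms(1,3)
proof (induction k arbitrary: p q)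
  case 0
  then show ?case by (metis Ck_on.simps(1) continuous_on_cong)
next
  case (Suc k)
  have q': "(q has_derivative frechet_derivative q (at x)) (at x)" if "x \<in> U" for x
    using Suc.prems(1) that by (simp add: frechet_derivative_works)
  have p': "(p has_derivative frechet_derivative q (at x)) (at x)" if "x \<in> U" for x
    by (rule has_derivative_transform_within_open[OF q'[OF that] U that]) (simp add: Suc.prems)
  have "Ck_on k (\<lambda>x. frechet_derivative p (at x) h) U" for h
  proof (rule Suc.IH)
    show "Ck_on k (\<lambda>x. frechet_derivative q (at x) h) U" using Suc.prems by simp
    show "frechet_derivative p (at x) h = frechet_derivative q (at x) h" if "x \<in> U" for x
      using frechet_derivative_at[OF p'[OF that]] by simp
  qed
  with p' show ?case by (auto simp: differentiable_def)
qed

lemma Ck_on_SucI: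
  assumes U: "open U"
    and f': "\<And>x. x \<in> U \<Longrightarrow> (f has_derivative f' x) (at x)"
    and "\<And>h. Ck_on k (\<lambda>x. f' x h) U"
  shows "Ck_on (Suc k) f U"
proof -
  have "Ck_on k (\<lambda>x. frechet_derivative f (at x) h) U" for h
    by (rule Ck_on_cong[OF assms(3)[of h] U]) (use frechet_derivative_at[OF f'] in auto)
  with f' show ?thesis by (auto simp: differentiable_def)
qed

lemma Ck_on_SucD:
  assumes "Ck_on (Suc k) f U" "x \<in> U"
  shows "(f has_derivative frechet_derivative f (at x)) (at x)"
  using assms by (simp add: frechet_derivative_works)

lemma Ck_on_Suc_imp: "Ck_on (Suc k) f U \<Longrightarrow> Ck_on k f U"
proof (induction k arbitrary: f)
  case 0
  then show ?case
    by (auto intro!: continuous_at_imp_continuous_on differentiable_imp_continuous_within)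
next
  case (Suc k)
  then show ?case by simp
qed

lemma Ck_on_mono: "Ck_on k f U \<Longrightarrow> j \<le> k \<Longrightarrow> Ck_on j f U"
proof (induction k)
  case (Suc k)
  then show ?case by (metis Ck_on_Suc_imp le_Suc_eq)
qed simp

lemma Ck_on_continuous: "Ck_on k f U \<Longrightarrow> continuous_on U f"
  using Ck_on_mono[of k f U 0] by simp

lemma Ck_on_subset: "Ck_on k f U \<Longrightarrow> V \<subseteq> U \<Longrightarrow> Ck_on k f V"
  by (induction k arbitrary: f) (auto intro: continuous_on_subset)

lemma Ck_on_const [simp]: "Ck_on k (\<lambda>_. c) U"
  by (induction k arbitrary: c) auto

lemma Ck_on_linear:
  assumes "bounded_linear f" "open U"
  shows "Ck_on k f U"
proof (cases k)
  case 0
  then show ?thesis using assms by (simp add: linear_continuous_on)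
next
  case (Suc j)
  show ?thesis unfolding Suc
    by (rule Ck_on_SucI[where f' = "\<lambda>_. f"])
      (use assms in \<open>auto intro: bounded_linear_imp_has_derivative\<close>)
qed

lemma Ck_on_bounded_linear_compose:
  assumes L: "bounded_linear L" and U: "open U" and f: "Ck_on k f U"
  shows "Ck_on k (\<lambda>x. L (f x)) U"
  using f
proof (induction k arbitrary: f)
  case 0
  then show ?case using L by (simp add: bounded_linear.continuous_on)
next
  case (Suc k)
  show ?case
    by (rule Ck_on_SucI[where f' = "\<lambda>x h. L (frechet_derivative f (at x) h)", OF U])
      (use Suc in \<open>auto intro: bounded_linear.has_derivative[OF L] Ck_on_SucD[OF Suc.prems]\<close>)
qed

lemma Ck_on_add:
  assumes "open U" "Ck_on k f U" "Ck_on k g U"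
  shows "Ck_on k (\<lambda>x. f x + g x) U"
  using assms(2,3)
proof (induction k arbitrary: f g)
  case 0
  then show ?case by (simp add: continuous_on_add)
next
  case (Suc k)
  show ?case
    by (rule Ck_on_SucI[where f' = "\<lambda>x h. frechet_derivative f (at x) h + frechet_derivative g (at x) h",
          OF assms(1)])
      (use Suc in \<open>auto intro!: has_derivative_add Ck_on_SucD[OF Suc.prems(1)] Ck_on_SucD[OF Suc.prems(2)]\<close>)
qed

lemma Ck_on_sum:
  assumes "open U" "\<And>i. i \<in> I \<Longrightarrow> Ck_on k (f i) U"
  shows "Ck_on k (\<lambda>x. \<Sum>i\<in>I. f i x) U"
proof (cases "finite I")
  case True
  then show ?thesis using assms(2)
    by (induction I) (auto intro: Ck_on_add[OF assms(1)])
qed simp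

lemma Ck_on_minus:
  assumes "open U" "Ck_on k f U" shows "Ck_on k (\<lambda>x. - f x) U"
  using Ck_on_bounded_linear_compose[OF bounded_linear_minus[OF bounded_linear_ident] assms] by simp

lemma Ck_on_diff:
  assumes "open U" "Ck_on k f U" "Ck_on k g U"
  shows "Ck_on k (\<lambda>x. f x - g x) U"
  using Ck_on_add[OF assms(1,2) Ck_on_minus[OF assms(1,3)]] by simp

lemma Ck_on_bilinear:
  assumes B: "bounded_bilinear B" and U: "open U" and "Ck_on k f U" "Ck_on k g U"
  shows "Ck_on k (\<lambda>x. B (f x) (g x)) U"
  using assms(3,4)
proof (induction k arbitrary: f g)
  case 0
  then show ?case using B by (simp add: bounded_bilinear.continuous_on)
next
  case (Suc k)
  show ?case
  proof (rule Ck_on_SucI[where f' = "\<lambda>x h. B (f x) (frechet_derivative g (at x) h)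
        + B (frechet_derivative f (at x) h) (g x)", OF U])
    fix x assume "x \<in> U"
    then show "((\<lambda>x. B (f x) (g x)) has_derivative (\<lambda>h. B (f x) (frechet_derivative g (at x) h)
        + B (frechet_derivative f (at x) h) (g x))) (at x)"
      by (intro bounded_bilinear.FDERIV[OF B] Ck_on_SucD[OF Suc.prems(1)] Ck_on_SucD[OF Suc.prems(2)])
  next
    fix h
    show "Ck_on k (\<lambda>x. B (f x) (frechet_derivative g (at x) h)
        + B (frechet_derivative f (at x) h) (g x)) U"
      using Suc.prems by (intro Ck_on_add[OF U] Suc.IH Ck_on_Suc_imp[OF Suc.prems(1)]
          Ck_on_Suc_imp[OF Suc.prems(2)]) auto
  qed
qed

lemmas Ck_on_scaleR = Ck_on_bilinear[OF bounded_bilinear_scaleR]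
lemmas Ck_on_inner = Ck_on_bilinear[OF bounded_bilinear_inner]

text \<open>\<open>Ck_on\<close> controls derivatives only in a fixed direction \<open>h\<close>.
  When the direction moves with the point, as in the chain rule, this expansion reduces it to the
  finitely many fixed directions of a basis, with coefficients that carry the motion.\<close>

lemma linear_euclidean_expand:
  fixes L :: "'a::euclidean_space \<Rightarrow> 'b::real_normed_vector"
  assumes "linear L"
  shows "L x = (\<Sum>b\<in>Basis. (x \<bullet> b) *\<^sub>R L b)"
proof -
  have "L x = L (\<Sum>b\<in>Basis. (x \<bullet> b) *\<^sub>R b)" by (simp add: euclidean_representation)
  also have "\<dots> = (\<Sum>b\<in>Basis. (x \<bullet> b) *\<^sub>R L b)"
    using assms by (simp add: linear_sum linear_cmul)
  finally show ?thesis .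
qed

lemma Ck_on_compose:
  fixes f :: "'b::euclidean_space \<Rightarrow> 'c::real_normed_vector"
  assumes U: "open U" and "Ck_on k g U" and "Ck_on k f V" and V: "\<And>x. x \<in> U \<Longrightarrow> g x \<in> V"
  shows "Ck_on k (\<lambda>x. f (g x)) U"
  using assms(2,3)
proof (induction k arbitrary: f)
  case 0
  then show ?case using V by (auto intro: continuous_on_compose2)
next
  case (Suc k)
  let ?f' = "\<lambda>x. frechet_derivative f (at x)" and ?g' = "\<lambda>x. frechet_derivative g (at x)"
  show ?case
  proof (rule Ck_on_SucI[where f' = "\<lambda>x h. \<Sum>b\<in>Basis. (?g' x h \<bullet> b) *\<^sub>R ?f' (g x) b", OF U])
    fix x assume x: "x \<in> U"
    have df: "(f has_derivative ?f' (g x)) (at (g x))"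
      using Ck_on_SucD[OF Suc.prems(2) V[OF x]] .
    have "((\<lambda>x. f (g x)) has_derivative (\<lambda>h. ?f' (g x) (?g' x h))) (at x)"
      by (rule has_derivative_compose[OF Ck_on_SucD[OF Suc.prems(1) x] df])
    moreover have "?f' (g x) (?g' x h) = (\<Sum>b\<in>Basis. (?g' x h \<bullet> b) *\<^sub>R ?f' (g x) b)" for h
      by (rule linear_euclidean_expand[OF has_derivative_linear[OF df]])
    ultimately show "((\<lambda>x. f (g x)) has_derivative
        (\<lambda>h. \<Sum>b\<in>Basis. (?g' x h \<bullet> b) *\<^sub>R ?f' (g x) b)) (at x)" by simp
  next
    fix h
    show "Ck_on k (\<lambda>x. \<Sum>b\<in>Basis. (?g' x h \<bullet> b) *\<^sub>R ?f' (g x) b) U"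
      using Suc.prems
      by (intro Ck_on_sum[OF U] Ck_on_scaleR[OF U] Ck_on_inner[OF U] Suc.IH
          Ck_on_Suc_imp[OF Suc.prems(1)]) auto
  qed
qed

lemma Ck_on_compose_linear:
  assumes L: "bounded_linear L" and U: "open U" and "Ck_on k f V" and V: "\<And>x. x \<in> U \<Longrightarrow> L x \<in> V"
  shows "Ck_on k (\<lambda>x. f (L x)) U"
  using assms(3)
proof (induction k arbitrary: f)
  case 0
  then show ?case using V
    by (auto intro: continuous_on_compose2 linear_continuous_on[OF L])
next
  case (Suc k)
  show ?case
  proof (rule Ck_on_SucI[where f' = "\<lambda>x h. frechet_derivative f (at (L x)) (L h)", OF U])
    show "((\<lambda>x. f (L x)) has_derivative (\<lambda>h. frechet_derivative f (at (L x)) (L h))) (at x)"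
      if "x \<in> U" for x
      by (rule has_derivative_compose[OF bounded_linear_imp_has_derivative[OF L]
            Ck_on_SucD[OF Suc.prems V[OF that]]])
    show "Ck_on k (\<lambda>x. frechet_derivative f (at (L x)) (L h)) U" for h
      using Suc.prems by (intro Suc.IH) auto
  qed
qed

text \<open>The resolvent identity \<open>B y - B x = - B x (A y - A x) B y\<close>, written in
  coordinates of \<open>B y h\<close> so that \<open>A\<close> is compared only on fixed basis
  vectors, where its dependence on the point is known.\<close>

lemma inverse_operator_diff:
  fixes A B :: "'a \<Rightarrow> 'b::euclidean_space \<Rightarrow> 'b"
  assumes lin: "linear (A x)" "linear (A y)" "linear (B x)"
    and inv: "\<And>h. A y (B y h) = h" "\<And>h. B x (A x h) = h"
  shows "B y h - B x h = - (\<Sum>b\<in>Basis. (B y h \<bullet> b) *\<^sub>R B x (A y b - A x b))"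
proof -
  have "B y h - B x h = - B x (A y (B y h) - A x (B y h))"
    using inv linear_diff[OF lin(3)] by simp
  moreover have "A y (B y h) - A x (B y h) = (\<Sum>b\<in>Basis. (B y h \<bullet> b) *\<^sub>R (A y b - A x b))"
    using linear_euclidean_expand[OF lin(2), of "B y h"] linear_euclidean_expand[OF lin(1), of "B y h"]
    by (simp add: sum_subtractf scaleR_diff_right)
  ultimately show ?thesis by (simp add: linear_sum[OF lin(3)] linear_cmul[OF lin(3)])
qed

text \<open>The resolvent identity bounds the difference by
  \<open>norm (B y h) * \<epsilon> y\<close> with \<epsilon> tending to 0. No bound on
  \<open>B y\<close> is given, so the first factor has to be absorbed.\<close>

lemma continuous_on_inverse_operator:
  fixes A :: "'a::real_normed_vector \<Rightarrow> 'b::euclidean_space \<Rightarrow> 'b"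
  assumes U: "open U"
    and lin: "\<And>x. x \<in> U \<Longrightarrow> linear (A x)" and linB: "\<And>x. x \<in> U \<Longrightarrow> linear (B x)"
    and AB: "\<And>x h. x \<in> U \<Longrightarrow> A x (B x h) = h" and BA: "\<And>x h. x \<in> U \<Longrightarrow> B x (A x h) = h"
    and contA: "\<And>h. continuous_on U (\<lambda>x. A x h)"
  shows "continuous_on U (\<lambda>x. B x h)"
proof (rule continuous_at_imp_continuous_on, rule ballI)
  fix x assume x: "x \<in> U"
  have lB: "linear (B x)" by (rule linB[OF x])
  have bB: "bounded_linear (B x)" using lB by (simp add: linear_conv_bounded_linear)
  define \<epsilon> where "\<epsilon> y = (\<Sum>b\<in>Basis. norm (B x (A y b - A x b)))" for y
  have \<epsilon>0: "\<epsilon> y \<ge> 0" for y unfolding \<epsilon>_def by (simp add: sum_nonneg)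
  have bnd: "norm (B y h - B x h) \<le> norm (B y h) * \<epsilon> y" if y: "y \<in> U" for y
  proof -
    have "B y h - B x h = - (\<Sum>b\<in>Basis. (B y h \<bullet> b) *\<^sub>R B x (A y b - A x b))"
      by (rule inverse_operator_diff[OF lin[OF x] lin[OF y] lB AB[OF y] BA[OF x]])
    then have "norm (B y h - B x h) = norm (\<Sum>b\<in>Basis. (B y h \<bullet> b) *\<^sub>R B x (A y b - A x b))"
      by (simp only: norm_minus_cancel)
    also have "\<dots> \<le> (\<Sum>b\<in>Basis. norm ((B y h \<bullet> b) *\<^sub>R B x (A y b - A x b)))"
      by (rule norm_sum)
    also have "\<dots> \<le> (\<Sum>b\<in>Basis. norm (B y h) * norm (B x (A y b - A x b)))"
      by (intro sum_mono) (auto intro!: mult_right_mono Basis_le_norm)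
    finally show ?thesis by (simp add: \<epsilon>_def sum_distrib_left)
  qed
  have "((\<lambda>y. A y b - A x b) \<longlongrightarrow> A x b - A x b) (at x)" for b
    using contA[of b] U x
    by (intro tendsto_intros) (simp add: continuous_on_eq_continuous_at isCont_def)
  then have "((\<lambda>y. B x (A y b - A x b)) \<longlongrightarrow> B x 0) (at x)" for b
    using bounded_linear.tendsto[OF bB, of "\<lambda>y. A y b - A x b" 0] by simp
  then have "(\<epsilon> \<longlongrightarrow> (\<Sum>b\<in>(Basis::'b set). norm (B x 0))) (at x)"
    unfolding \<epsilon>_def by (intro tendsto_intros)
  then have lim: "(\<epsilon> \<longlongrightarrow> 0) (at x)" by (simp add: linear_0[OF lB])
  \<comment> \<open>Below 1/2 the triangle inequality gives
    \<open>norm (B y h) \<le> 2 * norm (B x h)\<close>, which removes the unknown \<open>B y\<close>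
    from the bound.\<close>
  then have small: "\<forall>\<^sub>F y in at x. \<epsilon> y < 1/2" by (rule order_tendstoD) simp
  have inU: "\<forall>\<^sub>F y in at x. y \<in> U" using U x by (metis eventually_at_topological)
  have "((\<lambda>y. B y h - B x h) \<longlongrightarrow> 0) (at x)"
  proof (rule Lim_null_comparison)
    show "\<forall>\<^sub>F y in at x. norm (B y h - B x h) \<le> 2 * norm (B x h) * \<epsilon> y"
      using small inU
    proof eventually_elim
      case (elim y)
      have "norm (B y h) \<le> norm (B x h) + norm (B y h - B x h)"
        by (metis add.commute diff_add_cancel norm_triangle_ineq)
      also have "\<dots> \<le> norm (B x h) + norm (B y h) * (1/2)"
        using bnd[OF elim(2)] elim(1) mult_left_mono[of "\<epsilon> y" "1/2" "norm (B y h)"] by simp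
      finally have "norm (B y h) \<le> 2 * norm (B x h)" by simp
      then show ?case using bnd[OF elim(2)] mult_right_mono[OF _ \<epsilon>0[of y]] by (meson order_trans)
    qed
    show "((\<lambda>y. 2 * norm (B x h) * \<epsilon> y) \<longlongrightarrow> 0) (at x)"
      using tendsto_mult_right_zero[OF lim] .
  qed
  then show "isCont (\<lambda>x. B x h) x" by (simp add: isCont_def LIM_zero_iff)
qed

text \<open>A product rule in which one factor is merely continuous; this suffices where the other
  factor vanishes. In the differentiation of an inverse operator the continuous factor is a
  coordinate of \<open>B y h\<close>, whose differentiability is the claim itself and cannot be
  assumed.\<close>

lemma has_derivative_scaleR_vanishing:
  assumes c: "(c \<longlongrightarrow> c x) (at x)" and D: "(D has_derivative D') (at x)" and D0: "D x = 0"
  shows "((\<lambda>y. c y *\<^sub>R D y) has_derivative (\<lambda>h. c x *\<^sub>R D' h)) (at x)"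
proof -
  have bl: "bounded_linear D'" by (rule has_derivative_bounded_linear[OF D])
  obtain K where K: "\<And>h. norm (D' h) \<le> norm h * K" using bounded_linear.bounded[OF bl] by blast
  let ?r = "\<lambda>y. (D y - D' (y - x)) /\<^sub>R norm (y - x)"
  have "(?r \<longlongrightarrow> 0) (at x)" using D by (simp add: has_derivative_at_within D0)
  from tendsto_scaleR[OF c this] have 1: "((\<lambda>y. c y *\<^sub>R ?r y) \<longlongrightarrow> 0) (at x)" by simp
  have 2: "((\<lambda>y. (c y - c x) *\<^sub>R (D' (y - x) /\<^sub>R norm (y - x))) \<longlongrightarrow> 0) (at x)"
  proof (rule Lim_null_comparison)
    show "\<forall>\<^sub>F y in at x. norm ((c y - c x) *\<^sub>R (D' (y - x) /\<^sub>R norm (y - x))) \<le> \<bar>c y - c x\<bar> * K"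
      unfolding eventually_at_filter
    proof (intro always_eventually allI impI)
      fix y assume "y \<noteq> x"
      then have "norm (D' (y - x) /\<^sub>R norm (y - x)) \<le> K" using K[of "y - x"] by (simp add: field_simps)
      then show "norm ((c y - c x) *\<^sub>R (D' (y - x) /\<^sub>R norm (y - x))) \<le> \<bar>c y - c x\<bar> * K"
        by (simp only: norm_scaleR mult_left_mono abs_ge_zero)
    qed
    show "((\<lambda>y. \<bar>c y - c x\<bar> * K) \<longlongrightarrow> 0) (at x)"
      by (rule tendsto_mult_left_zero[OF tendsto_rabs_zero[OF LIM_zero[OF c]]])
  qed
  have "(c y *\<^sub>R D y - c x *\<^sub>R D x - c x *\<^sub>R D' (y - x)) /\<^sub>R norm (y - x)
      = c y *\<^sub>R ?r y + (c y - c x) *\<^sub>R (D' (y - x) /\<^sub>R norm (y - x))" for y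
    by (simp add: D0 algebra_simps)
  then show ?thesis
    using tendsto_add[OF 1 2] bl
    by (simp add: has_derivative_at_within bounded_linear_compose[OF bounded_linear_scaleR_right])
qed

text \<open>Differentiating \<open>A(x)\<inverse>h\<close> gives \<open>- A(x)\<inverse> A'(x) A(x)\<inverse> h\<close>; in coordinates this is a polynomial in
  functions of the same kind and in the first derivatives of \<open>A\<close>.\<close>

lemma Ck_on_inverse_operator:
  fixes A :: "'a::real_normed_vector \<Rightarrow> 'b::euclidean_space \<Rightarrow> 'b"
  assumes U: "open U"
    and lin: "\<And>x. x \<in> U \<Longrightarrow> linear (A x)" and linB: "\<And>x. x \<in> U \<Longrightarrow> linear (B x)"
    and AB: "\<And>x h. x \<in> U \<Longrightarrow> A x (B x h) = h" and BA: "\<And>x h. x \<in> U \<Longrightarrow> B x (A x h) = h"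
    and "\<And>h. Ck_on k (\<lambda>x. A x h) U"
  shows "Ck_on k (\<lambda>x. B x h) U"
  using assms(6)
proof (induction k arbitrary: h)
  case 0
  then show ?case
    using continuous_on_inverse_operator[of U A B h, OF U lin linB AB BA] by simp
next
  case (Suc k)
  let ?A' = "\<lambda>x c b. frechet_derivative (\<lambda>x. A x b) (at x) c"
  let ?B' = "\<lambda>x c. - (\<Sum>b\<in>Basis. (B x h \<bullet> b) *\<^sub>R (\<Sum>e\<in>Basis. (?A' x c b \<bullet> e) *\<^sub>R B x e))"
  show ?case
  proof (rule Ck_on_SucI[where f' = "?B'", OF U])
    fix x assume x: "x \<in> U"
    have dA: "((\<lambda>x. A x b) has_derivative (\<lambda>c. ?A' x c b)) (at x)" for b
      by (rule Ck_on_SucD[OF Suc.prems x])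
    have lB: "linear (B x)" by (rule linB[OF x])
    have bB: "bounded_linear (B x)" using lB by (simp add: linear_conv_bounded_linear)
    have Bexp: "(\<Sum>e\<in>Basis. (y \<bullet> e) *\<^sub>R B x e) = B x y" for y
      by (rule linear_euclidean_expand[symmetric, OF lB])
    have cB: "((\<lambda>y. B y h) \<longlongrightarrow> B x h) (at x)"
      using continuous_on_inverse_operator[of U A B h, OF U lin linB AB BA Ck_on_continuous[OF Suc.prems]] U x
      by (simp add: continuous_on_eq_continuous_at isCont_def)
    have key: "B y h - B x h = - (\<Sum>b\<in>Basis. (B y h \<bullet> b) *\<^sub>R B x (A y b - A x b))" if "y \<in> U" for y
      by (rule inverse_operator_diff[OF lin[OF x] lin[OF that] lB AB[OF that] BA[OF x]])
    have one: "((\<lambda>y. (B y h \<bullet> b) *\<^sub>R B x (A y b - A x b)) has_derivative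
        (\<lambda>c. (B x h \<bullet> b) *\<^sub>R B x (?A' x c b))) (at x)" for b
    proof (rule has_derivative_scaleR_vanishing)
      show "((\<lambda>y. B y h \<bullet> b) \<longlongrightarrow> B x h \<bullet> b) (at x)" by (intro tendsto_intros cB)
      show "((\<lambda>y. B x (A y b - A x b)) has_derivative (\<lambda>c. B x (?A' x c b))) (at x)"
        using bounded_linear.has_derivative[OF bB has_derivative_diff[OF dA[of b] has_derivative_const]] by simp
    qed (simp add: linear_0[OF lB])
    have "((\<lambda>y. B x h - (\<Sum>b\<in>Basis. (B y h \<bullet> b) *\<^sub>R B x (A y b - A x b))) has_derivative
        (\<lambda>c. 0 - (\<Sum>b\<in>Basis. (B x h \<bullet> b) *\<^sub>R B x (?A' x c b)))) (at x)"
      by (intro has_derivative_diff has_derivative_const has_derivative_sum one)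
    then have "((\<lambda>y. B y h) has_derivative (\<lambda>c. 0 - (\<Sum>b\<in>Basis. (B x h \<bullet> b) *\<^sub>R B x (?A' x c b)))) (at x)"
    proof (rule has_derivative_transform_within_open[OF _ U x])
      fix y assume "y \<in> U"
      from key[OF this]
      show "B x h - (\<Sum>b\<in>Basis. (B y h \<bullet> b) *\<^sub>R B x (A y b - A x b)) = B y h"
        by (simp add: algebra_simps)
    qed
    then have "((\<lambda>y. B y h) has_derivative (\<lambda>c. - (\<Sum>b\<in>Basis. (B x h \<bullet> b) *\<^sub>R B x (?A' x c b)))) (at x)"
      by simp
    then show "((\<lambda>y. B y h) has_derivative ?B' x) (at x)"
      by (simp only: Bexp)
  next
    fix c
    have "Ck_on k (\<lambda>x. A x b) U" for b using Suc.prems Ck_on_Suc_imp by blast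
    then have "Ck_on k (\<lambda>x. B x e) U" for e by (rule Suc.IH)
    then show "Ck_on k (\<lambda>x. ?B' x c) U"
      using Suc.prems by (intro Ck_on_minus[OF U] Ck_on_sum[OF U] Ck_on_scaleR[OF U] Ck_on_inner[OF U]) auto
  qed
qed

text \<open>The derivative of the integral in direction \<open>h\<close> is an integral of the same
  form, with \<open>g\<close> replaced by its derivative in the fixed direction
  \<open>(0, h)\<close>; so the induction stays within one family. The derivative of the matrix
  exponential will be such an integral.\<close>

lemma Ck_on_integral:
  fixes g :: "real \<times> 'a::euclidean_space \<Rightarrow> 'b::banach"
  assumes "Ck_on k g UNIV"
  shows "Ck_on k (\<lambda>x. integral {0..1} (\<lambda>s. g (s, x))) UNIV"
  using assms
proof (induction k arbitrary: g)
  case 0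
  have "continuous_on (UNIV \<times> cbox 0 1) (\<lambda>(x, s). g (s, x))"
    unfolding case_prod_unfold using 0
    by (auto intro!: continuous_on_compose2[of UNIV g] continuous_intros)
  from integral_continuous_on_param[OF this] show ?case by simp
next
  case (Suc k)
  define g' where "g' p = frechet_derivative g (at p)" for p
  have g': "(g has_derivative g' p) (at p)" for p
    using Ck_on_SucD[OF Suc.prems] by (simp add: g'_def)
  have cg: "continuous_on UNIV g" by (rule Ck_on_continuous[OF Suc.prems])
  have Ckg': "Ck_on k (\<lambda>p. g' p h) UNIV" for h
    unfolding g'_def using Suc.prems unfolding Ck_on.simps by blast
  have cg': "continuous_on UNIV (\<lambda>p. g' p h)" for h by (rule Ck_on_continuous[OF Ckg'])
  \<comment> \<open>The Leibniz rule asks for a derivative that is continuous in operator norm; in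
    finite dimension continuity on basis vectors is enough.\<close>
  define G where "G x s = Blinfun (\<lambda>h. g' (s, x) (0, h))" for x s
  have bl: "bounded_linear (\<lambda>h. g' (s, x) (0, h))" for s x
    by (rule bounded_linear_compose[OF has_derivative_bounded_linear[OF g']])
      (intro bounded_linear_Pair bounded_linear_zero bounded_linear_ident)
  have G: "blinfun_apply (G x s) h = g' (s, x) (0, h)" for x s h
    unfolding G_def by (simp add: bounded_linear_Blinfun_apply[OF bl])
  have dG: "((\<lambda>x. g (s, x)) has_derivative blinfun_apply (G x s)) (at x within UNIV)" for x s
  proof -
    have "((\<lambda>x. g (s, x)) has_derivative (\<lambda>h. g' (s, x) (0, h))) (at x)"
      by (rule has_derivative_compose[OF _ g']) (auto intro!: derivative_eq_intros)
    then show ?thesis by (simp add: G[abs_def])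
  qed
  have contG: "continuous_on (UNIV \<times> cbox 0 1) (\<lambda>(x, s). G x s)"
    unfolding case_prod_unfold
  proof (rule continuous_on_blinfun_componentwise)
    fix i :: 'a
    show "continuous_on (UNIV \<times> cbox 0 1) (\<lambda>p. blinfun_apply (G (fst p) (snd p)) i)"
      unfolding G
      by (rule continuous_on_compose2[OF cg'[of "(0, i)"], where f = "\<lambda>p. (snd p, fst p)"])
        (auto intro!: continuous_intros)
  qed
  have int: "(\<lambda>s. g (s, x)) integrable_on cbox 0 1" for x
    by (rule integrable_continuous)
      (auto intro!: continuous_on_compose2[OF cg] continuous_intros)
  have Gint: "G x integrable_on cbox 0 1" for x
  proof (rule integrable_continuous)
    show "continuous_on (cbox 0 1) (G x)"
      using continuous_on_compose2[OF contG, of "cbox 0 1" "\<lambda>s. (x, s)"] by (auto simp: continuous_on_Pair)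
  qed
  show ?case
  proof (rule Ck_on_SucI[where f' = "\<lambda>x h. integral {0..1} (\<lambda>s. g' (s, x) (0, h))"])
    fix x
    have "((\<lambda>x. integral (cbox 0 1) (\<lambda>s. g (s, x))) has_derivative integral (cbox 0 1) (G x)) (at x within UNIV)"
      by (rule leibniz_rule[OF dG int contG]) auto
    moreover have "blinfun_apply (integral (cbox 0 1) (G x)) = (\<lambda>h. integral {0..1} (\<lambda>s. g' (s, x) (0, h)))"
      by (rule ext, subst blinfun_apply_integral[OF Gint]) (simp add: G)
    ultimately show "((\<lambda>x. integral {0..1} (\<lambda>s. g (s, x))) has_derivative
        (\<lambda>h. integral {0..1} (\<lambda>s. g' (s, x) (0, h)))) (at x)" by simp
  next
    fix h
    show "Ck_on k (\<lambda>x. integral {0..1} (\<lambda>s. g' (s, x) (0, h))) UNIV"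
      by (rule Suc.IH[OF Ckg'])
  qed simp
qed

text \<open>Bootstrapping: the inverse function theorem makes \<open>g\<close> differentiable with
  \<open>g' y\<close> inverse to the derivative of \<open>f\<close> at \<open>g y\<close>. If
  \<open>g\<close> is of class \<open>C^k\<close>, so is this derivative and hence its inverse
  \<open>g'\<close>, which makes \<open>g\<close> of class \<open>C^(k+1)\<close>. The maps to be
  inverted, \<open>matrix_exp\<close> and \<open>tube\<close> at 0, both have the identity as
  derivative.\<close>

lemma smooth_local_inverse:
  fixes f :: "'a::euclidean_space \<Rightarrow> 'a"
  assumes U: "open U" "x0 \<in> U" and f: "\<And>k. Ck_on k f U"
    and id: "(f has_derivative (\<lambda>h. h)) (at x0)"
  obtains U' V g where "open U'" "U' \<subseteq> U" "x0 \<in> U'" "open V" "f x0 \<in> V" "homeomorphism U' V f g"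
    "\<And>k. Ck_on k g V" "(g has_derivative (\<lambda>h. h)) (at (f x0))"
proof -
  define f' where "f' x = Blinfun (frechet_derivative f (at x))" for x
  have df: "(f has_derivative frechet_derivative f (at x)) (at x)" if "x \<in> U" for x
    using Ck_on_SucD[OF f that] .
  have app: "blinfun_apply (f' x) = frechet_derivative f (at x)" if "x \<in> U" for x
    unfolding f'_def
    by (rule bounded_linear_Blinfun_apply[OF has_derivative_bounded_linear[OF df[OF that]]])
  have Ck': "Ck_on k (\<lambda>x. frechet_derivative f (at x) h) U" for k h using f[of "Suc k"] by simp
  have contf': "continuous_on U f'"
  proof (rule continuous_on_blinfun_componentwise)
    fix i :: 'a
    have "continuous_on U (\<lambda>x. frechet_derivative f (at x) i)" by (rule Ck_on_continuous[OF Ck'])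
    then show "continuous_on U (\<lambda>x. blinfun_apply (f' x) i)"
      using continuous_on_cong[of U U "\<lambda>x. blinfun_apply (f' x) i" "\<lambda>x. frechet_derivative f (at x) i"]
        app by metis
  qed
  have fd0: "frechet_derivative f (at x0) = (\<lambda>h. h)" using frechet_derivative_at[OF id] by simp
  have inv0: "id_blinfun o\<^sub>L f' x0 = id_blinfun"
    by (rule blinfun_eqI) (simp add: app[OF U(2)] fd0)
  have dfb: "(f has_derivative blinfun_apply (f' x)) (at x)" if "x \<in> U" for x
    using df[OF that] app[OF that] by simp
  obtain U' V g g' where *: "open U'" "U' \<subseteq> U" "x0 \<in> U'" "open V" "f x0 \<in> V" "homeomorphism U' V f g"
    and dg: "\<And>y. y \<in> V \<Longrightarrow> (g has_derivative (g' y)) (at y)"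
    and g': "\<And>y. y \<in> V \<Longrightarrow> g' y = inv_into UNIV (blinfun_apply (f'(g y)))"
    and bij: "\<And>y. y \<in> V \<Longrightarrow> bij (blinfun_apply (f'(g y)))"
    using inverse_function_theorem[OF U(1) dfb contf' U(2) inv0] by metis
  have gU: "g y \<in> U" if "y \<in> V" for y
    using *(2,6) that by (auto simp: homeomorphism_def)
  let ?A = "\<lambda>y. frechet_derivative f (at (g y))"
  have AB: "?A y (g' y h) = h" and BA: "g' y (?A y h) = h" if "y \<in> V" for y h
    using bij[OF that] g'[OF that] app[OF gU[OF that]]
    by (auto simp: bij_def surj_f_inv_f inv_f_f)
  have lA: "linear (?A y)" if "y \<in> V" for y by (rule has_derivative_linear[OF df[OF gU[OF that]]])
  have lB: "linear (g' y)" if "y \<in> V" for y by (rule has_derivative_linear[OF dg[OF that]])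
  have contg: "continuous_on V g" using *(6) by (simp add: homeomorphism_def)
  have CA: "Ck_on k (\<lambda>y. ?A y h) V" if "Ck_on k g V" for k h
    by (rule Ck_on_compose[OF *(4) that Ck' gU])
  have Ckg: "Ck_on k g V" for k
  proof (induction k)
    case 0
    then show ?case using contg by simp
  next
    case (Suc k)
    show ?case
    proof (rule Ck_on_SucI[where f' = g', OF *(4) dg])
      show "Ck_on k (\<lambda>y. g' y h) V" for h
        by (rule Ck_on_inverse_operator[where A = ?A and B = g', OF *(4) lA lB AB BA CA[OF Suc]])
    qed
  qed
  have "g (f x0) = x0" using *(3,6) by (auto simp: homeomorphism_def)
  then have "g' (f x0) = (\<lambda>h. h)"
    using AB[OF *(5)] by (auto simp: fd0)
  with dg[OF *(5)] have "(g has_derivative (\<lambda>h. h)) (at (f x0))" by simp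
  with * Ckg show thesis using that by blast
qed

section \<open>Compactly supported smooth functions\<close>

text \<open>The derivatives of \<open>exp (- 1/x)\<close> are combinations of these functions, so
  smoothness follows by induction on the order with \<open>m\<close> arbitrary. The case
  \<open>m = 0\<close> is the flat function from which bumps are made.\<close>

definition flat_exp :: "nat \<Rightarrow> real \<Rightarrow> real" where
  "flat_exp m x = (if x > 0 then inverse x ^ m * exp (- inverse x) else 0)"

lemma flat_exp_tendsto_0: "(flat_exp m \<longlongrightarrow> 0) (at 0)"
proof -
  have "((\<lambda>x::real. inverse x ^ m / exp (inverse x)) \<longlongrightarrow> 0) (at_right 0)"
    by (rule filterlim_compose[OF tendsto_power_div_exp_0 filterlim_inverse_at_top_right])
  then have r: "(flat_exp m \<longlongrightarrow> 0) (at_right 0)"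
    by (rule tendsto_cong[THEN iffD1, rotated])
      (auto simp: flat_exp_def exp_minus divide_inverse eventually_at_filter)
  have l: "(flat_exp m \<longlongrightarrow> 0) (at_left 0)"
    by (rule tendsto_cong[THEN iffD1, OF _ tendsto_const])
      (auto simp: flat_exp_def eventually_at_filter)
  show ?thesis using filterlim_split_at[OF l r] .
qed

lemma has_derivative_flat_exp:
  "(flat_exp m has_real_derivative flat_exp (m + 2) x - m * flat_exp (m + 1) x) (at x)"
proof (cases x "0::real" rule: linorder_cases)
  case less
  have "((\<lambda>_. 0) has_real_derivative 0) (at x)" by simp
  then have "(flat_exp m has_real_derivative 0) (at x)"
    by (rule DERIV_cong_ev[THEN iffD1, rotated -1])
      (use less in \<open>auto simp: flat_exp_def eventually_nhds intro!: exI[of _ "{..<0}"]\<close>)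
  then show ?thesis using less by (simp add: flat_exp_def)
next
  case equal
  have "flat_exp m h / h = flat_exp (m + 1) h" for h
    by (simp add: flat_exp_def field_simps)
  then show ?thesis
    using flat_exp_tendsto_0[of "m + 1"] equal
    by (simp add: has_field_derivative_iff flat_exp_def[of _ 0])
next
  case greater
  have "((\<lambda>x. inverse x ^ m * exp (- inverse x)) has_real_derivative
      real m * (inverse x ^ (m - 1) * - (inverse x)\<^sup>2) * exp (- inverse x)
        + exp (- inverse x) * (inverse x)\<^sup>2 * inverse x ^ m) (at x)"
    using greater by (auto intro!: derivative_eq_intros simp: power2_eq_square)
  then have "((\<lambda>x. inverse x ^ m * exp (- inverse x)) has_real_derivative
      flat_exp (m + 2) x - m * flat_exp (m + 1) x) (at x)"
    by (rule DERIV_cong)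
      (use greater in \<open>cases m; auto simp: flat_exp_def power2_eq_square algebra_simps\<close>)
  then show ?thesis
    by (rule DERIV_cong_ev[THEN iffD1, rotated -1])
      (use greater in \<open>auto simp: flat_exp_def eventually_nhds intro!: exI[of _ "{0<..}"]\<close>)
qed

lemma Ck_on_flat_exp: "Ck_on k (flat_exp m) UNIV"
proof (induction k arbitrary: m)
  case 0
  have "isCont (flat_exp m) x" for x using has_derivative_flat_exp DERIV_isCont by blast
  then show ?case by (simp add: continuous_at_imp_continuous_on)
next
  case (Suc k)
  show ?case
  proof (rule Ck_on_SucI[where f' = "\<lambda>x h. h *\<^sub>R (flat_exp (m + 2) x - m *\<^sub>R flat_exp (m + 1) x)"])
    show "(flat_exp m has_derivative (\<lambda>h. h *\<^sub>R (flat_exp (m + 2) x - m *\<^sub>R flat_exp (m + 1) x))) (at x)" for x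
      using has_derivative_flat_exp[of m x]
      by (simp add: has_field_derivative_def mult.commute[of _ "flat_exp _ x - _"])
  next
    fix h
    show "Ck_on k (\<lambda>x. h *\<^sub>R (flat_exp (m + 2) x - m *\<^sub>R flat_exp (m + 1) x)) UNIV"
      by (intro Ck_on_bounded_linear_compose[OF bounded_linear_scaleR_right] Ck_on_diff Suc open_UNIV)
  qed simp
qed

lemma smooth_bump_exists:
  fixes c :: "'a::euclidean_space"
  assumes "r > 0"
  obtains \<phi> :: "'a \<Rightarrow> real" where "\<And>k. Ck_on k \<phi> UNIV" "\<And>x. x \<notin> cball c r \<Longrightarrow> \<phi> x = 0"
    "\<And>x. \<phi> x \<ge> 0" "\<phi> c > 0"
proof
  define \<phi> where "\<phi> x = flat_exp 0 (r\<^sup>2 - (x - c) \<bullet> (x - c))" for x :: 'a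
  have id: "Ck_on k (\<lambda>x. x - c) (UNIV :: 'a set)" for k
    by (intro Ck_on_diff Ck_on_const Ck_on_linear bounded_linear_ident open_UNIV)
  have "Ck_on k (\<lambda>x. r\<^sup>2 - (x - c) \<bullet> (x - c)) (UNIV :: 'a set)" for k
    by (intro Ck_on_diff Ck_on_const Ck_on_inner open_UNIV id)
  then show "Ck_on k \<phi> UNIV" for k
    unfolding \<phi>_def by (rule Ck_on_compose[OF open_UNIV _ Ck_on_flat_exp]) auto
  show "\<phi> x = 0" if "x \<notin> cball c r" for x
  proof -
    have "r\<^sup>2 < (norm (x - c))\<^sup>2" using that assms by (intro power_strict_mono) (auto simp: dist_norm norm_minus_commute)
    then show ?thesis by (simp add: \<phi>_def flat_exp_def power2_norm_eq_inner)
  qed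
  show "\<phi> x \<ge> 0" for x by (simp add: \<phi>_def flat_exp_def)
  show "\<phi> c > 0" using assms by (simp add: \<phi>_def flat_exp_def)
qed

text \<open>Translation invariance of the integral: for small \<open>t\<close> the support of the
  translate \<open>F (x + t e)\<close> stays in the box, so \<open>J t\<close> is constant, while
  differentiation under the integral at \<open>t = 0\<close> gives the integral in question.\<close>

lemma integral_directional_derivative_eq_0:
  fixes F :: "'a::euclidean_space \<Rightarrow> 'b::banach"
  assumes F: "Ck_on 1 F UNIV" and supp: "\<And>x. x \<notin> cball c r \<Longrightarrow> F x = 0"
    and "r < R" and box: "cball c R \<subseteq> cbox a b"
  shows "integral (cbox a b) (\<lambda>x. frechet_derivative F (at x) e) = 0"
proof -
  let ?F' = "\<lambda>x. frechet_derivative F (at x)"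
  have dF: "(F has_derivative ?F' x) (at x)" for x
    using Ck_on_SucD[of 0 F UNIV x] F by simp
  have cF: "continuous_on UNIV F" by (rule Ck_on_continuous[OF F])
  have cF': "continuous_on UNIV (\<lambda>x. ?F' x e)" using F by simp
  define J where "J t = integral (cbox a b) (\<lambda>x. F (x + t *\<^sub>R e))" for t :: real
  have dJ: "(J has_vector_derivative integral (cbox a b) (\<lambda>x. ?F' (x + 0 *\<^sub>R e) e)) (at 0 within UNIV)"
    unfolding J_def
  proof (rule leibniz_rule_vector_derivative)
    fix x t assume "t \<in> cbox a b"
    have "((\<lambda>x. F (t + x *\<^sub>R e)) has_derivative (\<lambda>h. ?F' (t + x *\<^sub>R e) (h *\<^sub>R e))) (at x)"
      by (rule has_derivative_compose[OF _ dF]) (auto intro!: derivative_eq_intros)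
    then show "((\<lambda>x. F (t + x *\<^sub>R e)) has_vector_derivative ?F' (t + x *\<^sub>R e) e) (at x within UNIV)"
      using linear_cmul[OF has_derivative_linear[OF dF]] by (simp add: has_vector_derivative_def)
  next
    show "(\<lambda>t. F (t + x *\<^sub>R e)) integrable_on cbox a b" for x
      by (intro integrable_continuous continuous_on_compose2[OF cF] continuous_intros) auto
    show "continuous_on (UNIV \<times> cbox a b) (\<lambda>(x, t). ?F' (t + x *\<^sub>R e) e)"
      unfolding case_prod_unfold
      by (intro continuous_on_compose2[OF cF'] continuous_intros) auto
  qed auto
  have const: "J t = J 0" if t: "norm (t *\<^sub>R e) < R - r" for t
  proof -
    have F0: "F x = 0" if "x \<notin> cbox a b" for x
      using box \<open>r < R\<close> that subset_cball[of r R c] by (intro supp) auto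
    have Ft0: "F (x + t *\<^sub>R e) = 0" if "x \<notin> cbox a b" for x
    proof (rule supp, rule notI)
      assume "x + t *\<^sub>R e \<in> cball c r"
      then have "dist c x \<le> r + norm (t *\<^sub>R e)"
        using dist_triangle[of c x "x + t *\<^sub>R e"] by (simp add: dist_norm)
      then have "x \<in> cball c R" using t by simp
      then show False using that box by auto
    qed
    have "(F has_integral J 0) (cbox a b)"
      unfolding J_def using integrable_integral[OF integrable_continuous[OF continuous_on_subset[OF cF]]] by simp
    from has_integral_affinity[OF this, of 1 "t *\<^sub>R e"]
    have "((\<lambda>x. F (x + t *\<^sub>R e)) has_integral J 0) ((\<lambda>x. x - t *\<^sub>R e) ` cbox a b)" by simp
    \<comment> \<open>The substitution moves the box along with the integrand. Both integrals are
      therefore extended by zero to the whole space, where they can be compared.\<close>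
    then have "((\<lambda>x. F (x + t *\<^sub>R e)) has_integral J 0) UNIV"
    proof (rule has_integral_on_superset)
      show "F (x + t *\<^sub>R e) = 0" if "x \<notin> (\<lambda>x. x - t *\<^sub>R e) ` cbox a b" for x
        using that F0[of "x + t *\<^sub>R e"] image_eqI[of x "\<lambda>x. x - t *\<^sub>R e" "x + t *\<^sub>R e" "cbox a b"] by auto
    qed auto
    moreover have "((\<lambda>x. F (x + t *\<^sub>R e)) has_integral J t) (cbox a b)"
      unfolding J_def
      by (intro integrable_integral integrable_continuous continuous_on_compose2[OF cF] continuous_intros) auto
    then have "((\<lambda>x. F (x + t *\<^sub>R e)) has_integral J t) UNIV"
      by (rule has_integral_on_superset) (use Ft0 in auto)
    ultimately show ?thesis using has_integral_unique by blast
  qed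
  have "(J has_vector_derivative 0) (at 0)"
  proof (rule has_vector_derivative_transform_within_open[where f = "\<lambda>_. J 0" and S = "{t. norm (t *\<^sub>R e) < R - r}"])
    show "open {t. norm (t *\<^sub>R e) < R - r}"
      by (intro open_Collect_less continuous_intros)
    show "J 0 = J t" if "t \<in> {t. norm (t *\<^sub>R e) < R - r}" for t
      using const[of t] that by simp
  qed (use \<open>r < R\<close> in auto)
  from vector_derivative_unique_at[OF this] dJ show ?thesis by simp
qed

section \<open>The exponential of complex matrices\<close>

lemma bounded_bilinear_matrix_mult:
  "bounded_bilinear ((**) :: complex^'n^'n \<Rightarrow> complex^'n^'n \<Rightarrow> complex^'n^'n)"
proof -
  have "linear (\<lambda>B. A ** B)" "linear (\<lambda>B. B ** A)" for A :: "complex^'n^'n"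
    by (intro linearI; simp add: matrix_matrix_mult_def Finite_Cartesian_Product.vec_eq_iff sum.distrib algebra_simps scaleR_sum_right)+
  then show ?thesis
    unfolding bilinear_conv_bounded_bilinear[symmetric] bilinear_def by blast
qed

interpretation mm: bounded_bilinear "(**) :: complex^'n^'n \<Rightarrow> complex^'n^'n \<Rightarrow> complex^'n^'n"
  by (rule bounded_bilinear_matrix_mult)

lemma matrix_mult_bounded:
  obtains K where "K > 0" "\<And>(A :: complex^'n^'n) (B :: complex^'n^'n). norm (A ** B) \<le> norm A * norm B * K"
proof -
  have "\<exists>K>0. \<forall>(A :: complex^'n^'n) (B :: complex^'n^'n). norm (A ** B) \<le> norm A * norm B * K"
    using bounded_bilinear.pos_bounded[OF bounded_bilinear_matrix_mult] by auto
  then show thesis using that by auto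
qed

text \<open>Bounded operators form a Banach algebra, which lends its exponential series to matrices;
  the matrix norm of \<open>complex^'n^'n\<close> does not satisfy \<open>norm 1 = 1\<close>.\<close>

typedef (overloaded) 'a bop = "UNIV :: ('a::real_normed_vector \<Rightarrow>\<^sub>L 'a) set"
  morphisms bop_fun Bop by simp

lemma bop_fun_Bop [simp]: "bop_fun (Bop f) = f" by (simp add: Bop_inverse)
lemma blinfun_eq_iff': "f = g \<longleftrightarrow> (\<forall>x. blinfun_apply f x = blinfun_apply g x)"
  by (auto intro: blinfun_eqI)

lemma bop_eq_iff: "f = g \<longleftrightarrow> bop_fun f = bop_fun g" by (simp add: bop_fun_inject)

instantiation bop :: (euclidean_space) real_normed_algebra_1
begin

definition "0 = Bop 0"
definition "1 = Bop id_blinfun"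
definition "f + g = Bop (bop_fun f + bop_fun g)"
definition "f - g = Bop (bop_fun f - bop_fun g)"
definition "- f = Bop (- bop_fun f)"
definition "f * g = Bop (bop_fun f o\<^sub>L bop_fun g)"
definition "r *\<^sub>R f = Bop (r *\<^sub>R bop_fun f)"
definition "norm f = norm (bop_fun f)"
definition "sgn f = Bop (sgn (bop_fun f))"
definition "dist f g = norm (f - g)" for f g :: "'a bop"
definition "(uniformity :: ('a bop \<times> 'a bop) filter) = (INF e\<in>{0<..}. principal {(x, y). dist x y < e})"
definition "open (U :: 'a bop set) \<longleftrightarrow> (\<forall>x\<in>U. eventually (\<lambda>(x', y). x' = x \<longrightarrow> y \<in> U) uniformity)"

lemmas bop_defs = zero_bop_def one_bop_def plus_bop_def minus_bop_def uminus_bop_def times_bop_def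
  scaleR_bop_def norm_bop_def sgn_bop_def

instance
proof
  fix f g h :: "'a bop" and r s :: real
  show "norm (f * g) \<le> norm f * norm g" by (simp add: bop_defs norm_blinfun_compose)
  show "norm (1 :: 'a bop) = 1" by (simp add: bop_defs)
  show "(0 :: 'a bop) \<noteq> 1"
    by (auto simp: bop_defs Bop_inject) (metis norm_blinfun_id norm_zero zero_neq_one)
  show "norm (f + g) \<le> norm f + norm g" by (simp add: bop_defs norm_triangle_ineq)
  show "(norm f = 0) = (f = 0)" by (simp add: bop_defs bop_eq_iff)
  show "dist f g = norm (f - g)" by (rule dist_bop_def)
qed (simp_all add: sgn_div_norm bop_defs bop_eq_iff uniformity_bop_def open_bop_def algebra_simps
      blinfun.bilinear_simps blinfun_eq_iff')

end

instance bop :: (euclidean_space) banach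
proof
  fix X :: "nat \<Rightarrow> 'a bop" assume X: "Cauchy X"
  have d: "dist f g = dist (bop_fun f) (bop_fun g)" for f g :: "'a bop"
    by (simp add: dist_bop_def norm_bop_def minus_bop_def dist_norm)
  have "Cauchy (\<lambda>n. bop_fun (X n))" using X by (simp add: Cauchy_def d)
  then obtain l where "(\<lambda>n. bop_fun (X n)) \<longlonglongrightarrow> l"
    using Cauchy_convergent_iff convergent_def by blast
  then have "X \<longlonglongrightarrow> Bop l" by (simp add: tendsto_iff d)
  then show "convergent X" by (auto simp: convergent_def)
qed

section \<open>Matrices as bounded operators, and the exponential series\<close>

definition mat_bop :: "complex^'n^'n \<Rightarrow> (complex^'n) bop" where
  "mat_bop A = Bop (Blinfun ((*v) A))"

definition bop_mat :: "(complex^'n) bop \<Rightarrow> complex^'n^'n" where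
  "bop_mat f = matrix (blinfun_apply (bop_fun f))"

lemma bop_fun_mat_bop [simp]: "blinfun_apply (bop_fun (mat_bop A)) = (*v) A"
  by (simp add: mat_bop_def bounded_linear_Blinfun_apply)

lemma bop_mat_mat_bop [simp]: "bop_mat (mat_bop A) = A"
  by (simp add: bop_mat_def)

lemma mat_bop_mult: "mat_bop (A ** B) = mat_bop A * mat_bop B"
  by (simp add: bop_eq_iff blinfun_eq_iff' times_bop_def matrix_vector_mul_assoc)

lemma mat_bop_one: "mat_bop (Finite_Cartesian_Product.mat 1) = 1"
  by (simp add: bop_eq_iff blinfun_eq_iff' one_bop_def)

lemma scaleR_mult_vector: "(r *\<^sub>R A) *v x = r *\<^sub>R (A *v x)" for A :: "complex^'n^'n"
  by (simp add: matrix_vector_mult_def Finite_Cartesian_Product.vec_eq_iff scaleR_sum_right)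

lemma linear_mat_bop: "linear mat_bop"
  by (rule linearI)
    (simp_all add: bop_eq_iff blinfun_eq_iff' plus_bop_def scaleR_bop_def blinfun.bilinear_simps
      matrix_vector_mult_add_rdistrib scaleR_mult_vector)

lemma bounded_linear_mat_bop: "bounded_linear mat_bop"
  using linear_mat_bop by (simp add: linear_conv_bounded_linear)

lemma bounded_linear_bop_mat: "bounded_linear (bop_mat :: (complex^'n) bop \<Rightarrow> _)"
proof (rule bounded_linear_intro)
  fix f g :: "(complex^'n) bop" and r :: real
  show "bop_mat (f + g) = bop_mat f + bop_mat g"
    by (simp add: bop_mat_def plus_bop_def matrix_def Finite_Cartesian_Product.vec_eq_iff blinfun.bilinear_simps)
  show "bop_mat (r *\<^sub>R f) = r *\<^sub>R bop_mat f"
    by (simp add: bop_mat_def scaleR_bop_def matrix_def Finite_Cartesian_Product.vec_eq_iff blinfun.bilinear_simps)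
  have entry: "norm (bop_mat f $ i $ j) \<le> norm f" for i j
  proof -
    have "norm (bop_mat f $ i $ j) \<le> norm (blinfun_apply (bop_fun f) (axis j 1))"
      unfolding bop_mat_def matrix_def by (simp add: Finite_Cartesian_Product.norm_nth_le)
    also have "\<dots> \<le> norm (bop_fun f) * norm (axis j (1::complex) :: complex^'n)"
      by (rule norm_blinfun)
    finally show ?thesis by (simp add: norm_bop_def norm_eq_sqrt_inner[of "axis j _"] inner_axis_axis)
  qed
  have "norm (bop_mat f) \<le> (\<Sum>i\<in>UNIV. norm (bop_mat f $ i))"
    unfolding norm_vec_def[of "bop_mat f"] by (rule L2_set_le_sum) simp
  also have "\<dots> \<le> (\<Sum>i\<in>(UNIV::'n set). \<Sum>j\<in>UNIV. norm (bop_mat f $ i $ j))"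
  proof (rule sum_mono)
    fix i
    show "norm (bop_mat f $ i) \<le> (\<Sum>j\<in>UNIV. norm (bop_mat f $ i $ j))"
      unfolding norm_vec_def[of "bop_mat f $ i"] by (rule L2_set_le_sum) simp
  qed
  also have "\<dots> \<le> (\<Sum>i\<in>(UNIV::'n set). \<Sum>j\<in>(UNIV::'n set). norm f)"
    by (intro sum_mono entry)
  finally show "norm (bop_mat f) \<le> norm f * (real CARD('n) * real CARD('n))"
    by (simp add: algebra_simps)
qed

lemma mat_bop_power: "mat_bop (((**) X ^^ k) (Finite_Cartesian_Product.mat 1)) = mat_bop X ^ k"
  by (induction k) (simp_all add: mat_bop_one mat_bop_mult)

text \<open>\<open>mat_bop\<close> is linear, multiplicative and continuous with continuous left
  inverse \<open>bop_mat\<close>, so the exponential series passes in both directions. Identities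
  between exponentials can then be proved for operators and pulled back by injectivity.\<close>

lemma mat_bop_exp: "mat_bop (matrix_exp X) = exp (mat_bop X)"
  and matrix_exp_eq: "matrix_exp X = bop_mat (exp (mat_bop X))"
proof -
  let ?f = "\<lambda>k. (1 / fact k) *\<^sub>R (((**) X ^^ k) (Finite_Cartesian_Product.mat 1))"
  have m: "mat_bop (?f k) = mat_bop X ^ k /\<^sub>R fact k" for k
    by (simp add: linear_cmul[OF linear_mat_bop] mat_bop_power divide_inverse)
  have "(\<lambda>k. bop_mat (mat_bop X ^ k /\<^sub>R fact k)) sums bop_mat (exp (mat_bop X))"
    by (rule bounded_linear.sums[OF bounded_linear_bop_mat exp_converges])
  then have s: "?f sums bop_mat (exp (mat_bop X))"
    by (simp only: m[symmetric] bop_mat_mat_bop)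
  then show 1: "matrix_exp X = bop_mat (exp (mat_bop X))"
    by (simp add: matrix_exp_def sums_iff)
  have "(\<lambda>k. mat_bop (?f k)) sums mat_bop (matrix_exp X)"
    using bounded_linear.sums[OF bounded_linear_mat_bop s] 1 by simp
  then show "mat_bop (matrix_exp X) = exp (mat_bop X)"
    using exp_converges[of "mat_bop X"] m sums_unique2 by fastforce
qed

lemma mat_bop_inject: "mat_bop A = mat_bop B \<Longrightarrow> A = B"
  by (metis bop_mat_mat_bop)

lemma matrix_exp_0 [simp]: "matrix_exp 0 = Finite_Cartesian_Product.mat 1"
  by (rule mat_bop_inject) (simp add: mat_bop_exp linear_0[OF linear_mat_bop] mat_bop_one)

lemma matrix_exp_add_scale: "matrix_exp ((s + t) *\<^sub>R X) = matrix_exp (s *\<^sub>R X) ** matrix_exp (t *\<^sub>R X)"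
  by (rule mat_bop_inject)
    (simp add: mat_bop_exp mat_bop_mult linear_cmul[OF linear_mat_bop] linear_add[OF linear_mat_bop] scaleR_add_left
      exp_add_commuting[symmetric])

lemma matrix_exp_minus: "matrix_exp X ** matrix_exp (- X) = Finite_Cartesian_Product.mat 1"
  "matrix_exp (- X) ** matrix_exp X = Finite_Cartesian_Product.mat 1"
  using matrix_exp_add_scale[of 1 "-1" X] matrix_exp_add_scale[of "-1" 1 X] by simp_all

lemma invertible_matrix_exp: "invertible (matrix_exp X)"
  unfolding invertible_def using matrix_exp_minus by blast

lemma matrix_exp_of_nat: "matrix_exp (real k *\<^sub>R X) = ((**) (matrix_exp X) ^^ k) (Finite_Cartesian_Product.mat 1)"
proof (induction k)
  case (Suc k)
  then show ?case using matrix_exp_add_scale[of 1 "real k" X] by (simp add: add.commute)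
qed simp

lemma matrix_exp_has_vector_derivative:
  "((\<lambda>t. matrix_exp (t *\<^sub>R X)) has_vector_derivative matrix_exp (t *\<^sub>R X) ** X) (at t within S)"
proof -
  have "((\<lambda>t. bop_mat (exp (t *\<^sub>R mat_bop X))) has_vector_derivative
      bop_mat (exp (t *\<^sub>R mat_bop X) * mat_bop X)) (at t within S)"
    by (rule bounded_linear.has_vector_derivative[OF bounded_linear_bop_mat
          exp_scaleR_has_vector_derivative_right])
  moreover have e: "exp (t *\<^sub>R mat_bop X) = mat_bop (matrix_exp (t *\<^sub>R X))" for t
    by (simp add: mat_bop_exp linear_cmul[OF linear_mat_bop])
  ultimately show ?thesis
    by (simp add: e mat_bop_mult[symmetric])
qed

lemma matrix_exp_commute: "matrix_exp (t *\<^sub>R X) ** X = X ** matrix_exp (t *\<^sub>R X)"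
  by (rule mat_bop_inject)
    (simp add: mat_bop_mult mat_bop_exp linear_cmul[OF linear_mat_bop] exp_times_scaleR_commute)

lemma matrix_exp_bounded:
  obtains M where "M > 0" "\<And>X :: complex^'n^'n. norm X \<le> R \<Longrightarrow> norm (matrix_exp X) \<le> M"
proof -
  obtain K where K: "K > 0" "\<And>f :: (complex^'n) bop. norm (bop_mat f) \<le> norm f * K"
    using bounded_linear.pos_bounded[OF bounded_linear_bop_mat] by blast
  obtain L where L: "L > 0" "\<And>X :: complex^'n^'n. norm (mat_bop X) \<le> norm X * L"
    using bounded_linear.pos_bounded[OF bounded_linear_mat_bop] by blast
  have "norm (matrix_exp X) \<le> exp (R * L) * K" if "norm X \<le> R" for X :: "complex^'n^'n"
  proof -
    have "norm (matrix_exp X) \<le> exp (norm (mat_bop X)) * K"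
      unfolding matrix_exp_eq
      by (rule order_trans[OF K(2)]) (use K(1) norm_exp in \<open>auto intro!: mult_right_mono\<close>)
    also have "\<dots> \<le> exp (R * L) * K"
    proof -
      have "norm (mat_bop X) \<le> R * L"
        using L(2)[of X] mult_right_mono[OF that, of L] L(1) by linarith
      then show ?thesis using K(1) by simp
    qed
    finally show ?thesis .
  qed
  with K(1) show thesis by (intro that[of "exp (R * L) * K"]) auto
qed

text \<open>Duhamel's formula: the integrand is the derivative of
  \<open>exp ((1 - s) X) exp (s (X + H))\<close>, which runs from \<open>exp X\<close> to
  \<open>exp (X + H)\<close>. It compares exponentials without asking that \<open>X\<close> and
  \<open>H\<close> commute.\<close>

lemma matrix_exp_diff_integral:
  "((\<lambda>s. matrix_exp ((1 - s) *\<^sub>R X) ** (H ** matrix_exp (s *\<^sub>R (X + H)))) has_integral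
     matrix_exp (X + H) - matrix_exp X) {0..1}"
proof -
  let ?F = "\<lambda>s. matrix_exp ((1 - s) *\<^sub>R X) ** matrix_exp (s *\<^sub>R (X + H))"
  have "((\<lambda>s. matrix_exp ((1 - s) *\<^sub>R X) ** (H ** matrix_exp (s *\<^sub>R (X + H)))) has_integral ?F 1 - ?F 0) {0..1}"
  proof (rule fundamental_theorem_of_calculus)
    fix s :: real assume "s \<in> {0..1}"
    have 1: "((\<lambda>s. matrix_exp ((1 - s) *\<^sub>R X)) has_vector_derivative
        (- 1) *\<^sub>R (matrix_exp ((1 - s) *\<^sub>R X) ** X)) (at s within {0..1})"
    proof -
      have "((\<lambda>s. 1 - s) has_vector_derivative - 1) (at s within {0..1})"
        by (auto intro!: derivative_eq_intros)
      from vector_diff_chain_within[OF this matrix_exp_has_vector_derivative]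
      show ?thesis by (simp add: o_def)
    qed
    have 2: "((\<lambda>s. matrix_exp (s *\<^sub>R (X + H))) has_vector_derivative
        (X + H) ** matrix_exp (s *\<^sub>R (X + H))) (at s within {0..1})"
      using matrix_exp_has_vector_derivative[of "X + H" s] by (simp add: matrix_exp_commute)
    have e: "matrix_exp ((1 - s) *\<^sub>R X) ** ((X + H) ** matrix_exp (s *\<^sub>R (X + H)))
        + ((- 1) *\<^sub>R (matrix_exp ((1 - s) *\<^sub>R X) ** X)) ** matrix_exp (s *\<^sub>R (X + H))
        = matrix_exp ((1 - s) *\<^sub>R X) ** (H ** matrix_exp (s *\<^sub>R (X + H)))"
      by (simp add: mm.add_left mm.add_right mm.minus_left matrix_mul_assoc)
    show "(?F has_vector_derivative matrix_exp ((1 - s) *\<^sub>R X) ** (H ** matrix_exp (s *\<^sub>R (X + H))))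
        (at s within {0..1})"
      using mm.has_vector_derivative[OF 1 2] by (simp only: e)
  qed simp
  then show ?thesis by simp
qed

lemma has_derivative_quadratic:
  assumes f': "bounded_linear f'" and "\<delta> > 0"
    and bnd: "\<And>y. y \<in> S \<Longrightarrow> norm (y - x) < \<delta> \<Longrightarrow> norm (f y - f x - f' (y - x)) \<le> C * (norm (y - x))\<^sup>2"
  shows "(f has_derivative f') (at x within S)"
  unfolding has_derivative_iff_norm
proof (intro conjI f')
  show "((\<lambda>y. norm (f y - f x - f' (y - x)) / norm (y - x)) \<longlongrightarrow> 0) (at x within S)"
  proof (rule Lim_null_comparison)
    have "\<forall>\<^sub>F y in at x within S. y \<in> S \<and> y \<noteq> x \<and> norm (y - x) < \<delta>"
      using \<open>\<delta> > 0\<close> by (auto simp: eventually_at dist_norm)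
    then show "\<forall>\<^sub>F y in at x within S. norm (norm (f y - f x - f' (y - x)) / norm (y - x)) \<le> C * norm (y - x)"
    proof eventually_elim
      case (elim y)
      then show ?case using bnd[of y] by (simp add: field_simps power2_eq_square)
    qed
    have "((\<lambda>y. C * norm (y - x)) \<longlongrightarrow> C * norm (x - x)) (at x within S)"
      by (intro tendsto_intros)
    then show "((\<lambda>y. C * norm (y - x)) \<longlongrightarrow> 0) (at x within S)" by simp
  qed
qed

lemma norm_scaleR_le: "0 \<le> c \<Longrightarrow> c \<le> 1 \<Longrightarrow> norm x \<le> R \<Longrightarrow> norm (c *\<^sub>R x) \<le> R"
  using mult_right_mono[of c 1 "norm x"] by simp

lemma matrix_exp_lipschitz:
  obtains L where "L \<ge> 0" "\<And>X Y :: complex^'n^'n. norm X \<le> R \<Longrightarrow> norm Y \<le> R \<Longrightarrow>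
    norm (matrix_exp Y - matrix_exp X) \<le> L * norm (Y - X)"
proof -
  obtain K where K: "K > 0" "\<And>(A :: complex^'n^'n) (B :: complex^'n^'n). norm (A ** B) \<le> norm A * norm B * K"
    using matrix_mult_bounded by blast
  obtain M where M: "M > 0" "\<And>X :: complex^'n^'n. norm X \<le> R \<Longrightarrow> norm (matrix_exp X) \<le> M"
    using matrix_exp_bounded by blast
  have "norm (matrix_exp Y - matrix_exp X) \<le> (M * M * K * K) * norm (Y - X)"
    if XY: "norm X \<le> R" "norm Y \<le> R" for X Y :: "complex^'n^'n"
  proof -
    let ?I = "\<lambda>s. matrix_exp ((1 - s) *\<^sub>R X) ** ((Y - X) ** matrix_exp (s *\<^sub>R Y))"
    have I: "(?I has_integral matrix_exp Y - matrix_exp X) (cbox 0 1)"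
      using matrix_exp_diff_integral[of X "Y - X"] by simp
    have "norm (matrix_exp Y - matrix_exp X) \<le> (M * M * K * K) * norm (Y - X) * Henstock_Kurzweil_Integration.content (cbox 0 (1::real))"
    proof (rule has_integral_bound[OF _ I])
      fix s :: real assume s: "s \<in> cbox 0 1"
      have "norm ((1 - s) *\<^sub>R X) \<le> R" "norm (s *\<^sub>R Y) \<le> R"
        using s XY by (intro norm_scaleR_le; simp)+
      then have b: "norm (matrix_exp ((1 - s) *\<^sub>R X)) \<le> M" "norm (matrix_exp (s *\<^sub>R Y)) \<le> M"
        using M(2) by auto
      have "norm (?I s) \<le> norm (matrix_exp ((1 - s) *\<^sub>R X)) * (norm (Y - X) * norm (matrix_exp (s *\<^sub>R Y)) * K) * K"
        by (rule order_trans[OF K(2)]) (use K in \<open>auto intro!: mult_right_mono mult_left_mono\<close>)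
      also have "\<dots> \<le> M * (norm (Y - X) * M * K) * K"
        using b K(1) M(1) by (intro mult_right_mono mult_mono) auto
      finally show "norm (?I s) \<le> (M * M * K * K) * norm (Y - X)" by (simp add: algebra_simps)
    qed (use K M in auto)
    then show ?thesis by simp
  qed
  with K(1) M(1) show thesis by (intro that[of "M * M * K * K"]) auto
qed

lemma continuous_on_matrix_exp: "continuous_on S (matrix_exp :: complex^'n^'n \<Rightarrow> _)"
proof (rule continuous_at_imp_continuous_on, rule ballI)
  fix X :: "complex^'n^'n"
  obtain L where L: "\<And>Z Y :: complex^'n^'n. norm Z \<le> norm X + 1 \<Longrightarrow> norm Y \<le> norm X + 1 \<Longrightarrow>
    norm (matrix_exp Y - matrix_exp Z) \<le> L * norm (Y - Z)"
    using matrix_exp_lipschitz by blast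
  have "((\<lambda>Y. matrix_exp Y - matrix_exp X) \<longlongrightarrow> 0) (at X)"
  proof (rule Lim_null_comparison)
    have "norm Y \<le> norm X + 1" if "dist Y X < 1" for Y
      using that norm_triangle_sub[of Y X] by (simp add: dist_norm)
    then show "\<forall>\<^sub>F Y in at X. norm (matrix_exp Y - matrix_exp X) \<le> L * norm (Y - X)"
      unfolding eventually_at by (intro exI[of _ 1]) (auto intro!: L)
    have "((\<lambda>Y. L * norm (Y - X)) \<longlongrightarrow> L * norm (X - X)) (at X)" by (intro tendsto_intros)
    then show "((\<lambda>Y. L * norm (Y - X)) \<longlongrightarrow> 0) (at X)" by simp
  qed
  then show "isCont matrix_exp X" by (simp add: isCont_def LIM_zero_iff)
qed

text \<open>In Duhamel's formula the factor \<open>exp (s (X + H))\<close> is replaced by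
  \<open>exp (s X)\<close>. By the Lipschitz bound this costs a multiple of \<open>norm H\<close>,
  and with the factor \<open>H\<close> already present the error is quadratic.\<close>

lemma matrix_exp_has_derivative:
  fixes X :: "complex^'n^'n"
  shows "(matrix_exp has_derivative
    (\<lambda>H. integral {0..1} (\<lambda>s. matrix_exp ((1 - s) *\<^sub>R X) ** (H ** matrix_exp (s *\<^sub>R X))))) (at X)"
proof -
  \<comment> \<open>This radius holds \<open>X\<close> and every \<open>X + H\<close> with
    \<open>norm H < 1\<close>, so that one bound and one Lipschitz constant serve all exponentials
    that occur.\<close>
  let ?R = "norm X + 1"
  let ?J = "\<lambda>H s. matrix_exp ((1 - s) *\<^sub>R X) ** (H ** matrix_exp (s *\<^sub>R X))"
  have cont: "continuous_on {0..1} (?J H)" for H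
    by (intro mm.continuous_on continuous_on_compose2[OF continuous_on_matrix_exp[of UNIV]] continuous_intros subset_UNIV)
  have int: "?J H integrable_on {0..1}" for H by (rule integrable_continuous_interval[OF cont])
  have lin: "linear (\<lambda>H. integral {0..1} (?J H))"
  proof (rule linearI)
    show "integral {0..1} (?J (H + H')) = integral {0..1} (?J H) + integral {0..1} (?J H')" for H H'
      by (subst integral_add[OF int int, symmetric]) (simp add: mm.add_left mm.add_right)
    show "integral {0..1} (?J (r *\<^sub>R H)) = r *\<^sub>R integral {0..1} (?J H)" for r H
      by (subst integral_cmul[symmetric]) (simp add: mm.scaleR_left mm.scaleR_right)
  qed
  obtain K where K: "K > 0" "\<And>(A :: complex^'n^'n) (B :: complex^'n^'n). norm (A ** B) \<le> norm A * norm B * K"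
    using matrix_mult_bounded by blast
  obtain M where M: "M > 0" "\<And>X :: complex^'n^'n. norm X \<le> ?R \<Longrightarrow> norm (matrix_exp X) \<le> M"
    using matrix_exp_bounded by blast
  obtain L where L: "L \<ge> 0" "\<And>X Y :: complex^'n^'n. norm X \<le> ?R \<Longrightarrow> norm Y \<le> ?R \<Longrightarrow>
    norm (matrix_exp Y - matrix_exp X) \<le> L * norm (Y - X)"
    using matrix_exp_lipschitz by blast
  show ?thesis
  proof (rule has_derivative_quadratic[where \<delta> = 1])
    show "bounded_linear (\<lambda>H. integral {0..1} (?J H))" using lin by (simp add: linear_conv_bounded_linear)
    fix Y assume Y: "norm (Y - X) < 1"
    define H where "H = Y - X"
    have nH: "norm H \<le> 1" using Y by (simp add: H_def)
    have YX: "Y = X + H" by (simp add: H_def)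
    have nX: "norm (s *\<^sub>R X) \<le> ?R" if "s \<in> {0..1}" for s
      using that by (intro norm_scaleR_le) auto
    have nY: "norm (s *\<^sub>R (X + H)) \<le> ?R" if "s \<in> {0..1}" for s
      using that norm_triangle_ineq[of X H] nH by (intro norm_scaleR_le) auto
    have I: "((\<lambda>s. matrix_exp ((1 - s) *\<^sub>R X) ** (H ** matrix_exp (s *\<^sub>R (X + H))) - ?J H s) has_integral
       (matrix_exp (X + H) - matrix_exp X - integral {0..1} (?J H))) (cbox 0 1)"
      using has_integral_diff[OF matrix_exp_diff_integral integrable_integral[OF int]] by simp
    have "norm (matrix_exp (X + H) - matrix_exp X - integral {0..1} (?J H))
      \<le> (M * K * K * L) * (norm H)\<^sup>2 * Henstock_Kurzweil_Integration.content (cbox 0 (1::real))"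
    proof (rule has_integral_bound[OF _ I])
      fix s :: real assume "s \<in> cbox 0 1"
      then have s: "s \<in> {0..1}" "1 - s \<in> {0..1}" by auto
      have "norm (matrix_exp (s *\<^sub>R (X + H)) - matrix_exp (s *\<^sub>R X)) \<le> L * norm (s *\<^sub>R H)"
        using L(2)[OF nX[OF s(1)] nY[OF s(1)]] by (simp add: algebra_simps)
      also have "\<dots> \<le> L * norm H" using s L(1) by (auto intro!: mult_left_mono mult_left_le_one_le)
      finally have d: "norm (matrix_exp (s *\<^sub>R (X + H)) - matrix_exp (s *\<^sub>R X)) \<le> L * norm H" .
      have "matrix_exp ((1 - s) *\<^sub>R X) ** (H ** matrix_exp (s *\<^sub>R (X + H))) - ?J H s
        = matrix_exp ((1 - s) *\<^sub>R X) ** (H ** (matrix_exp (s *\<^sub>R (X + H)) - matrix_exp (s *\<^sub>R X)))"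
        by (simp add: mm.diff_right)
      also have "norm \<dots> \<le> norm (matrix_exp ((1 - s) *\<^sub>R X)) *
          (norm H * norm (matrix_exp (s *\<^sub>R (X + H)) - matrix_exp (s *\<^sub>R X)) * K) * K"
        by (rule order_trans[OF K(2)]) (use K in \<open>auto intro!: mult_right_mono mult_left_mono\<close>)
      also have "\<dots> \<le> M * (norm H * (L * norm H) * K) * K"
        using d K(1) M(1) L(1) M(2)[OF nX[OF s(2)]] by (intro mult_right_mono mult_mono) auto
      finally show "norm (matrix_exp ((1 - s) *\<^sub>R X) ** (H ** matrix_exp (s *\<^sub>R (X + H))) - ?J H s)
        \<le> (M * K * K * L) * (norm H)\<^sup>2" by (simp add: algebra_simps power2_eq_square)
    qed (use K M L in auto)
    then show "norm (matrix_exp Y - matrix_exp X - integral {0..1} (?J (Y - X)))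
      \<le> (M * K * K * L) * (norm (Y - X))\<^sup>2"
      by (simp add: YX)
  qed simp
qed

text \<open>The derivative is an integral of products of \<open>matrix_exp\<close> itself, seen as
  functions of the pair \<open>(s, X)\<close>; so class \<open>C^k\<close> yields class
  \<open>C^(k+1)\<close>, starting from continuity.\<close>

lemma Ck_on_matrix_exp: "Ck_on k (matrix_exp :: complex^'n^'n \<Rightarrow> _) UNIV"
proof (induction k)
  case 0
  then show ?case by (simp add: continuous_on_matrix_exp)
next
  case (Suc k)
  show ?case
  proof (rule Ck_on_SucI[OF open_UNIV matrix_exp_has_derivative])
    fix H :: "complex^'n^'n"
    have fst: "Ck_on k (\<lambda>p :: real \<times> (complex^'n^'n). fst p) UNIV" and snd: "Ck_on k (\<lambda>p :: real \<times> (complex^'n^'n). snd p) UNIV"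
      by (intro Ck_on_linear bounded_linear_fst bounded_linear_snd open_UNIV)+
    have "Ck_on k (\<lambda>p. matrix_exp ((1 - fst p) *\<^sub>R snd p) ** (H ** matrix_exp (fst p *\<^sub>R snd p)))
        (UNIV :: (real \<times> (complex^'n^'n)) set)"
      by (intro Ck_on_bilinear[OF bounded_bilinear_matrix_mult] Ck_on_const open_UNIV
          Ck_on_compose[OF _ _ Suc] Ck_on_scaleR Ck_on_diff fst snd) auto
    from Ck_on_integral[OF this]
    show "Ck_on k (\<lambda>X. integral {0..1} (\<lambda>s. matrix_exp ((1 - s) *\<^sub>R X) ** (H ** matrix_exp (s *\<^sub>R X)))) UNIV"
      by simp
  qed
qed

lemma matrix_exp_has_derivative_0: "((matrix_exp :: complex^'n^'n \<Rightarrow> _) has_derivative (\<lambda>H. H)) (at 0)"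
proof -
  have "(\<lambda>H :: complex^'n^'n. integral {0..1} (\<lambda>s. matrix_exp ((1 - s) *\<^sub>R 0) ** (H ** matrix_exp (s *\<^sub>R 0)))) = (\<lambda>H. H)"
    by (rule ext) (simp only: scaleR_zero_right matrix_exp_0 matrix_mul_lid matrix_mul_rid integral_const_real,
        simp)
  with matrix_exp_has_derivative[of "0 :: complex^'n^'n"] show ?thesis by (simp only:)
qed

section \<open>Closed linear groups and their Lie algebras\<close>

abbreviation idm :: "complex^'n^'n" where "idm \<equiv> Finite_Cartesian_Product.mat 1"

text \<open>The increments are measured by given positive numbers \<open>t n\<close> and not by
  their own norm. This is the form in which tangent vectors arise as limits of quotients.\<close>

lemma has_derivative_sequentially:
  assumes f: "(f has_derivative f') (at x)" and y: "y \<longlonglongrightarrow> x"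
    and t: "\<And>n. t n > 0" and q: "(\<lambda>n. (y n - x) /\<^sub>R t n) \<longlonglongrightarrow> Y"
  shows "(\<lambda>n. (f (y n) - f x) /\<^sub>R t n) \<longlonglongrightarrow> f' Y"
proof -
  have bl: "bounded_linear f'" by (rule has_derivative_bounded_linear[OF f])
  \<comment> \<open>At \<open>x\<close> itself the quotient is 0, because the inverse of 0 is 0;
    thus \<open>r\<close> is continuous at \<open>x\<close> and may be evaluated along sequences
    that meet \<open>x\<close>.\<close>
  define r where "r z = (f z - f x - f' (z - x)) /\<^sub>R norm (z - x)" for z
  have "(r \<longlongrightarrow> 0) (at x)" using f by (simp add: has_derivative_at_within r_def[abs_def])
  then have "isCont r x" by (simp add: isCont_def r_def)
  then have "(\<lambda>n. r (y n)) \<longlonglongrightarrow> r x" using y by (rule isCont_tendsto_compose)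
  then have r0: "(\<lambda>n. r (y n)) \<longlonglongrightarrow> 0" by (simp add: r_def)
  have eq: "(f (y n) - f x) /\<^sub>R t n = f' ((y n - x) /\<^sub>R t n) + norm ((y n - x) /\<^sub>R t n) *\<^sub>R r (y n)" for n
  proof (cases "y n = x")
    case True
    then show ?thesis by (simp add: linear_simps(3)[OF bl])
  next
    case False
    have "norm ((y n - x) /\<^sub>R t n) *\<^sub>R r (y n) = (f (y n) - f x - f' (y n - x)) /\<^sub>R t n"
      using False t[of n] by (simp add: r_def divide_inverse)
    moreover have "f' ((y n - x) /\<^sub>R t n) = f' (y n - x) /\<^sub>R t n"
      by (simp add: linear_simps(5)[OF bl])
    ultimately show ?thesis by (simp add: algebra_simps)
  qed
  have "(\<lambda>n. f' ((y n - x) /\<^sub>R t n) + norm ((y n - x) /\<^sub>R t n) *\<^sub>R r (y n)) \<longlonglongrightarrow> f' Y + norm Y *\<^sub>R 0"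
    by (intro tendsto_intros bounded_linear.tendsto[OF bl] q r0)
  then show ?thesis by (simp add: eq)
qed

lemma subspace_projection_exists:
  fixes S :: "'a::euclidean_space set"
  assumes "subspace S"
  shows "\<exists>P. linear P \<and> (\<forall>x. P x \<in> S) \<and> (\<forall>x\<in>S. P x = x)"
proof -
  obtain B where B: "B \<subseteq> S" "pairwise Linear_Algebra.orthogonal B" "\<And>x. x \<in> B \<Longrightarrow> norm x = 1"
    "independent B" "span B = S"
    using orthonormal_basis_subspace[OF assms] by metis
  define P where "P x = (\<Sum>b\<in>B. (x \<bullet> b) *\<^sub>R b)" for x
  have "linear P"
    by (rule linearI) (simp_all add: P_def inner_left_distrib scaleR_add_left sum.distrib scaleR_sum_right)
  moreover have "P x \<in> S" for x
    unfolding P_def using B(1) assms by (intro subspace_sum) (auto intro: subspace_scale)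
  moreover have "P x = x" if "x \<in> S" for x
    unfolding P_def using B that independent_imp_finite
    by (intro orthonormal_basis_expand) auto
  ultimately show ?thesis by blast
qed

text \<open>A limit is required to lie in \<open>G\<close> only if it is invertible: a zero set of
  regular functions, which involve the inverse of the determinant, is closed in the general linear
  group but need not be closed among all matrices.\<close>

locale closed_linear_group =
  fixes G :: "(complex^'n^'n) set"
  assumes one_mem: "idm \<in> G"
    and mult_mem: "g \<in> G \<Longrightarrow> h \<in> G \<Longrightarrow> g ** h \<in> G"
    and inverse_exists: "g \<in> G \<Longrightarrow> \<exists>h\<in>G. g ** h = idm \<and> h ** g = idm"
    and closed_in_GL: "(\<And>n. X n \<in> G) \<Longrightarrow> X \<longlonglongrightarrow> g \<Longrightarrow> invertible g \<Longrightarrow> g \<in> G"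
begin

abbreviation "\<gg> \<equiv> lie_algebra G"

lemma left_inverse_unique:
  assumes "g ** h = idm" "h' ** g = idm"
  shows "h' = (h :: complex^'n^'n)"
  by (metis assms matrix_mul_assoc matrix_mul_lid matrix_mul_rid)

lemma
  assumes "g \<in> G"
  shows inv_mem: "matrix_inv g \<in> G"
    and mult_inv: "g ** matrix_inv g = idm"
    and inv_mult: "matrix_inv g ** g = idm"
proof -
  obtain h where h: "h \<in> G" "g ** h = idm" "h ** g = idm" using inverse_exists[OF assms] by blast
  have "g ** matrix_inv g = idm \<and> matrix_inv g ** g = idm"
    unfolding matrix_inv_def by (rule someI[of _ h]) (use h in auto)
  then show "g ** matrix_inv g = idm" "matrix_inv g ** g = idm" by auto
  then have "matrix_inv g = h" using h left_inverse_unique by blast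
  then show "matrix_inv g \<in> G" using h by simp
qed

lemma inv_mult_cancel: "g \<in> G \<Longrightarrow> matrix_inv g ** (g ** x) = x"
  by (simp add: matrix_mul_assoc inv_mult)

lemma mult_inv_cancel: "g \<in> G \<Longrightarrow> g ** (matrix_inv g ** x) = x"
  by (simp add: matrix_mul_assoc mult_inv)

lemma power_mem: "g \<in> G \<Longrightarrow> ((**) g ^^ k) idm \<in> G"
  by (induction k) (auto simp: one_mem mult_mem)

section \<open>The Lie algebra as a set of tangent directions at the identity\<close>

lemma exp_mem: "X \<in> \<gg> \<Longrightarrow> matrix_exp (t *\<^sub>R X) \<in> G"
  by (simp add: lie_algebra_def)

lemma exp_mem1: "X \<in> \<gg> \<Longrightarrow> matrix_exp X \<in> G"
  using exp_mem[of X 1] by simp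

text \<open>The step behind Cartan's theorem: the powers of \<open>g n\<close> with exponent about
  \<open>s / t n\<close> lie in the group and converge to \<open>exp (s Y)\<close>, because the
  logarithm of \<open>g n\<close> is close to \<open>t n\<close> times \<open>Y\<close>. Closedness
  then puts the whole one-parameter group of \<open>Y\<close> into \<open>G\<close>; negative
  \<open>s\<close> are reached by inversion.\<close>

lemma limit_of_quotients_mem:
  assumes g: "\<And>n. g n \<in> G" and t: "\<And>n. t n > 0" and t0: "t \<longlonglongrightarrow> 0"
    and q: "(\<lambda>n. (g n - idm) /\<^sub>R t n) \<longlonglongrightarrow> Y"
  shows "Y \<in> \<gg>"
proof -
  obtain U V :: "(complex^'n^'n) set" and lg where V: "open V" "idm \<in> V" and hom: "homeomorphism U V matrix_exp lg"
    and U: "0 \<in> U" and dlg: "(lg has_derivative (\<lambda>h. h)) (at idm)"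
    using smooth_local_inverse[OF open_UNIV UNIV_I Ck_on_matrix_exp matrix_exp_has_derivative_0]
    unfolding matrix_exp_0 by metis
  have lg: "matrix_exp (lg y) = y" if "y \<in> V" for y using hom that by (auto simp: homeomorphism_def)
  have lg1: "lg idm = 0" using hom U by (metis homeomorphism_apply1 matrix_exp_0)
  have "(\<lambda>n. t n *\<^sub>R ((g n - idm) /\<^sub>R t n)) \<longlonglongrightarrow> 0 *\<^sub>R Y" by (intro tendsto_intros t0 q)
  moreover have "t n *\<^sub>R ((g n - idm) /\<^sub>R t n) = g n - idm" for n using t[of n] by simp
  ultimately have g1: "g \<longlonglongrightarrow> idm" by (simp add: LIM_zero_iff)
  then obtain N where N: "\<And>n. n \<ge> N \<Longrightarrow> g n \<in> V"
    using V topological_tendstoD[OF g1 V] by (auto simp: eventually_sequentially)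
  have Z: "(\<lambda>n. lg (g n) /\<^sub>R t n) \<longlonglongrightarrow> Y"
    using has_derivative_sequentially[OF dlg g1 t q] by (simp add: lg1)
  have pos: "matrix_exp (s *\<^sub>R Y) \<in> G" if "s \<ge> 0" for s
  proof -
    \<comment> \<open>Rounding down leaves an error of at most \<open>t n\<close> in
      \<open>real (k n) * t n\<close>, which tends to 0.\<close>
    define k where "k n = nat \<lfloor>s / t n\<rfloor>" for n
    have "(\<lambda>n. real (k n) * t n - s) \<longlonglongrightarrow> 0"
    proof (rule Lim_null_comparison[OF _ t0])
      have "norm (real (k n) * t n - s) \<le> t n" for n
      proof -
        have k: "real (k n) = of_int \<lfloor>s / t n\<rfloor>" using that t[of n] by (simp add: k_def)
        have "real (k n) \<le> s / t n" "s / t n < real (k n) + 1" unfolding k by linarith+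
        then have "real (k n) * t n \<le> s" "s < (real (k n) + 1) * t n"
          using t[of n] by (simp_all add: field_simps)
        then show ?thesis by (simp add: abs_if algebra_simps)
      qed
      then show "\<forall>\<^sub>F n in sequentially. norm (real (k n) * t n - s) \<le> t n" by simp
    qed
    then have ks: "(\<lambda>n. real (k n) * t n) \<longlonglongrightarrow> s" by (simp add: LIM_zero_iff)
    have "(\<lambda>n. (real (k n) * t n) *\<^sub>R (lg (g n) /\<^sub>R t n)) \<longlonglongrightarrow> s *\<^sub>R Y"
      by (intro tendsto_intros ks Z)
    moreover have "(\<lambda>n. (real (k n) * t n) *\<^sub>R (lg (g n) /\<^sub>R t n)) = (\<lambda>n. real (k n) *\<^sub>R lg (g n))"
    proof
      fix n
      have "real (k n) * t n * inverse (t n) = real (k n)" using t[of n] by simp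
      then show "(real (k n) * t n) *\<^sub>R (lg (g n) /\<^sub>R t n) = real (k n) *\<^sub>R lg (g n)"
        by (simp only: scaleR_scaleR)
    qed
    ultimately have "(\<lambda>n. real (k n) *\<^sub>R lg (g n)) \<longlonglongrightarrow> s *\<^sub>R Y" by (simp only:)
    then have "(\<lambda>n. matrix_exp (real (k n) *\<^sub>R lg (g n))) \<longlonglongrightarrow> matrix_exp (s *\<^sub>R Y)"
      using continuous_on_matrix_exp[of UNIV]
      by (auto intro: isCont_tendsto_compose simp: continuous_on_eq_continuous_at)
    \<comment> \<open>\<open>lg\<close> is known to invert the exponential only on \<open>V\<close>,
      so the first \<open>N\<close> terms are dropped before \<open>exp (lg (g n))\<close> is
      replaced by \<open>g n\<close>.\<close>
    then have "(\<lambda>n. matrix_exp (real (k (n + N)) *\<^sub>R lg (g (n + N)))) \<longlonglongrightarrow> matrix_exp (s *\<^sub>R Y)"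
      by (rule LIMSEQ_ignore_initial_segment)
    moreover have "matrix_exp (real (k (n + N)) *\<^sub>R lg (g (n + N))) \<in> G" for n
      using N[of "n + N"] by (simp add: matrix_exp_of_nat lg power_mem g)
    ultimately show ?thesis
      using closed_in_GL[OF _ _ invertible_matrix_exp] by fast
  qed
  show ?thesis unfolding lie_algebra_def
  proof (intro CollectI allI)
    fix s :: real
    show "matrix_exp (s *\<^sub>R Y) \<in> G"
    proof (cases "s \<ge> 0")
      case False
      then have m: "matrix_exp (- (s *\<^sub>R Y)) \<in> G" using pos[of "- s"] by simp
      have "matrix_inv (matrix_exp (- (s *\<^sub>R Y))) = matrix_exp (s *\<^sub>R Y)"
        by (rule left_inverse_unique[OF _ inv_mult[OF m]]) (rule matrix_exp_minus)
      then show ?thesis using inv_mem[OF m] by simp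
    qed (use pos in simp)
  qed
qed

text \<open>This turns closure properties of the Lie algebra into the choice of a curve:
  \<open>exp (tX) exp (tY)\<close> for sums and \<open>g exp (tX) g^-1\<close> for
  conjugates.\<close>

lemma curve_derivative_mem:
  assumes d: "d > 0" and \<gamma>: "\<And>t. \<bar>t\<bar> < d \<Longrightarrow> \<gamma> t \<in> G" and \<gamma>0: "\<gamma> 0 = idm"
    and \<gamma>': "(\<gamma> has_vector_derivative Y) (at 0)"
  shows "Y \<in> \<gg>"
proof -
  \<comment> \<open>The factor \<open>d / 2\<close> keeps every term, including the one with
    \<open>n = 0\<close>, strictly inside the interval on which the curve lies in the group.\<close>
  define t where "t n = d / 2 * inverse (real (Suc n))" for n
  have t: "t n > 0" for n using d by (simp add: t_def)
  have td: "\<bar>t n\<bar> < d" for n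
  proof -
    have "t n \<le> d / 2 * 1" unfolding t_def using d by (intro mult_left_mono) (auto simp: inverse_le_1_iff)
    then show ?thesis using d t[of n] by simp
  qed
  have t0: "t \<longlonglongrightarrow> 0"
    unfolding t_def[abs_def] by (rule tendsto_mult_right_zero[OF LIMSEQ_inverse_real_of_nat])
  have "(\<lambda>n. (t n - 0) /\<^sub>R t n) \<longlonglongrightarrow> 1" using t by (simp add: less_imp_neq[symmetric])
  from has_derivative_sequentially[OF \<gamma>'[unfolded has_vector_derivative_def] t0 t this]
  have "(\<lambda>n. (\<gamma> (t n) - idm) /\<^sub>R t n) \<longlonglongrightarrow> Y" by (simp add: \<gamma>0)
  then show ?thesis by (intro limit_of_quotients_mem[of "\<lambda>n. \<gamma> (t n)" t] \<gamma> t td t0)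
qed

lemma matrix_exp_derivative_0: "((\<lambda>t. matrix_exp (t *\<^sub>R X)) has_vector_derivative X) (at 0 within S)"
  using matrix_exp_has_vector_derivative[of X 0] by simp

lemma subspace_lie_algebra: "subspace \<gg>"
proof (rule subspaceI)
  show "0 \<in> \<gg>" by (simp add: lie_algebra_def one_mem)
  show "c *\<^sub>R X \<in> \<gg>" if "X \<in> \<gg>" for c X using that by (simp add: lie_algebra_def)
  show "X + Y \<in> \<gg>" if XY: "X \<in> \<gg>" "Y \<in> \<gg>" for X Y
  proof (rule curve_derivative_mem[where \<gamma> = "\<lambda>t. matrix_exp (t *\<^sub>R X) ** matrix_exp (t *\<^sub>R Y)" and d = 1])
    show "((\<lambda>t. matrix_exp (t *\<^sub>R X) ** matrix_exp (t *\<^sub>R Y)) has_vector_derivative X + Y) (at 0)"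
      using mm.has_vector_derivative[OF matrix_exp_derivative_0[of X] matrix_exp_derivative_0[of Y]]
      by (simp add: add.commute)
  qed (auto intro: mult_mem exp_mem XY)
qed

lemma Ad_mem:
  assumes "g \<in> G" "X \<in> \<gg>"
  shows "g ** X ** matrix_inv g \<in> \<gg>"
proof (rule curve_derivative_mem[where \<gamma> = "\<lambda>t. g ** matrix_exp (t *\<^sub>R X) ** matrix_inv g" and d = 1])
  show "((\<lambda>t. g ** matrix_exp (t *\<^sub>R X) ** matrix_inv g) has_vector_derivative g ** X ** matrix_inv g) (at 0)"
    using bounded_linear.has_vector_derivative[OF bounded_linear_compose[OF mm.bounded_linear_left[of "matrix_inv g"]
          mm.bounded_linear_right[of g]] matrix_exp_derivative_0[of X]] .
qed (auto intro: mult_mem exp_mem assms inv_mem simp: mult_inv assms)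

lemma Ad_exp_derivative:
  "((\<lambda>t. matrix_exp (t *\<^sub>R X) ** Y ** matrix_exp (- t *\<^sub>R X)) has_vector_derivative X ** Y - Y ** X) (at 0)"
proof -
  have 1: "((\<lambda>t. matrix_exp (t *\<^sub>R X) ** Y) has_vector_derivative X ** Y) (at 0)"
    by (rule bounded_linear.has_vector_derivative[OF mm.bounded_linear_left matrix_exp_derivative_0])
  have "((\<lambda>t. matrix_exp (t *\<^sub>R - X)) has_vector_derivative - X) (at 0)"
    by (rule matrix_exp_derivative_0)
  then have 2: "((\<lambda>t. matrix_exp (- t *\<^sub>R X)) has_vector_derivative - X) (at 0)" by simp
  show ?thesis using mm.has_vector_derivative[OF 1 2] by (simp add: mm.minus_right)
qed

lemma inv_exp: "X \<in> \<gg> \<Longrightarrow> matrix_inv (matrix_exp (t *\<^sub>R X)) = matrix_exp (- t *\<^sub>R X)"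
  using left_inverse_unique[OF matrix_exp_minus(1)[of "t *\<^sub>R X"] inv_mult[OF exp_mem]] by simp

text \<open>The curve \<open>Ad (exp tX) Y\<close> runs in the Lie algebra, a closed subspace. Its
  derivative at 0 is the bracket, hence a limit of difference quotients that lie in this
  subspace.\<close>

lemma bracket_mem:
  assumes "X \<in> \<gg>" "Y \<in> \<gg>"
  shows "X ** Y - Y ** X \<in> \<gg>"
proof -
  let ?F = "\<lambda>t. matrix_exp (t *\<^sub>R X) ** Y ** matrix_exp (- t *\<^sub>R X)"
  define t where "t n = inverse (real (Suc n))" for n
  have t: "t n > 0" for n by (simp add: t_def)
  have t0: "t \<longlonglongrightarrow> 0" unfolding t_def[abs_def] by (rule LIMSEQ_inverse_real_of_nat)
  have F: "?F s \<in> \<gg>" for s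
    using Ad_mem[OF exp_mem[OF assms(1)] assms(2), of s] by (simp add: inv_exp[OF assms(1)])
  have "(\<lambda>n. (t n - 0) /\<^sub>R t n) \<longlonglongrightarrow> 1" using t by (simp add: less_imp_neq[symmetric])
  from has_derivative_sequentially[OF Ad_exp_derivative[unfolded has_vector_derivative_def] t0 t this]
  have lim: "(\<lambda>n. (?F (t n) - ?F 0) /\<^sub>R t n) \<longlonglongrightarrow> X ** Y - Y ** X" by simp
  have "(?F (t n) - ?F 0) /\<^sub>R t n \<in> \<gg>" for n
    by (intro subspace_scale[OF subspace_lie_algebra] subspace_diff[OF subspace_lie_algebra] F)
  from closed_sequentially[OF closed_subspace[OF subspace_lie_algebra] this lim] show ?thesis .
qed

section \<open>Coordinates adapted to the group near the identity\<close>

definition lie_proj :: "complex^'n^'n \<Rightarrow> complex^'n^'n" where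
  "lie_proj = (SOME P. linear P \<and> (\<forall>x. P x \<in> \<gg>) \<and> (\<forall>x\<in>\<gg>. P x = x))"

lemma linear_lie_proj: "linear lie_proj"
  and lie_proj_mem: "lie_proj X \<in> \<gg>"
  and lie_proj_id: "X \<in> \<gg> \<Longrightarrow> lie_proj X = X"
  using someI_ex[OF subspace_projection_exists[OF subspace_lie_algebra]] unfolding lie_proj_def[symmetric]
  by auto

lemma bounded_linear_lie_proj: "bounded_linear lie_proj"
  using linear_lie_proj by (simp add: linear_conv_bounded_linear)

text \<open>Coordinates near the identity: the first factor runs through the group, the second through a
  linear slice transversal to it.\<close>

definition tube :: "complex^'n^'n \<Rightarrow> complex^'n^'n" where
  "tube Z = matrix_exp (lie_proj Z) ** (idm + (Z - lie_proj Z))"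

lemma tube_0: "tube 0 = idm"
  by (simp add: tube_def linear_0[OF linear_lie_proj])

lemma Ck_on_tube: "Ck_on k tube UNIV"
  unfolding tube_def[abs_def]
  by (intro Ck_on_bilinear[OF bounded_bilinear_matrix_mult] Ck_on_add Ck_on_diff Ck_on_const
      Ck_on_linear bounded_linear_ident bounded_linear_lie_proj open_UNIV
      Ck_on_compose_linear[OF bounded_linear_lie_proj _ Ck_on_matrix_exp]) auto

lemma tube_has_derivative: "(tube has_derivative (\<lambda>H. H)) (at 0)"
proof -
  have P: "(lie_proj has_derivative lie_proj) (at 0)"
    by (rule bounded_linear_imp_has_derivative[OF bounded_linear_lie_proj])
  have P0: "lie_proj 0 = 0" by (rule linear_0[OF linear_lie_proj])
  have "((\<lambda>Z. matrix_exp (lie_proj Z)) has_derivative lie_proj) (at 0)"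
    using has_derivative_compose[OF P, of matrix_exp "\<lambda>H. H"] matrix_exp_has_derivative_0 by (simp add: P0)
  moreover have "((\<lambda>Z. idm + (Z - lie_proj Z)) has_derivative (\<lambda>H. 0 + (H - lie_proj H))) (at 0)"
    by (intro has_derivative_add has_derivative_diff has_derivative_const has_derivative_ident P)
  ultimately have "(tube has_derivative (\<lambda>H. matrix_exp (lie_proj 0) ** (0 + (H - lie_proj H))
      + lie_proj H ** (idm + (0 - lie_proj 0)))) (at 0)"
    unfolding tube_def[abs_def] by (rule mm.FDERIV)
  then show ?thesis by (simp add: P0)
qed

text \<open>Cartan's theorem: near the identity the group has no points off the zero slice.
  Otherwise some \<open>g n\<close> tending to the identity have slice parts
  \<open>W n \<noteq> 0\<close>; dividing by the exponential factor leaves \<open>idm + W n\<close>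
  in the group. A limit \<open>u\<close> of the directions of \<open>W n\<close> is then a unit
  vector that lies in the Lie algebra and is killed by \<open>lie_proj\<close>, which is
  impossible.\<close>

lemma group_in_tube:
  assumes V: "open V" "idm \<in> V" and hom: "homeomorphism U V tube \<Psi>" and U: "0 \<in> U"
  obtains \<epsilon> where "\<epsilon> > 0" "\<And>g. g \<in> G \<Longrightarrow> dist g idm < \<epsilon> \<Longrightarrow> g \<in> V \<and> \<Psi> g \<in> \<gg>"
proof (rule ccontr)
  assume not: "\<not> thesis"
  obtain \<epsilon>0 where \<epsilon>0: "\<epsilon>0 > 0" "\<And>y. dist y idm < \<epsilon>0 \<Longrightarrow> y \<in> V"
    using V by (meson open_dist)
  have "\<exists>g\<in>G. dist g idm < min \<epsilon>0 (inverse (real (Suc n))) \<and> \<Psi> g \<notin> \<gg>" for n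
  proof (rule ccontr)
    assume "\<not> ?thesis"
    then show False using not that[of "min \<epsilon>0 (inverse (real (Suc n)))"] \<epsilon>0 by auto
  qed
  then obtain g where g: "\<And>n. g n \<in> G" "\<And>n. dist (g n) idm < \<epsilon>0"
    "\<And>n. dist (g n) idm < inverse (real (Suc n))" "\<And>n. \<Psi> (g n) \<notin> \<gg>"
    by (metis min_less_iff_conj)
  have gV: "g n \<in> V" for n using g(2) \<epsilon>0 by blast
  have "(\<lambda>n. dist (g n) idm) \<longlonglongrightarrow> 0"
    by (rule Lim_null_comparison[OF _ LIMSEQ_inverse_real_of_nat]) (use g(3) in \<open>auto intro: less_imp_le always_eventually\<close>)
  then have g1: "g \<longlonglongrightarrow> idm" by (rule iffD2[OF tendsto_dist_iff])
  define Z where "Z n = \<Psi> (g n)" for n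
  define W where "W n = Z n - lie_proj (Z n)" for n
  have \<Psi>1: "\<Psi> idm = 0" using hom U by (metis homeomorphism_apply1 tube_0)
  have "isCont \<Psi> idm"
    using hom V by (simp add: homeomorphism_def continuous_on_eq_continuous_at)
  then have Z0: "Z \<longlonglongrightarrow> 0" unfolding Z_def using isCont_tendsto_compose[OF _ g1] \<Psi>1 by metis
  have "W \<longlonglongrightarrow> 0 - lie_proj 0"
    unfolding W_def by (intro tendsto_intros Z0 bounded_linear.tendsto[OF bounded_linear_lie_proj])
  then have W0: "W \<longlonglongrightarrow> 0" by (simp add: linear_0[OF linear_lie_proj])
  have Wne: "W n \<noteq> 0" for n
  proof
    assume "W n = 0"
    then have "Z n = lie_proj (Z n)" by (simp add: W_def)
    then show False using lie_proj_mem[of "Z n"] g(4)[of n] by (simp add: Z_def)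
  qed
  have h: "idm + W n \<in> G" for n
  proof -
    have "tube (Z n) = g n" unfolding Z_def using hom gV by (simp add: homeomorphism_def)
    then have "matrix_exp (- lie_proj (Z n)) ** g n = idm + W n"
      by (metis tube_def W_def matrix_exp_minus(2) matrix_mul_assoc matrix_mul_lid)
    moreover have "matrix_exp (- lie_proj (Z n)) \<in> G"
      using exp_mem[OF lie_proj_mem, of "-1" "Z n"] by simp
    ultimately show ?thesis using mult_mem g(1) by metis
  qed
  let ?u = "\<lambda>n. W n /\<^sub>R norm (W n)"
  have "\<forall>n. ?u n \<in> sphere 0 1" using Wne by simp
  then have "\<exists>u\<in>sphere 0 1. \<exists>r. strict_mono r \<and> (?u \<circ> r) \<longlonglongrightarrow> u"
    using compact_sphere[of "0 :: complex^'n^'n" 1] unfolding compact_def by (elim allE[of _ ?u]) simp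
  then obtain u r where u: "u \<in> sphere 0 1" "strict_mono r" "(?u \<circ> r) \<longlonglongrightarrow> u" by blast
  have "u \<in> \<gg>"
  proof (rule limit_of_quotients_mem)
    show "idm + W (r n) \<in> G" for n by (rule h)
    show "norm (W (r n)) > 0" for n using Wne by simp
    show "(\<lambda>n. norm (W (r n))) \<longlonglongrightarrow> 0"
      using tendsto_norm_zero[OF LIMSEQ_subseq_LIMSEQ[OF W0 u(2)]] by (simp add: o_def)
    show "(\<lambda>n. (idm + W (r n) - idm) /\<^sub>R norm (W (r n))) \<longlonglongrightarrow> u"
      using u(3) by (simp add: o_def)
  qed
  have "lie_proj (?u (r n)) = 0" for n
    by (simp add: W_def linear_cmul[OF linear_lie_proj] linear_diff[OF linear_lie_proj] lie_proj_id lie_proj_mem)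
  moreover have "(\<lambda>n. lie_proj (?u (r n))) \<longlonglongrightarrow> lie_proj u"
    using bounded_linear.tendsto[OF bounded_linear_lie_proj u(3)] by (simp add: o_def)
  ultimately have "lie_proj u = 0" by (simp add: LIMSEQ_const_iff)
  with \<open>u \<in> \<gg>\<close> u(1) show False by (simp add: lie_proj_id)
qed

text \<open>Equivariance of the retraction \<open>\<rho>\<close> makes a Haar measure unnecessary: averaging \<open>\<pi>(\<rho>(x)) v\<close>
  over matrices \<open>x\<close> near the identity turns translation by the group into a linear change of variables.\<close>

lemma local_retraction:
  obtains r \<delta> \<rho> \<zeta> where "r > 0" "\<And>k. Ck_on k \<rho> (ball idm r)"
    "\<And>x. x \<in> ball idm r \<Longrightarrow> \<rho> x \<in> G" "\<And>x. x \<in> G \<Longrightarrow> x \<in> ball idm r \<Longrightarrow> \<rho> x = x"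
    "\<And>x. x \<in> ball idm r \<Longrightarrow> \<rho> x = matrix_exp (\<zeta> x)" "\<And>x. \<zeta> x \<in> \<gg>" "\<zeta> idm = 0"
    "(\<zeta> has_derivative lie_proj) (at idm)"
    "\<delta> > 0" "\<delta> \<le> r"
    "\<And>h x. h \<in> G \<Longrightarrow> dist h idm < \<delta> \<Longrightarrow> dist x idm < \<delta> \<Longrightarrow> h ** x \<in> ball idm r \<and> \<rho> (h ** x) = h ** \<rho> x"
proof -
  obtain U V \<Psi> where UV: "open U" "0 \<in> U" "open V" "idm \<in> V" "homeomorphism U V tube \<Psi>"
    and Ck: "\<And>k. Ck_on k \<Psi> V" and d\<Psi>: "(\<Psi> has_derivative (\<lambda>h. h)) (at idm)"
    using smooth_local_inverse[OF open_UNIV UNIV_I Ck_on_tube tube_has_derivative, unfolded tube_0] by metis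
  have \<Psi>_tube: "\<Psi> (tube z) = z" if "z \<in> U" for z using UV(5) that by (simp add: homeomorphism_def)
  have tube_\<Psi>: "tube (\<Psi> y) = y" if "y \<in> V" for y using UV(5) that by (simp add: homeomorphism_def)
  have \<Psi>1: "\<Psi> idm = 0" using \<Psi>_tube[OF UV(2)] by (simp add: tube_0)
  obtain \<epsilon> where \<epsilon>: "\<epsilon> > 0" "\<And>g. g \<in> G \<Longrightarrow> dist g idm < \<epsilon> \<Longrightarrow> g \<in> V \<and> \<Psi> g \<in> \<gg>"
    using group_in_tube[OF UV(3,4,5,2)] by blast
  obtain r0 where r0: "r0 > 0" "\<And>y. dist y idm < r0 \<Longrightarrow> y \<in> V"
    using UV by (meson open_dist)
  define r where "r = min \<epsilon> r0"
  have r: "r > 0" using \<epsilon> r0 by (simp add: r_def)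
  have rV: "ball idm r \<subseteq> V" using r0 by (auto simp: r_def dist_commute)
  \<comment> \<open>\<zeta> keeps the group coordinate of a point and drops its slice coordinate;
    the exponential of \<zeta> is the retraction.\<close>
  define \<zeta> where "\<zeta> x = lie_proj (\<Psi> x)" for x
  define \<rho> where "\<rho> x = matrix_exp (\<zeta> x)" for x
  have \<rho>G: "\<rho> x \<in> G" for x unfolding \<rho>_def \<zeta>_def by (intro exp_mem1 lie_proj_mem)
  have Ck\<rho>: "Ck_on k \<rho> (ball idm r)" for k
    unfolding \<rho>_def \<zeta>_def
    by (rule Ck_on_compose[OF open_ball Ck_on_bounded_linear_compose[OF bounded_linear_lie_proj open_ball
            Ck_on_subset[OF Ck rV]] Ck_on_matrix_exp]) simp
  have \<rho>id: "\<rho> x = x" if "x \<in> G" "dist x idm < \<epsilon>" for x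
  proof -
    have x: "x \<in> V" "\<Psi> x \<in> \<gg>" using \<epsilon>(2) that by auto
    then show ?thesis using tube_\<Psi>[OF x(1)] by (simp add: \<rho>_def \<zeta>_def tube_def lie_proj_id)
  qed
  have \<zeta>1: "\<zeta> idm = 0" by (simp add: \<zeta>_def \<Psi>1 linear_0[OF linear_lie_proj])
  have d\<zeta>: "(\<zeta> has_derivative lie_proj) (at idm)"
    unfolding \<zeta>_def[abs_def] by (rule bounded_linear.has_derivative[OF bounded_linear_lie_proj d\<Psi>])
  have \<rho>1: "\<rho> idm = idm" by (simp add: \<rho>_def \<zeta>1)
  have c\<Psi>: "isCont \<Psi> idm" by (rule has_derivative_continuous[OF d\<Psi>])
  have c\<rho>: "isCont \<rho> idm"
    using Ck_on_continuous[OF Ck\<rho>[of 0]] r by (simp add: continuous_on_eq_continuous_at)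
  let ?N = "nhds idm \<times>\<^sub>F nhds (idm :: complex^'n^'n)"
  have f: "(fst \<longlongrightarrow> idm) ?N" and s: "(snd \<longlongrightarrow> idm) ?N"
    by (simp_all add: filterlim_fst filterlim_snd)
  have \<rho>s: "((\<lambda>p. \<rho> (snd p)) \<longlongrightarrow> idm) ?N" using isCont_tendsto_compose[OF c\<rho> s] \<rho>1 by simp
  have "((\<lambda>p. fst p ** snd p) \<longlongrightarrow> idm ** idm) ?N" by (intro mm.tendsto f s)
  then have e1: "\<forall>\<^sub>F p in ?N. dist (fst p ** snd p) idm < r"
    using r by (auto dest: tendstoD)
  have h\<rho>: "((\<lambda>p. fst p ** \<rho> (snd p)) \<longlongrightarrow> idm) ?N"
    using mm.tendsto[OF f \<rho>s] by simp
  then have e2: "\<forall>\<^sub>F p in ?N. dist (fst p ** \<rho> (snd p)) idm < \<epsilon>"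
    using \<epsilon>(1) by (auto dest: tendstoD)
  \<comment> \<open>These are the expected tube coordinates of the product \<open>h x\<close>: the
    group part belongs to \<open>h\<close> times the retract of \<open>x\<close>, the slice part is
    that of \<open>x\<close>. They can be recognised as such only inside \<open>U\<close>, where
    \<Psi> inverts \<open>tube\<close>.\<close>
  have "((\<lambda>p. \<Psi> (fst p ** \<rho> (snd p)) + (\<Psi> (snd p) - lie_proj (\<Psi> (snd p)))) \<longlongrightarrow>
      \<Psi> idm + (\<Psi> idm - lie_proj (\<Psi> idm))) ?N"
    by (intro tendsto_intros isCont_tendsto_compose[OF c\<Psi>] h\<rho> s bounded_linear.tendsto[OF bounded_linear_lie_proj])
  then have "((\<lambda>p. \<Psi> (fst p ** \<rho> (snd p)) + (\<Psi> (snd p) - lie_proj (\<Psi> (snd p)))) \<longlongrightarrow> 0) ?N"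
    by (simp add: \<Psi>1 linear_0[OF linear_lie_proj])
  then have e3: "\<forall>\<^sub>F p in ?N. \<Psi> (fst p ** \<rho> (snd p)) + (\<Psi> (snd p) - lie_proj (\<Psi> (snd p))) \<in> U"
    using UV(1,2) by (rule topological_tendstoD)
  have "\<forall>\<^sub>F p in nhds (idm, idm). dist (fst p ** snd p) idm < r \<and> dist (fst p ** \<rho> (snd p)) idm < \<epsilon>
      \<and> \<Psi> (fst p ** \<rho> (snd p)) + (\<Psi> (snd p) - lie_proj (\<Psi> (snd p))) \<in> U"
    unfolding nhds_prod by (intro eventually_conj e1 e2 e3)
  then obtain d where d: "d > 0" "\<And>p. dist p (idm, idm) < d \<Longrightarrow> dist (fst p ** snd p) idm < r \<and> dist (fst p ** \<rho> (snd p)) idm < \<epsilon>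
      \<and> \<Psi> (fst p ** \<rho> (snd p)) + (\<Psi> (snd p) - lie_proj (\<Psi> (snd p))) \<in> U"
    unfolding eventually_nhds_metric by blast
  \<comment> \<open>The radius \<open>d\<close> concerns the pair \<open>(h, x)\<close>, whose
    distance from \<open>(idm, idm)\<close> is at most the sum of the two distances; hence
    \<open>d / 2\<close> for each.\<close>
  define \<delta> where "\<delta> = min r (d / 2)"
  have eq: "h ** x \<in> ball idm r \<and> \<rho> (h ** x) = h ** \<rho> x"
    if h: "h \<in> G" "dist h idm < \<delta>" and x: "dist x idm < \<delta>" for h x
  proof -
    have "dist (h, x) (idm, idm) \<le> dist h idm + dist x idm"
      unfolding dist_Pair_Pair by (rule sqrt_sum_squares_le_sum) simp_all
    also have "\<dots> < d" using h x by (simp add: \<delta>_def)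
    finally have D: "dist (h ** x) idm < r" "dist (h ** \<rho> x) idm < \<epsilon>"
      "\<Psi> (h ** \<rho> x) + (\<Psi> x - lie_proj (\<Psi> x)) \<in> U"
      using d(2)[of "(h, x)"] by auto
    let ?Z = "\<Psi> (h ** \<rho> x)" and ?W = "\<Psi> x - lie_proj (\<Psi> x)"
    have hx: "h ** \<rho> x \<in> V" "?Z \<in> \<gg>" using \<epsilon>(2)[OF mult_mem[OF h(1) \<rho>G] D(2)] by auto
    have P: "lie_proj (?Z + ?W) = ?Z"
      using hx(2) by (simp add: linear_add[OF linear_lie_proj] linear_diff[OF linear_lie_proj] lie_proj_id lie_proj_mem)
    have eZ: "matrix_exp ?Z = h ** \<rho> x"
      using tube_\<Psi>[OF hx(1)] hx(2) by (simp add: tube_def lie_proj_id)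
    have xV: "x \<in> V" using x rV by (auto simp: \<delta>_def dist_commute)
    have "tube (?Z + ?W) = h ** \<rho> x ** (idm + ?W)"
      unfolding tube_def P by (simp add: eZ)
    also have "\<dots> = h ** tube (\<Psi> x)" by (simp add: tube_def \<rho>_def \<zeta>_def matrix_mul_assoc)
    also have "\<dots> = h ** x" by (simp add: tube_\<Psi>[OF xV])
    finally have "\<Psi> (h ** x) = ?Z + ?W" using \<Psi>_tube[OF D(3)] by metis
    then have "\<rho> (h ** x) = h ** \<rho> x" using P eZ by (simp add: \<rho>_def \<zeta>_def)
    then show ?thesis using D(1) by (simp add: dist_commute)
  qed
  show thesis
  proof (rule that[of r \<rho> \<zeta> \<delta>])
    show "\<delta> > 0" "\<delta> \<le> r" using r d by (auto simp: \<delta>_def)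
    show "\<rho> x = x" if "x \<in> G" "x \<in> ball idm r" for x
      using \<rho>id that by (simp add: r_def dist_commute)
    show "\<zeta> x \<in> \<gg>" for x unfolding \<zeta>_def by (rule lie_proj_mem)
  qed (use r Ck\<rho> \<rho>G \<zeta>1 d\<zeta> eq in \<open>auto simp: \<rho>_def\<close>)
qed

end

section \<open>Complex Hilbert spaces\<close>

lemma scaleR_eq_scaleC: "r *\<^sub>R x = complex_of_real r *\<^sub>C (x :: 'h::complex_hilbert_space)"
  by (simp add: scaleC_of_real)

lemma cinner_scaleR_left: "cinner (r *\<^sub>R x) y = of_real r * cinner x (y :: 'h::complex_hilbert_space)"
  by (simp add: scaleR_eq_scaleC cinner_scaleC_left)

lemma cinner_add_right: "cinner x (y + z) = cinner x y + cinner x (z :: 'h::complex_hilbert_space)"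
  by (subst cinner_commute) (simp add: cinner_add_left cinner_commute[symmetric])

lemma cinner_scaleR_right: "cinner x (r *\<^sub>R y) = of_real r * cinner x (y :: 'h::complex_hilbert_space)"
  by (subst cinner_commute) (simp add: cinner_scaleR_left cinner_commute[symmetric])

lemma cinner_scaleC_right: "cinner x (c *\<^sub>C y) = cnj c * cinner x (y :: 'h::complex_hilbert_space)"
  by (subst cinner_commute) (simp add: cinner_scaleC_left cinner_commute[symmetric])

lemma Re_cinner_self_nonneg: "Re (cinner x x) \<ge> 0" for x :: "'h::complex_hilbert_space"
  by (metis norm_eq_sqrt_cinner norm_ge_zero real_sqrt_ge_0_iff)

lemma power2_norm_eq_cinner: "(norm x)\<^sup>2 = Re (cinner x x)" for x :: "'h::complex_hilbert_space"
  by (simp add: norm_eq_sqrt_cinner Re_cinner_self_nonneg)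

lemma Re_cinner_commute: "Re (cinner x y) = Re (cinner y (x :: 'h::complex_hilbert_space))"
  by (subst cinner_commute) simp

text \<open>The class takes \<open>norm\<close> from a Banach space, so the triangle inequality is
  available, and Cauchy-Schwarz follows from it by expanding the square of
  \<open>norm (x + y)\<close>; the usual deduction is reversed.\<close>

lemma Re_cinner_le: "Re (cinner x y) \<le> norm x * norm (y :: 'h::complex_hilbert_space)"
proof -
  have "(norm (x + y))\<^sup>2 = (norm x)\<^sup>2 + (norm y)\<^sup>2 + 2 * Re (cinner x y)"
    by (simp add: power2_norm_eq_cinner cinner_add_left cinner_add_right Re_cinner_commute[of y x])
  moreover have "(norm (x + y))\<^sup>2 \<le> (norm x + norm y)\<^sup>2"
    by (intro power_mono norm_triangle_ineq) simp
  ultimately show ?thesis by (simp add: power2_sum)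
qed

lemma abs_Re_cinner_le: "\<bar>Re (cinner x y)\<bar> \<le> norm x * norm (y :: 'h::complex_hilbert_space)"
  using Re_cinner_le[of x y] Re_cinner_le[of "(- 1) *\<^sub>R x" y] by (simp only: cinner_scaleR_left) simp

lemma norm_scaleC: "norm (c *\<^sub>C x) = norm c * norm (x :: 'h::complex_hilbert_space)"
proof -
  have "cinner (c *\<^sub>C x) (c *\<^sub>C x) = of_real ((norm c)\<^sup>2) * cinner x x"
    by (simp only: cinner_scaleC_left cinner_scaleC_right complex_norm_square mult_ac)
  then have "(norm (c *\<^sub>C x))\<^sup>2 = (norm c * norm x)\<^sup>2"
    unfolding power2_norm_eq_cinner power_mult_distrib by (simp del: of_real_power)
  then show ?thesis by (rule power2_eq_imp_eq) simp_all
qed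

lemma bounded_bilinear_cinner: "bounded_bilinear (cinner :: 'h::complex_hilbert_space \<Rightarrow> _)"
proof
  fix x y z :: 'h and r :: real
  show "cinner (r *\<^sub>R x) y = r *\<^sub>R cinner x y" "cinner x (r *\<^sub>R y) = r *\<^sub>R cinner x y"
    by (simp_all add: cinner_scaleR_left cinner_scaleR_right scaleR_conv_of_real)
  \<comment> \<open>The factor 2 comes from estimating the real and the imaginary part
    separately.\<close>
  have "norm (cinner x y) \<le> norm x * norm y * 2" for x y :: 'h
  proof -
    have "Im (cinner x y) = - Re (cinner (\<i> *\<^sub>C x) y)" by (simp add: cinner_scaleC_left)
    then have "\<bar>Im (cinner x y)\<bar> \<le> norm x * norm y"
      using abs_Re_cinner_le[of "\<i> *\<^sub>C x" y] by (simp add: norm_scaleC)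
    then show ?thesis using cmod_le[of "cinner x y"] abs_Re_cinner_le[of x y] by linarith
  qed
  then show "\<exists>K. \<forall>a b :: 'h. norm (cinner a b) \<le> norm a * norm b * K" by blast
qed (simp_all add: cinner_add_left cinner_add_right)

interpretation ci: bounded_bilinear "cinner :: 'h::complex_hilbert_space \<Rightarrow> _"
  by (rule bounded_bilinear_cinner)

lemma bounded_linear_Re_cinner: "bounded_linear (\<lambda>x. Re (cinner x (u :: 'h::complex_hilbert_space)))"
  using bounded_linear_compose[OF bounded_linear_Re ci.bounded_linear_left] .

lemma eq_if_Re_cinner_eq:
  assumes "\<And>u. Re (cinner x u) = Re (cinner y (u :: 'h::complex_hilbert_space))"
  shows "x = y"
proof -
  have "Re (cinner (x - y) (x - y)) = 0" using assms[of "x - y"] by (simp add: ci.diff_left)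
  then have "(norm (x - y))\<^sup>2 = 0" by (simp only: power2_norm_eq_cinner)
  then show ?thesis by simp
qed

lemma mean_value_bound:
  fixes f :: "real \<Rightarrow> 'a::real_normed_vector"
  assumes "0 \<le> b" and f': "\<And>t. 0 \<le> t \<Longrightarrow> t \<le> b \<Longrightarrow> (f has_vector_derivative f' t) (at t)"
    and B: "\<And>t. 0 \<le> t \<Longrightarrow> t \<le> b \<Longrightarrow> norm (f' t) \<le> B"
  shows "norm (f b - f 0) \<le> B * b"
proof -
  have "norm (f b - f 0) \<le> B * norm (b - 0)"
  proof (rule differentiable_bound[of "{0..b}"])
    show "(f has_derivative (\<lambda>h. h *\<^sub>R f' t)) (at t within {0..b})" if "t \<in> {0..b}" for t
      using f'[of t] that by (auto simp: has_vector_derivative_def intro: has_derivative_at_withinI)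
    show "onorm (\<lambda>h. h *\<^sub>R f' t) \<le> B" if "t \<in> {0..b}" for t
    proof (rule onorm_le)
      fix h :: real
      show "norm (h *\<^sub>R f' t) \<le> B * norm h"
        using mult_right_mono[OF B[of t], of "norm h"] that by (simp add: mult.commute)
    qed
  qed (use assms in auto)
  then show ?thesis using \<open>0 \<le> b\<close> by simp
qed

text \<open>The integral starts at \<open>-s\<close> because \<open>integral {a..t}\<close> is 0 for
  \<open>t < a\<close>: with base point 0 it would carry no information to the left. Here 0 is an
  interior point and the derivative is two-sided.\<close>

lemma integral_equation_derivative:
  fixes g :: "real \<Rightarrow> 'a::banach"
  assumes s: "s > 0" and cg: "continuous_on {-s..s} g"
    and eq: "\<And>t. t \<in> {-s..s} \<Longrightarrow> f t = c + integral {-s..t} g"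
  shows "(f has_vector_derivative g 0) (at 0)"
proof -
  have "((\<lambda>t. integral {-s..t} g) has_vector_derivative g 0) (at 0 within {-s..s})"
    using s by (intro integral_has_vector_derivative cg) auto
  then have "((\<lambda>t. integral {-s..t} g) has_vector_derivative g 0) (at 0)"
    using s by (simp add: at_within_interior[of 0 "{-s..s}"])
  then have "((\<lambda>t. c + integral {-s..t} g) has_vector_derivative 0 + g 0) (at 0)"
    by (intro has_vector_derivative_add has_vector_derivative_const)
  then have "(f has_vector_derivative 0 + g 0) (at 0)"
    by (rule has_vector_derivative_transform_within_open[where S = "{-s<..<s}"]) (use s eq in auto)
  then show ?thesis by simp
qed

section \<open>A criterion for smoothness\<close>

locale unitary_rep = closed_linear_group G for G :: "(complex^'n^'n) set" +
  fixes \<pi> :: "complex^'n^'n \<Rightarrow> 'h::complex_hilbert_space \<Rightarrow> 'h"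
  assumes unitary: "unitary_representation G \<pi>"
begin

lemma rep_add: "g \<in> G \<Longrightarrow> \<pi> g (x + y) = \<pi> g x + \<pi> g y"
  and rep_scaleC: "g \<in> G \<Longrightarrow> \<pi> g (c *\<^sub>C x) = c *\<^sub>C \<pi> g x"
  and cinner_rep: "g \<in> G \<Longrightarrow> cinner (\<pi> g x) (\<pi> g y) = cinner x y"
  and rep_mult: "g \<in> G \<Longrightarrow> h \<in> G \<Longrightarrow> \<pi> (g ** h) x = \<pi> g (\<pi> h x)"
  and continuous_on_rep: "continuous_on G (\<lambda>g. \<pi> g x)"
  using unitary unfolding unitary_representation_def by blast+

lemma norm_rep: "g \<in> G \<Longrightarrow> norm (\<pi> g x) = norm x"
  by (simp add: norm_eq_sqrt_cinner cinner_rep)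

lemma rep_scaleR: "g \<in> G \<Longrightarrow> \<pi> g (r *\<^sub>R x) = r *\<^sub>R \<pi> g x"
  by (simp add: scaleR_eq_scaleC rep_scaleC)

lemma bounded_linear_rep: "g \<in> G \<Longrightarrow> bounded_linear (\<pi> g)"
  by (rule bounded_linear_intro[where K = 1]) (simp_all add: rep_add rep_scaleR norm_rep)

text \<open>The definition of a unitary representation does not state this. Surjectivity writes
  \<open>x\<close> as \<open>\<pi> idm y\<close>, and \<open>\<pi> idm\<close> is
  idempotent.\<close>

lemma rep_one: "\<pi> idm x = x"
proof -
  have "surj (\<pi> idm)" using unitary one_mem unfolding unitary_representation_def by blast
  then obtain y where "x = \<pi> idm y" by blast
  then show ?thesis using rep_mult[OF one_mem one_mem, of y] by simp
qed

lemma rep_inv: "g \<in> G \<Longrightarrow> \<pi> g (\<pi> (matrix_inv g) x) = x" "g \<in> G \<Longrightarrow> \<pi> (matrix_inv g) (\<pi> g x) = x"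
  by (simp_all add: rep_mult[symmetric] inv_mem mult_inv inv_mult rep_one)

lemma rep_exp_derivative_shift:
  assumes X: "X \<in> \<gg>"
    and d: "((\<lambda>s. \<pi> (matrix_exp (s *\<^sub>R X)) (\<pi> (matrix_exp (t *\<^sub>R X)) v)) has_vector_derivative y) (at 0)"
  shows "((\<lambda>s. \<pi> (matrix_exp (s *\<^sub>R X)) v) has_vector_derivative y) (at t)"
proof -
  have 1: "((\<lambda>s. s - t) has_vector_derivative 1) (at t)" by (auto intro!: derivative_eq_intros)
  have "((\<lambda>s. \<pi> (matrix_exp (s *\<^sub>R X)) (\<pi> (matrix_exp (t *\<^sub>R X)) v)) has_vector_derivative y) (at (t - t))"
    using d by simp
  from vector_diff_chain_at[OF 1 this]
  have "((\<lambda>s. \<pi> (matrix_exp ((s - t) *\<^sub>R X)) (\<pi> (matrix_exp (t *\<^sub>R X)) v)) has_vector_derivative y) (at t)"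
    by (simp add: o_def)
  moreover have "\<pi> (matrix_exp ((s - t) *\<^sub>R X)) (\<pi> (matrix_exp (t *\<^sub>R X)) v) = \<pi> (matrix_exp (s *\<^sub>R X)) v" for s
    using matrix_exp_add_scale[of "s - t" t X] rep_mult[OF exp_mem[OF X] exp_mem[OF X]] by simp
  ultimately show ?thesis by simp
qed

text \<open>\<open>matrix_inv (\<rho> x)\<close> is the inverse of left multiplication by
  \<open>\<rho> x\<close>, an operator on the space of matrices, so smoothness of inverse operators
  applies.\<close>

lemma Ck_on_matrix_inv:
  fixes U :: "'a::real_normed_vector set" and \<rho> :: "'a \<Rightarrow> complex^'n^'n"
  assumes U: "open U" and \<rho>: "Ck_on k \<rho> U" and mem: "\<And>x. x \<in> U \<Longrightarrow> \<rho> x \<in> G"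
  shows "Ck_on k (\<lambda>x. matrix_inv (\<rho> x)) U"
proof -
  have A: "Ck_on k (\<lambda>x. \<rho> x ** h) U" for h :: "complex^'n^'n"
    by (intro Ck_on_bilinear[OF bounded_bilinear_matrix_mult] U \<rho> Ck_on_const)
  have l: "linear (\<lambda>h :: complex^'n^'n. a ** h)" for a :: "complex^'n^'n"
    by (rule bounded_linear.linear[OF mm.bounded_linear_right])
  have "Ck_on k (\<lambda>x. matrix_inv (\<rho> x) ** idm) U"
    by (rule Ck_on_inverse_operator[where A = "\<lambda>x h. \<rho> x ** h" and B = "\<lambda>x h. matrix_inv (\<rho> x) ** h"])
      (use U l mem A in \<open>auto simp: mult_inv_cancel inv_mult_cancel\<close>)
  then show ?thesis by simp
qed

text \<open>Smoothness of a vector asks for extensions of its orbit map to open sets of matrices.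
  Composition with the retraction, moved from the identity to \<open>g\<close>, supplies them, so it
  suffices to consider smooth maps into the group.\<close>

lemma smooth_vectorsI:
  assumes retract: "\<And>(U :: (complex^'n^'n) set) \<rho> k. open U \<Longrightarrow> (\<And>j. Ck_on j \<rho> U) \<Longrightarrow> (\<And>x. x \<in> U \<Longrightarrow> \<rho> x \<in> G) \<Longrightarrow>
    Ck_on k (\<lambda>x. \<pi> (\<rho> x) v) U"
  shows "v \<in> smooth_vectors G \<pi>"
  unfolding smooth_vectors_def smooth_on_group_def
proof (intro CollectI ballI)
  fix g assume g: "g \<in> G"
  obtain r \<rho> where r: "r > 0" and \<rho>: "\<And>k. Ck_on k \<rho> (ball idm r)"
    "\<And>x. x \<in> ball idm r \<Longrightarrow> \<rho> x \<in> G" "\<And>x. x \<in> G \<Longrightarrow> x \<in> ball idm r \<Longrightarrow> \<rho> x = x"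
    using local_retraction by metis
  define U where "U = (\<lambda>x. matrix_inv g ** x) -` ball idm r"
  have U: "open U"
    unfolding U_def by (intro open_vimage open_ball linear_continuous_on mm.bounded_linear_right)
  have gU: "g \<in> U" using r by (simp add: U_def inv_mult[OF g])
  let ?\<rho> = "\<lambda>x. g ** \<rho> (matrix_inv g ** x)"
  have "Ck_on k ?\<rho> U" for k
    by (intro Ck_on_bounded_linear_compose[OF mm.bounded_linear_right] U
        Ck_on_compose_linear[OF mm.bounded_linear_right _ \<rho>(1)]) (simp add: U_def)
  moreover have "?\<rho> x \<in> G" if "x \<in> U" for x
    using that g \<rho>(2) by (auto simp: U_def intro: mult_mem)
  ultimately have "Ck_on k (\<lambda>x. \<pi> (?\<rho> x) v) U" for k
    by (intro retract[OF U])
  moreover have "\<pi> (?\<rho> x) v = \<pi> x v" if "x \<in> U \<inter> G" for x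
    using that \<rho>(3)[of "matrix_inv g ** x"] inv_mem[OF g] by (auto simp: U_def mult_mem mult_inv_cancel[OF g])
  ultimately show "\<exists>U \<Phi>. open U \<and> g \<in> U \<and> (\<forall>k. Ck_on k \<Phi> U) \<and> (\<forall>x\<in>U \<inter> G. \<Phi> x = \<pi> x v)"
    using U gU by blast
qed

end

text \<open>\<open>D X\<close> is a candidate for \<open>d\<pi>(X)\<close> on a set of vectors not yet known to be smooth.\<close>

locale derivative_family = unitary_rep G \<pi>
  for G :: "(complex^'n^'n) set" and \<pi> :: "complex^'n^'n \<Rightarrow> 'h::complex_hilbert_space \<Rightarrow> 'h" +
  fixes S :: "'h set" and D :: "complex^'n^'n \<Rightarrow> 'h \<Rightarrow> 'h"
  assumes D_mem: "v \<in> S \<Longrightarrow> X \<in> lie_algebra G \<Longrightarrow> D X v \<in> S"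
    and D_derivative: "v \<in> S \<Longrightarrow> X \<in> lie_algebra G \<Longrightarrow>
      ((\<lambda>t. \<pi> (matrix_exp (t *\<^sub>R X)) v) has_vector_derivative D X v) (at 0)"
    and D_add: "v \<in> S \<Longrightarrow> X \<in> lie_algebra G \<Longrightarrow> Y \<in> lie_algebra G \<Longrightarrow> D (X + Y) v = D X v + D Y v"
    and D_scale: "v \<in> S \<Longrightarrow> X \<in> lie_algebra G \<Longrightarrow> D (r *\<^sub>R X) v = r *\<^sub>R D X v"
begin

lemma D_derivative_at:
  assumes "v \<in> S" "X \<in> \<gg>"
  shows "((\<lambda>t. \<pi> (matrix_exp (t *\<^sub>R X)) v) has_vector_derivative \<pi> (matrix_exp (t *\<^sub>R X)) (D X v)) (at t)"
proof (rule rep_exp_derivative_shift[OF assms(2)])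
  have "\<pi> (matrix_exp (s *\<^sub>R X)) (\<pi> (matrix_exp (t *\<^sub>R X)) v) = \<pi> (matrix_exp (t *\<^sub>R X)) (\<pi> (matrix_exp (s *\<^sub>R X)) v)" for s
    using matrix_exp_add_scale[of s t X] matrix_exp_add_scale[of t s X]
    by (simp add: rep_mult[symmetric] exp_mem[OF assms(2)] add.commute)
  then show "((\<lambda>s. \<pi> (matrix_exp (s *\<^sub>R X)) (\<pi> (matrix_exp (t *\<^sub>R X)) v)) has_vector_derivative
      \<pi> (matrix_exp (t *\<^sub>R X)) (D X v)) (at 0)"
    using bounded_linear.has_vector_derivative[OF bounded_linear_rep[OF exp_mem[OF assms(2)]] D_derivative[OF assms]]
    by simp
qed

lemma linear_D_proj: "v \<in> S \<Longrightarrow> linear (\<lambda>X. D (lie_proj X) v)"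
  by (rule linearI)
    (simp_all add: linear_add[OF linear_lie_proj] linear_cmul[OF linear_lie_proj] D_add D_scale lie_proj_mem)

lemma bounded_linear_D_proj: "v \<in> S \<Longrightarrow> bounded_linear (\<lambda>X. D (lie_proj X) v)"
  using linear_D_proj by (simp add: linear_conv_bounded_linear)

lemma D_expand:
  assumes "v \<in> S" "X \<in> \<gg>"
  shows "D X v = (\<Sum>b\<in>Basis. (X \<bullet> b) *\<^sub>R D (lie_proj b) v)"
  using linear_euclidean_expand[OF linear_D_proj[OF assms(1)], of X] assms(2) by (simp add: lie_proj_id)

lemma D_bounded:
  assumes "v \<in> S"
  obtains C where "C \<ge> 0" "\<And>X. X \<in> \<gg> \<Longrightarrow> norm (D X v) \<le> C * norm X"
proof -
  obtain C where "C \<ge> 0" "\<And>X. norm (D (lie_proj X) v) \<le> norm X * C"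
    using bounded_linear.nonneg_bounded[OF bounded_linear_D_proj[OF assms]] by blast
  then show thesis using that[of C] by (metis lie_proj_id mult.commute)
qed

lemma rep_exp_lipschitz:
  assumes "v \<in> S" "X \<in> \<gg>" "0 \<le> t"
  shows "norm (\<pi> (matrix_exp (t *\<^sub>R X)) v - v) \<le> norm (D X v) * t"
proof -
  have "norm (\<pi> (matrix_exp (t *\<^sub>R X)) v - \<pi> (matrix_exp (0 *\<^sub>R X)) v) \<le> norm (D X v) * t"
    by (rule mean_value_bound[OF assms(3) D_derivative_at[OF assms(1,2)]])
      (simp add: norm_rep exp_mem assms(2))
  then show ?thesis by (simp add: rep_one)
qed

text \<open>A second-order Taylor bound: the derivative of \<open>q\<close> is the increment of the
  orbit of \<open>D X v\<close>, which the Lipschitz estimate bounds by a further derivative.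
  Expanding \<open>X\<close> in a basis makes the constant independent of \<open>X\<close>, so that
  directional derivatives can be assembled into a Frechet derivative.\<close>

lemma rep_exp_quadratic:
  assumes v: "v \<in> S"
  obtains C where "\<And>X. X \<in> \<gg> \<Longrightarrow> norm (\<pi> (matrix_exp X) v - v - D X v) \<le> C * (norm X)\<^sup>2"
proof -
  let ?w = "\<lambda>b. D (lie_proj b) v"
  have w: "?w b \<in> S" for b by (intro D_mem v lie_proj_mem)
  have "\<exists>C\<ge>0. \<forall>X\<in>\<gg>. norm (D X (?w b)) \<le> C * norm X" for b using D_bounded[OF w[of b]] by metis
  then obtain C where C: "\<And>b. C b \<ge> 0" "\<And>b X. X \<in> \<gg> \<Longrightarrow> norm (D X (?w b)) \<le> C b * norm X" by metis
  have "norm (\<pi> (matrix_exp X) v - v - D X v) \<le> (\<Sum>b\<in>Basis. C b) * (norm X)\<^sup>2" if X: "X \<in> \<gg>" for X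
  proof -
    define q where "q t = \<pi> (matrix_exp (t *\<^sub>R X)) v - t *\<^sub>R D X v" for t :: real
    have q': "(q has_vector_derivative \<pi> (matrix_exp (t *\<^sub>R X)) (D X v) - D X v) (at t)" for t
      unfolding q_def
      by (rule has_vector_derivative_diff[OF D_derivative_at[OF v X]]) (auto intro!: derivative_eq_intros)
    have "norm (q 1 - q 0) \<le> ((\<Sum>b\<in>Basis. C b) * (norm X)\<^sup>2) * 1"
    proof (rule mean_value_bound[OF _ q'])
      fix t :: real assume t: "0 \<le> t" "t \<le> 1"
      have e: "matrix_exp (t *\<^sub>R X) \<in> G" by (rule exp_mem[OF X])
      have "\<pi> (matrix_exp (t *\<^sub>R X)) (D X v) - D X v
          = (\<Sum>b\<in>Basis. (X \<bullet> b) *\<^sub>R (\<pi> (matrix_exp (t *\<^sub>R X)) (?w b) - ?w b))"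
        unfolding D_expand[OF v X] linear_sum[OF bounded_linear.linear[OF bounded_linear_rep[OF e]]]
        by (simp add: rep_scaleR[OF e] sum_subtractf scaleR_diff_right)
      also have "norm \<dots> \<le> (\<Sum>b\<in>Basis. norm X * (C b * norm X))"
      proof (rule order_trans[OF norm_sum sum_mono])
        fix b :: "complex^'n^'n" assume b: "b \<in> Basis"
        have "norm (\<pi> (matrix_exp (t *\<^sub>R X)) (?w b) - ?w b) \<le> norm (D X (?w b)) * t"
          by (rule rep_exp_lipschitz[OF w X t(1)])
        also have "\<dots> \<le> (C b * norm X) * 1"
          using t C X by (intro mult_mono) auto
        finally show "norm ((X \<bullet> b) *\<^sub>R (\<pi> (matrix_exp (t *\<^sub>R X)) (?w b) - ?w b)) \<le> norm X * (C b * norm X)"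
          using Basis_le_norm[OF b, of X] by (simp add: mult_mono)
      qed
      also have "\<dots> = (\<Sum>b\<in>Basis. C b) * (norm X)\<^sup>2"
        unfolding sum_distrib_right by (intro sum.cong) (auto simp: power2_eq_square)
      finally show "norm (\<pi> (matrix_exp (t *\<^sub>R X)) (D X v) - D X v) \<le> (\<Sum>b\<in>Basis. C b) * (norm X)\<^sup>2" .
    qed simp
    then show ?thesis by (simp add: q_def rep_one algebra_simps)
  qed
  then show thesis using that by blast
qed

text \<open>The quadratic bound is uniform in the direction and so gives a Frechet derivative of
  \<open>\<pi> (exp X) v\<close> at 0 on the Lie algebra; the logarithm \<zeta> transports it to the
  group.\<close>

lemma rep_has_derivative_one:
  assumes v: "v \<in> S"
  shows "((\<lambda>g. \<pi> g v) has_derivative (\<lambda>Y. D (lie_proj Y) v)) (at idm within G)"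
proof -
  obtain r \<rho> \<zeta> where r: "r > 0" and \<rho>: "\<And>x. x \<in> G \<Longrightarrow> x \<in> ball idm r \<Longrightarrow> \<rho> x = x"
    "\<And>x. x \<in> ball idm r \<Longrightarrow> \<rho> x = matrix_exp (\<zeta> x)" and \<zeta>: "\<And>x. \<zeta> x \<in> \<gg>" "\<zeta> idm = 0"
    "(\<zeta> has_derivative lie_proj) (at idm)"
    using local_retraction by metis
  obtain C where C: "\<And>X. X \<in> \<gg> \<Longrightarrow> norm (\<pi> (matrix_exp X) v - v - D X v) \<le> C * (norm X)\<^sup>2"
    using rep_exp_quadratic[OF v] by blast
  have "((\<lambda>X. \<pi> (matrix_exp X) v) has_derivative (\<lambda>Y. D (lie_proj Y) v)) (at 0 within \<gg>)"
    by (rule has_derivative_quadratic[where \<delta> = 1 and C = C, OF bounded_linear_D_proj[OF v]])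
      (use C in \<open>auto simp: rep_one lie_proj_id\<close>)
  then have "((\<lambda>X. \<pi> (matrix_exp X) v) has_derivative (\<lambda>Y. D (lie_proj Y) v)) (at (\<zeta> idm) within \<zeta> ` G)"
    using \<zeta> by (auto intro: has_derivative_subset)
  from has_derivative_in_compose[OF has_derivative_at_withinI[OF \<zeta>(3)] this]
  have "((\<lambda>x. \<pi> (matrix_exp (\<zeta> x)) v) has_derivative (\<lambda>Y. D (lie_proj Y) v)) (at idm within G)"
    by (simp add: lie_proj_id lie_proj_mem)
  then show ?thesis
  proof (rule has_derivative_transform_within[OF _ r one_mem])
    fix x assume "x \<in> G" "dist x idm < r"
    then show "\<pi> (matrix_exp (\<zeta> x)) v = \<pi> x v" using \<rho>[of x] by (simp add: dist_commute)
  qed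
qed

lemma Ck_on_rep:
  assumes U: "open U" and \<rho>: "\<And>j. Ck_on j \<rho> U" and mem: "\<And>x. x \<in> U \<Longrightarrow> \<rho> x \<in> G"
    and "v \<in> S"
  shows "Ck_on k (\<lambda>x. \<pi> (\<rho> x) v) U"
  using assms(4)
proof (induction k arbitrary: v)
  case 0
  show ?case
    using continuous_on_compose2[OF continuous_on_rep Ck_on_continuous[OF \<rho>[of 0]]] mem by auto
next
  case (Suc k)
  let ?\<rho>' = "\<lambda>x. frechet_derivative \<rho> (at x)"
  \<comment> \<open>The left logarithmic derivative of \<rho>; its coordinates are the smooth
    coefficients in the derivative.\<close>
  let ?c = "\<lambda>x h. matrix_inv (\<rho> x) ** ?\<rho>' x h"
  show ?case
  proof (rule Ck_on_SucI[where f' = "\<lambda>x h. \<Sum>b\<in>Basis. (?c x h \<bullet> b) *\<^sub>R \<pi> (\<rho> x) (D (lie_proj b) v)", OF U])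
    fix x assume x: "x \<in> U"
    note g = mem[OF x]
    \<comment> \<open>Translation by the inverse of \<open>\<rho> x\<close> moves the point to the
      identity, where the derivative of the orbit map is known.\<close>
    let ?f = "\<lambda>y. matrix_inv (\<rho> x) ** \<rho> y"
    have "(\<rho> has_derivative ?\<rho>' x) (at x)" by (rule Ck_on_SucD[OF \<rho>[of "Suc 0"] x])
    then have f': "(?f has_derivative ?c x) (at x within U)"
      by (rule bounded_linear.has_derivative[OF mm.bounded_linear_right has_derivative_at_withinI])
    have "?f ` U \<subseteq> G" using mem g inv_mem mult_mem by blast
    then have "((\<lambda>g. \<pi> g v) has_derivative (\<lambda>Y. D (lie_proj Y) v)) (at (?f x) within ?f ` U)"
      unfolding inv_mult[OF g] by (rule has_derivative_subset[OF rep_has_derivative_one[OF Suc.prems]])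
    from has_derivative_in_compose[OF f' this]
    have "((\<lambda>y. \<pi> (?f y) v) has_derivative (\<lambda>h. D (lie_proj (?c x h)) v)) (at x)"
      using at_within_open[OF x U] by simp
    from bounded_linear.has_derivative[OF bounded_linear_rep[OF g] this]
    have "((\<lambda>y. \<pi> (\<rho> x) (\<pi> (?f y) v)) has_derivative (\<lambda>h. \<pi> (\<rho> x) (D (lie_proj (?c x h)) v))) (at x)" .
    moreover have "\<pi> (\<rho> x) (D (lie_proj (?c x h)) v) = (\<Sum>b\<in>Basis. (?c x h \<bullet> b) *\<^sub>R \<pi> (\<rho> x) (D (lie_proj b) v))" for h
      unfolding linear_euclidean_expand[OF linear_D_proj[OF Suc.prems], of "?c x h"]
        linear_sum[OF bounded_linear.linear[OF bounded_linear_rep[OF g]]]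
      by (simp add: rep_scaleR[OF g])
    ultimately have "((\<lambda>y. \<pi> (\<rho> x) (\<pi> (?f y) v)) has_derivative
        (\<lambda>h. \<Sum>b\<in>Basis. (?c x h \<bullet> b) *\<^sub>R \<pi> (\<rho> x) (D (lie_proj b) v))) (at x)" by simp
    then show "((\<lambda>x. \<pi> (\<rho> x) v) has_derivative
        (\<lambda>h. \<Sum>b\<in>Basis. (?c x h \<bullet> b) *\<^sub>R \<pi> (\<rho> x) (D (lie_proj b) v))) (at x)"
    proof (rule has_derivative_transform_within_open[OF _ U x])
      fix y assume "y \<in> U"
      then show "\<pi> (\<rho> x) (\<pi> (?f y) v) = \<pi> (\<rho> y) v"
        using rep_mult[OF g, of "?f y" v] mem g by (simp add: mult_mem inv_mem mult_inv_cancel)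
    qed
  next
    fix h
    have "Ck_on k (\<lambda>x. ?\<rho>' x h) U" using \<rho>[of "Suc k"] by simp
    moreover have "Ck_on k (\<lambda>x. matrix_inv (\<rho> x)) U"
      by (rule Ck_on_matrix_inv[OF U \<rho> mem])
    ultimately have c: "Ck_on k (\<lambda>x. ?c x h) U"
      by (intro Ck_on_bilinear[OF bounded_bilinear_matrix_mult U])
    have IH: "Ck_on k (\<lambda>x. \<pi> (\<rho> x) (D (lie_proj b) v)) U" for b
      by (rule Suc.IH[OF D_mem[OF Suc.prems lie_proj_mem]])
    show "Ck_on k (\<lambda>x. \<Sum>b\<in>Basis. (?c x h \<bullet> b) *\<^sub>R \<pi> (\<rho> x) (D (lie_proj b) v)) U"
      by (rule Ck_on_sum[OF U]) (rule Ck_on_scaleR[OF U Ck_on_inner[OF U c Ck_on_const] IH])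
  qed
qed

lemma mem_smooth_vectors: "v \<in> S \<Longrightarrow> v \<in> smooth_vectors G \<pi>"
proof (rule smooth_vectorsI)
  fix U :: "(complex^'n^'n) set" and \<rho> k
  assume "v \<in> S" "open U" "\<And>j. Ck_on j \<rho> U" "\<And>x. x \<in> U \<Longrightarrow> \<rho> x \<in> G"
  then show "Ck_on k (\<lambda>x. \<pi> (\<rho> x) v) U" by (intro Ck_on_rep)
qed

end

section \<open>Garding vectors\<close>

lemma Ck_on_real_polynomial_function:
  "real_polynomial_function p \<Longrightarrow> Ck_on k p UNIV"
proof (induction p rule: real_polynomial_function.induct)
  case (mult f g)
  show ?case by (rule Ck_on_bilinear[OF bounded_bilinear_mult open_UNIV mult.IH])
qed (auto intro: Ck_on_linear Ck_on_add)

section \<open>Integration by parts along linear vector fields\<close>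

lemma has_integral_cbox_continuous:
  fixes f :: "'a::euclidean_space \<Rightarrow> 'b::banach"
  assumes "continuous_on UNIV f"
  shows "(f has_integral integral (cbox a b) f) (cbox a b)"
  using assms by (intro integrable_integral integrable_continuous) (auto intro: continuous_on_subset)

text \<open>The divergence of the vector field \<open>\<phi>(x) L x\<close>; the sum over the basis
  is the trace of \<open>L\<close>.\<close>

definition linear_divergence :: "('a::euclidean_space \<Rightarrow> 'a) \<Rightarrow> ('a \<Rightarrow> real) \<Rightarrow> 'a \<Rightarrow> real" where
  "linear_divergence L \<phi> x = frechet_derivative \<phi> (at x) (L x) + (\<Sum>e\<in>Basis. L e \<bullet> e) * \<phi> x"

lemma Ck_on_frechet_derivative_apply:
  fixes \<phi> :: "'a::euclidean_space \<Rightarrow> 'b::real_normed_vector"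
  assumes \<phi>: "Ck_on (Suc k) \<phi> U" and U: "open U" and L: "Ck_on k L U"
  shows "Ck_on k (\<lambda>x. frechet_derivative \<phi> (at x) (L x)) U"
proof (rule Ck_on_cong[OF _ U])
  show "Ck_on k (\<lambda>x. \<Sum>b\<in>Basis. (L x \<bullet> b) *\<^sub>R frechet_derivative \<phi> (at x) b) U"
    using \<phi> by (intro Ck_on_sum[OF U] Ck_on_scaleR[OF U] Ck_on_inner[OF U] L Ck_on_const) simp
  show "frechet_derivative \<phi> (at x) (L x) = (\<Sum>b\<in>Basis. (L x \<bullet> b) *\<^sub>R frechet_derivative \<phi> (at x) b)"
    if "x \<in> U" for x
    by (rule linear_euclidean_expand[OF has_derivative_linear[OF Ck_on_SucD[OF \<phi> that]]])
qed

lemma Ck_on_linear_divergence: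
  assumes "Ck_on (Suc k) \<phi> UNIV" "bounded_linear L"
  shows "Ck_on k (linear_divergence L \<phi>) UNIV"
  unfolding linear_divergence_def[abs_def]
  by (rule Ck_on_add[OF open_UNIV Ck_on_frechet_derivative_apply[OF assms(1) open_UNIV Ck_on_linear[OF assms(2) open_UNIV]]
        Ck_on_bounded_linear_compose[OF bounded_linear_mult_right open_UNIV Ck_on_Suc_imp[OF assms(1)]]])

text \<open>The divergence is the sum over basis vectors \<open>e\<close> of the derivative along
  \<open>e\<close> of the component \<open>(L x \<bullet> e) F x\<close>, and each of these
  derivatives has integral 0.\<close>

lemma integral_linear_divergence_eq_0:
  fixes F :: "'a::euclidean_space \<Rightarrow> real"
  assumes F: "Ck_on 1 F UNIV" and supp: "\<And>x. x \<notin> cball c r \<Longrightarrow> F x = 0"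
    and R: "r < R" "cball c R \<subseteq> cbox a b" and L: "bounded_linear L"
  shows "integral (cbox a b) (linear_divergence L F) = 0"
proof -
  let ?F' = "\<lambda>x. frechet_derivative F (at x)"
  let ?H = "\<lambda>e x. (L x \<bullet> e) *\<^sub>R F x"
  have dF: "(F has_derivative ?F' x) (at x)" for x
    using Ck_on_SucD[of 0 F UNIV x] F by simp
  have CH: "Ck_on 1 (?H e) UNIV" for e
    by (intro Ck_on_scaleR Ck_on_inner Ck_on_linear L Ck_on_const F open_UNIV)
  have dH: "frechet_derivative (?H e) (at x) e = (L x \<bullet> e) * ?F' x e + (L e \<bullet> e) * F x" for e x
  proof -
    have 1: "((\<lambda>x. L x \<bullet> e) has_derivative (\<lambda>h. L h \<bullet> e)) (at x)"
      by (rule bounded_linear.has_derivative[OF bounded_linear_inner_left bounded_linear_imp_has_derivative[OF L]])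
    have "(?H e has_derivative (\<lambda>h. (L x \<bullet> e) *\<^sub>R ?F' x h + (L h \<bullet> e) *\<^sub>R F x)) (at x)"
      by (rule bounded_bilinear.FDERIV[OF bounded_bilinear_scaleR 1 dF])
    from frechet_derivative_at[OF this, symmetric] show ?thesis by simp
  qed
  have 0: "((\<lambda>x. frechet_derivative (?H e) (at x) e) has_integral 0) (cbox a b)" for e
  proof -
    have "continuous_on UNIV (\<lambda>x. frechet_derivative (?H e) (at x) e)" using CH[of e] by simp
    from has_integral_cbox_continuous[OF this, of a b] show ?thesis
      using integral_directional_derivative_eq_0[OF CH _ R, of e] supp by simp
  qed
  have "((\<lambda>x. \<Sum>e\<in>Basis. frechet_derivative (?H e) (at x) e) has_integral (\<Sum>e\<in>(Basis :: 'a set). 0)) (cbox a b)"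
    by (rule has_integral_sum[OF finite_Basis]) (rule 0)
  moreover have "(\<Sum>e\<in>Basis. frechet_derivative (?H e) (at x) e) = linear_divergence L F x" for x
    unfolding dH linear_divergence_def linear_euclidean_expand[OF has_derivative_linear[OF dF], of x "L x"]
    by (simp add: sum.distrib sum_distrib_right)
  ultimately show ?thesis by (simp add: integral_unique)
qed

text \<open>For a \<open>C\<^sup>1\<close> function \<open>m\<close> the flow formula is integration by parts; it involves no derivative
  of \<open>m\<close>, so polynomial approximation extends it to the merely continuous matrix coefficients.\<close>

context
  fixes \<phi> :: "complex^'n^'n \<Rightarrow> real" and c a b A :: "complex^'n^'n" and r R :: real
  assumes \<phi>: "Ck_on 1 \<phi> UNIV" and supp: "\<And>x. x \<notin> cball c r \<Longrightarrow> \<phi> x = 0"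
    and R: "r < R" "cball c R \<subseteq> cbox a b"
begin

lemma continuous_on_flow:
  fixes m :: "complex^'n^'n \<Rightarrow> 'b::topological_space"
  shows "continuous_on UNIV m \<Longrightarrow> continuous_on X (\<lambda>p. m (matrix_exp (fst p *\<^sub>R A) ** snd p))"
  by (rule continuous_on_compose2[of UNIV m])
    (auto intro!: mm.continuous_on continuous_on_compose2[OF continuous_on_matrix_exp[of UNIV]] continuous_intros)

lemma flow_integral_C1:
  assumes m: "Ck_on 1 m UNIV" and pq: "p \<le> q"
  shows "((\<lambda>s. integral (cbox a b) (\<lambda>x. - linear_divergence ((**) A) \<phi> x * m (matrix_exp (s *\<^sub>R A) ** x))) has_integral
    integral (cbox a b) (\<lambda>x. \<phi> x * m (matrix_exp (q *\<^sub>R A) ** x))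
    - integral (cbox a b) (\<lambda>x. \<phi> x * m (matrix_exp (p *\<^sub>R A) ** x))) {p..q}"
proof (rule fundamental_theorem_of_calculus[OF pq])
  fix s :: real
  let ?m' = "\<lambda>y. frechet_derivative m (at y)" and ?\<phi>' = "\<lambda>x. frechet_derivative \<phi> (at x)"
  let ?E = "\<lambda>s. matrix_exp (s *\<^sub>R A)"
  have dm: "(m has_derivative ?m' y) (at y)" for y using Ck_on_SucD[of 0 m UNIV y] m by simp
  have d\<phi>: "(\<phi> has_derivative ?\<phi>' y) (at y)" for y using Ck_on_SucD[of 0 \<phi> UNIV y] \<phi> by simp
  have cm: "continuous_on UNIV m" by (rule Ck_on_continuous[OF m])
  have c\<phi>: "continuous_on UNIV \<phi>" by (rule Ck_on_continuous[OF \<phi>])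
  have cm': "continuous_on UNIV (\<lambda>y. ?m' y h)" for h using m by simp
  let ?g = "\<lambda>s x. \<phi> x * ?m' (?E s ** x) (?E s ** (A ** x))"
  have g_expand: "?g s x = (\<Sum>e\<in>Basis. \<phi> x * (((?E s ** (A ** x)) \<bullet> e) * ?m' (?E s ** x) e))" for s x
    unfolding linear_euclidean_expand[OF has_derivative_linear[OF dm], of "?E s ** x" "?E s ** (A ** x)"]
    by (simp add: sum_distrib_left)
  have cg: "continuous_on (UNIV \<times> cbox a b) (\<lambda>(s, x). ?g s x)"
    unfolding case_prod_unfold g_expand
    by (intro continuous_on_sum continuous_on_mult continuous_on_inner continuous_on_const continuous_on_flow[OF cm']
        mm.continuous_on continuous_on_compose2[OF continuous_on_matrix_exp[of UNIV]] continuous_on_compose2[OF c\<phi>]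
        continuous_intros subset_UNIV)
  have "((\<lambda>s. integral (cbox a b) (\<lambda>x. \<phi> x * m (?E s ** x))) has_vector_derivative
      integral (cbox a b) (?g s)) (at s within UNIV)"
  proof (rule leibniz_rule_vector_derivative[OF _ _ cg])
    fix s x assume "x \<in> cbox a b"
    have 1: "((\<lambda>s. ?E s ** x) has_vector_derivative ?E s ** A ** x) (at s)"
      by (rule bounded_linear.has_vector_derivative[OF mm.bounded_linear_left matrix_exp_has_vector_derivative])
    have "((\<lambda>s. m (?E s ** x)) has_vector_derivative ?m' (?E s ** x) (?E s ** A ** x)) (at s)"
      using vector_derivative_diff_chain_within[OF 1 has_derivative_at_withinI[OF dm]] by (simp add: o_def)
    then have "((\<lambda>s. \<phi> x * m (?E s ** x)) has_vector_derivative \<phi> x * ?m' (?E s ** x) (?E s ** A ** x)) (at s)"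
      by (rule bounded_linear.has_vector_derivative[OF bounded_linear_mult_right])
    then show "((\<lambda>s. \<phi> x * m (?E s ** x)) has_vector_derivative ?g s x) (at s within UNIV)"
      by (simp add: matrix_mul_assoc)
  next
    show "(\<lambda>x. \<phi> x * m (?E s ** x)) integrable_on cbox a b" for s
      by (intro integrable_continuous continuous_on_mult continuous_on_subset[OF c\<phi>]
          continuous_on_compose2[OF cm] mm.continuous_on continuous_on_const continuous_on_id subset_UNIV)
  qed auto
  moreover have "integral (cbox a b) (?g s) = integral (cbox a b) (\<lambda>x. - linear_divergence ((**) A) \<phi> x * m (?E s ** x))"
  proof -
    let ?F = "\<lambda>x. \<phi> x * m (?E s ** x)"
    have CE: "Ck_on 1 (\<lambda>x. m (?E s ** x)) UNIV"
      by (rule Ck_on_compose_linear[OF mm.bounded_linear_right open_UNIV m]) simp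
    have CF: "Ck_on 1 ?F UNIV"
      by (rule Ck_on_bilinear[OF bounded_bilinear_mult open_UNIV \<phi> CE])
    \<comment> \<open>Product rule: the integrand obtained by differentiating \<open>m\<close>
      differs from the desired one, in which the derivative falls on \<phi>, by the divergence
      belonging to \<open>?F\<close>. That divergence integrates to 0.\<close>
    have dF: "?g s x - (- linear_divergence ((**) A) \<phi> x * m (?E s ** x)) = linear_divergence ((**) A) ?F x" for x
    proof -
      have 1: "((\<lambda>x. m (?E s ** x)) has_derivative (\<lambda>h. ?m' (?E s ** x) (?E s ** h))) (at x)"
        by (rule has_derivative_compose[OF bounded_linear_imp_has_derivative[OF mm.bounded_linear_right] dm])
      have "(?F has_derivative (\<lambda>h. \<phi> x * ?m' (?E s ** x) (?E s ** h) + ?\<phi>' x h * m (?E s ** x))) (at x)"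
        by (rule has_derivative_mult[OF d\<phi> 1])
      from frechet_derivative_at[OF this, symmetric] show ?thesis
        by (simp add: linear_divergence_def algebra_simps)
    qed
    have "Ck_on 0 (linear_divergence ((**) A) ?F) UNIV" "Ck_on 0 (linear_divergence ((**) A) \<phi>) UNIV"
      using Ck_on_linear_divergence[of 0 _ "(**) A"] CF \<phi> mm.bounded_linear_right by auto
    then have c: "continuous_on UNIV (linear_divergence ((**) A) ?F)" "continuous_on UNIV (linear_divergence ((**) A) \<phi>)"
      by simp_all
    have "(linear_divergence ((**) A) ?F has_integral 0) (cbox a b)"
      using has_integral_cbox_continuous[OF c(1), of a b]
        integral_linear_divergence_eq_0[OF CF _ R mm.bounded_linear_right, of A] supp by simp
    moreover have "continuous_on UNIV (\<lambda>x. - linear_divergence ((**) A) \<phi> x * m (?E s ** x))"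
      by (intro continuous_on_mult continuous_on_minus c Ck_on_continuous[OF CE])
    ultimately have "((\<lambda>x. linear_divergence ((**) A) ?F x + (- linear_divergence ((**) A) \<phi> x * m (?E s ** x))) has_integral
        0 + integral (cbox a b) (\<lambda>x. - linear_divergence ((**) A) \<phi> x * m (?E s ** x))) (cbox a b)"
      by (intro has_integral_add has_integral_cbox_continuous)
    then show ?thesis unfolding dF[symmetric] by (simp add: integral_unique)
  qed
  ultimately show "((\<lambda>s. integral (cbox a b) (\<lambda>x. \<phi> x * m (?E s ** x))) has_vector_derivative
      integral (cbox a b) (\<lambda>x. - linear_divergence ((**) A) \<phi> x * m (?E s ** x))) (at s within {p..q})"
    by (simp add: has_vector_derivative_at_within)
qed

lemma linear_divergence_support: "x \<notin> cball c r \<Longrightarrow> linear_divergence L \<phi> x = 0"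
proof -
  assume x: "x \<notin> cball c r"
  have "(\<phi> has_derivative (\<lambda>h. 0)) (at x)"
    by (rule has_derivative_transform_within_open[of "\<lambda>_. 0" _ x UNIV "- cball c r"]) (use x supp in auto)
  from frechet_derivative_at[OF this, symmetric] show ?thesis by (simp add: linear_divergence_def supp[OF x])
qed

lemma flow_integral_bound:
  fixes g :: "complex^'n^'n" and \<psi> m m' :: "complex^'n^'n \<Rightarrow> real"
  assumes \<psi>: "continuous_on UNIV \<psi>" and \<psi>0: "\<And>x. x \<notin> cball c r \<Longrightarrow> \<psi> x = 0"
    and K: "\<And>x. x \<in> cbox a b \<Longrightarrow> \<bar>\<psi> x\<bar> \<le> K"
    and m: "continuous_on UNIV m" "continuous_on UNIV m'"
    and \<epsilon>: "\<And>x. x \<in> cball c r \<Longrightarrow> \<bar>m (g ** x) - m' (g ** x)\<bar> \<le> \<epsilon>" "\<epsilon> \<ge> 0" "K \<ge> 0"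
  shows "\<bar>integral (cbox a b) (\<lambda>x. \<psi> x * m (g ** x)) - integral (cbox a b) (\<lambda>x. \<psi> x * m' (g ** x))\<bar>
    \<le> K * \<epsilon> * Henstock_Kurzweil_Integration.content (cbox a b)"
proof -
  have c: "continuous_on UNIV (\<lambda>x. \<psi> x * f (g ** x))" if "continuous_on UNIV f" for f :: "complex^'n^'n \<Rightarrow> real"
    by (intro continuous_on_mult \<psi> continuous_on_compose2[OF that] mm.continuous_on continuous_on_const
        continuous_on_id subset_UNIV)
  have "norm (integral (cbox a b) (\<lambda>x. \<psi> x * m (g ** x)) - integral (cbox a b) (\<lambda>x. \<psi> x * m' (g ** x)))
    \<le> K * \<epsilon> * Henstock_Kurzweil_Integration.content (cbox a b)"
  proof (rule has_integral_bound)
    show "((\<lambda>x. \<psi> x * m (g ** x) - \<psi> x * m' (g ** x)) has_integral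
        integral (cbox a b) (\<lambda>x. \<psi> x * m (g ** x)) - integral (cbox a b) (\<lambda>x. \<psi> x * m' (g ** x))) (cbox a b)"
      by (intro has_integral_diff has_integral_cbox_continuous c m)
    fix x assume x: "x \<in> cbox a b"
    show "norm (\<psi> x * m (g ** x) - \<psi> x * m' (g ** x)) \<le> K * \<epsilon>"
    proof (cases "x \<in> cball c r")
      case True
      have "\<psi> x * m (g ** x) - \<psi> x * m' (g ** x) = \<psi> x * (m (g ** x) - m' (g ** x))" by (simp add: algebra_simps)
      then show ?thesis using mult_mono[OF K[OF x] \<epsilon>(1)[OF True] \<epsilon>(3)] by (simp add: abs_mult)
    qed (use \<psi>0 \<epsilon> in simp)
  qed (use \<epsilon> in simp)
  then show ?thesis by simp
qed

lemma flow_integral: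
  assumes m: "continuous_on UNIV m" and pq: "p \<le> q"
  shows "((\<lambda>s. integral (cbox a b) (\<lambda>x. - linear_divergence ((**) A) \<phi> x * m (matrix_exp (s *\<^sub>R A) ** x))) has_integral
    integral (cbox a b) (\<lambda>x. \<phi> x * m (matrix_exp (q *\<^sub>R A) ** x))
    - integral (cbox a b) (\<lambda>x. \<phi> x * m (matrix_exp (p *\<^sub>R A) ** x))) {p..q}"
proof -
  let ?E = "\<lambda>s. matrix_exp (s *\<^sub>R A)" and ?\<psi> = "\<lambda>x. - linear_divergence ((**) A) \<phi> x"
  let ?C = "Henstock_Kurzweil_Integration.content (cbox a b)"
  define I where "I \<eta> n s = integral (cbox a b) (\<lambda>x. \<eta> x * n (?E s ** x))"
    for \<eta> n :: "complex^'n^'n \<Rightarrow> real" and s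
  have c\<phi>: "continuous_on UNIV \<phi>" by (rule Ck_on_continuous[OF \<phi>])
  have "continuous_on UNIV (linear_divergence ((**) A) \<phi>)"
    using Ck_on_linear_divergence[of 0 \<phi>, OF _ mm.bounded_linear_right[of A]] \<phi> by simp
  then have c\<psi>: "continuous_on UNIV ?\<psi>" by (rule continuous_on_minus)
  have "\<exists>K. \<forall>x\<in>cbox a b. \<bar>\<eta> x\<bar> \<le> K" if "continuous_on UNIV \<eta>" for \<eta> :: "complex^'n^'n \<Rightarrow> real"
  proof -
    have "bounded (\<eta> ` cbox a b)"
      by (intro compact_imp_bounded compact_continuous_image continuous_on_subset[OF that] compact_cbox) simp
    then show ?thesis unfolding bounded_iff by auto
  qed
  then obtain K1 K2 where K1: "\<And>x. x \<in> cbox a b \<Longrightarrow> \<bar>\<phi> x\<bar> \<le> K1" and K2: "\<And>x. x \<in> cbox a b \<Longrightarrow> \<bar>?\<psi> x\<bar> \<le> K2"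
    using c\<phi> c\<psi> by metis
  define K where "K = max 0 (max K1 K2)"
  have K: "K \<ge> 0" "\<And>x. x \<in> cbox a b \<Longrightarrow> \<bar>\<phi> x\<bar> \<le> K" "\<And>x. x \<in> cbox a b \<Longrightarrow> \<bar>?\<psi> x\<bar> \<le> K"
    using K1 K2 by (force simp: K_def)+
  \<comment> \<open>All points that the flow reaches from the support ball during
    \<open>{p..q}\<close>. This set is compact, and only there must a polynomial be close to
    \<open>m\<close>.\<close>
  let ?S = "(\<lambda>z. ?E (fst z) ** snd z) ` ({p..q} \<times> cball c r)"
  have S: "compact ?S"
    by (intro compact_continuous_image continuous_on_flow[of "\<lambda>y. y"] continuous_on_id compact_Times compact_Icc compact_cball)
  have cI: "continuous_on {p..q} (I ?\<psi> m)"
  proof -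
    have "continuous_on ({p..q} \<times> cbox a b) (\<lambda>(s, x). ?\<psi> x * m (?E s ** x))"
      unfolding case_prod_unfold
      by (intro continuous_on_mult continuous_on_compose2[OF c\<psi>] continuous_on_flow[OF m] continuous_intros subset_UNIV)
    from integral_continuous_on_param[OF this] show ?thesis unfolding I_def .
  qed
  have int: "(I ?\<psi> m has_integral integral {p..q} (I ?\<psi> m)) {p..q}"
    by (intro integrable_integral integrable_continuous_interval cI)
  have "integral {p..q} (I ?\<psi> m) = I \<phi> m q - I \<phi> m p"
  proof (rule ccontr)
    assume ne: "integral {p..q} (I ?\<psi> m) \<noteq> I \<phi> m q - I \<phi> m p"
    define \<Delta> where "\<Delta> = \<bar>integral {p..q} (I ?\<psi> m) - (I \<phi> m q - I \<phi> m p)\<bar>"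
    \<comment> \<open>\<open>K * \<epsilon> * ?C\<close> bounds the error of each integral over the
      box; it enters once integrated over \<open>{p..q}\<close> and once at each endpoint. The
      summand 1 makes \<open>B\<close> positive and the final estimate strict.\<close>
    define B where "B = K * ?C * (q - p) + 2 * (K * ?C) + 1"
    have \<Delta>: "\<Delta> > 0" using ne by (simp add: \<Delta>_def)
    have B: "B > 0" using K(1) pq by (auto simp: B_def intro!: add_nonneg_pos mult_nonneg_nonneg)
    define \<epsilon> where "\<epsilon> = \<Delta> / B"
    have \<epsilon>: "\<epsilon> > 0" using \<Delta> B by (simp add: \<epsilon>_def)
    obtain n where n: "real_polynomial_function n" "\<And>x. x \<in> ?S \<Longrightarrow> \<bar>m x - n x\<bar> < \<epsilon>"
      by (rule Stone_Weierstrass_real_polynomial_function[OF S continuous_on_subset[OF m subset_UNIV] \<epsilon>])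
        (rule that)
    have Cn: "Ck_on 1 n UNIV" by (rule Ck_on_real_polynomial_function[OF n(1)])
    have cn: "continuous_on UNIV n" by (rule Ck_on_continuous[OF Cn])
    have close: "\<bar>m (?E s ** x) - n (?E s ** x)\<bar> \<le> \<epsilon>" if "s \<in> {p..q}" "x \<in> cball c r" for s x
    proof -
      have "?E s ** x \<in> ?S" using that by (intro image_eqI[of _ _ "(s, x)"]) auto
      from n(2)[OF this] show ?thesis by (rule less_imp_le)
    qed
    have b\<psi>: "\<bar>I ?\<psi> m s - I ?\<psi> n s\<bar> \<le> K * \<epsilon> * ?C" if "s \<in> {p..q}" for s
      unfolding I_def
      by (rule flow_integral_bound[OF c\<psi> _ K(3) m cn close[OF that] _ K(1)])
        (use \<epsilon> linear_divergence_support in auto)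
    have b\<phi>: "\<bar>I \<phi> m s - I \<phi> n s\<bar> \<le> K * \<epsilon> * ?C" if "s \<in> {p..q}" for s
      unfolding I_def
      by (rule flow_integral_bound[OF c\<phi> supp K(2) m cn close[OF that] _ K(1)]) (use \<epsilon> in auto)
    have "(I ?\<psi> n has_integral I \<phi> n q - I \<phi> n p) {p..q}"
      unfolding I_def by (rule flow_integral_C1[OF Cn pq])
    from has_integral_diff[OF int this]
    have "((\<lambda>s. I ?\<psi> m s - I ?\<psi> n s) has_integral
        integral {p..q} (I ?\<psi> m) - (I \<phi> n q - I \<phi> n p)) (cbox p q)" by simp
    then have "norm (integral {p..q} (I ?\<psi> m) - (I \<phi> n q - I \<phi> n p))
        \<le> K * \<epsilon> * ?C * Henstock_Kurzweil_Integration.content (cbox p q)"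
      by (rule has_integral_bound[rotated]) (use b\<psi> K(1) \<epsilon> in auto)
    then have "\<bar>integral {p..q} (I ?\<psi> m) - (I \<phi> n q - I \<phi> n p)\<bar> \<le> K * \<epsilon> * ?C * (q - p)"
      using pq by simp
    moreover have "\<bar>I \<phi> m q - I \<phi> n q\<bar> \<le> K * \<epsilon> * ?C" "\<bar>I \<phi> m p - I \<phi> n p\<bar> \<le> K * \<epsilon> * ?C"
      using b\<phi> pq by auto
    ultimately have "\<Delta> \<le> K * \<epsilon> * ?C * (q - p) + 2 * (K * \<epsilon> * ?C)" unfolding \<Delta>_def by linarith
    also have "\<dots> = \<epsilon> * (B - 1)" by (simp add: B_def algebra_simps)
    also have "\<dots> < \<epsilon> * B" using \<epsilon> by simp
    also have "\<epsilon> * B = \<Delta>" using B by (simp add: \<epsilon>_def)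
    finally show False by simp
  qed
  with int show ?thesis unfolding I_def by simp
qed

end

text \<open>\<open>f\<close> is controlled only on the larger ball, but the product vanishes off the
  smaller closed ball; the larger ball and the complement of the smaller one are open and cover the
  space.\<close>

lemma continuous_on_cutoff:
  fixes f :: "'a::metric_space \<Rightarrow> 'b::real_normed_vector"
  assumes \<phi>: "continuous_on UNIV \<phi>" and supp: "\<And>x. x \<notin> cball c d \<Longrightarrow> \<phi> x = 0"
    and "d < r" and f: "continuous_on (ball c r) f"
  shows "continuous_on UNIV (\<lambda>x. \<phi> x *\<^sub>R f x)"
proof -
  have "continuous_on (ball c r) (\<lambda>x. \<phi> x *\<^sub>R f x)"
    by (intro continuous_on_scaleR f continuous_on_subset[OF \<phi>]) simp
  moreover have "continuous_on (- cball c d) (\<lambda>x. \<phi> x *\<^sub>R f x)"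
    by (rule continuous_on_eq[of _ "\<lambda>_. 0"]) (use supp in auto)
  ultimately have "continuous_on (ball c r \<union> - cball c d) (\<lambda>x. \<phi> x *\<^sub>R f x)"
    by (intro continuous_on_open_Un) auto
  moreover have "ball c r \<union> - cball c d = UNIV" using \<open>d < r\<close> by auto
  ultimately show ?thesis by simp
qed

text \<open>The support radius \<open>d\<close> is below \<delta>, where the retraction is
  equivariant, and at most \<open>r / 4\<close>, so that a translation which moves points of the
  support by at most \<open>r / 4\<close> keeps them in the ball of radius \<open>r / 2\<close>. The
  box is a bounded domain of integration around the ball.\<close>

locale garding = unitary_rep G \<pi>
  for G :: "(complex^'n^'n) set" and \<pi> :: "complex^'n^'n \<Rightarrow> 'h::complex_hilbert_space \<Rightarrow> 'h" +
  fixes \<rho> :: "complex^'n^'n \<Rightarrow> complex^'n^'n" and r \<delta> d :: real and a b :: "complex^'n^'n"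
  assumes retraction: "continuous_on (ball idm r) \<rho>" "\<And>x. x \<in> ball idm r \<Longrightarrow> \<rho> x \<in> G" "\<rho> idm = idm"
    and equivariant: "\<And>h x. h \<in> G \<Longrightarrow> dist h idm < \<delta> \<Longrightarrow> dist x idm < \<delta> \<Longrightarrow>
      h ** x \<in> ball idm r \<and> \<rho> (h ** x) = h ** \<rho> x"
    and radii: "0 < d" "d < \<delta>" "d \<le> r / 4"
    and box: "cball idm r \<subseteq> cbox a b"
begin

section \<open>Averages and their derivatives along the group\<close>

definition test_functions :: "(complex^'n^'n \<Rightarrow> real) set" where
  "test_functions = {\<phi>. (\<forall>k. Ck_on k \<phi> UNIV) \<and> (\<forall>x. x \<notin> cball idm d \<longrightarrow> \<phi> x = 0)}"

definition average :: "(complex^'n^'n \<Rightarrow> real) \<Rightarrow> 'h \<Rightarrow> 'h" where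
  "average \<phi> v = integral (cbox a b) (\<lambda>x. \<phi> x *\<^sub>R \<pi> (\<rho> x) v)"

lemma continuous_on_test: "\<phi> \<in> test_functions \<Longrightarrow> continuous_on UNIV \<phi>"
  unfolding test_functions_def using Ck_on_continuous by blast

lemma rep_retraction_continuous: "continuous_on (ball idm r) (\<lambda>x. \<pi> (\<rho> x) v)"
  by (rule continuous_on_compose2[OF continuous_on_rep retraction(1)]) (use retraction(2) in auto)

lemma average_has_integral:
  assumes "\<phi> \<in> test_functions"
  shows "((\<lambda>x. \<phi> x *\<^sub>R \<pi> (\<rho> x) v) has_integral average \<phi> v) (cbox a b)"
  unfolding average_def
proof (rule has_integral_cbox_continuous)
  show "continuous_on UNIV (\<lambda>x. \<phi> x *\<^sub>R \<pi> (\<rho> x) v)"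
    by (rule continuous_on_cutoff[OF continuous_on_test[OF assms] _ _ rep_retraction_continuous, where d = d])
      (use assms radii in \<open>auto simp: test_functions_def\<close>)
qed

lemma average_add:
  assumes "\<phi> \<in> test_functions" "\<psi> \<in> test_functions"
  shows "average (\<lambda>x. \<phi> x + \<psi> x) v = average \<phi> v + average \<psi> v"
  using has_integral_add[OF average_has_integral[OF assms(1), of v] average_has_integral[OF assms(2), of v]]
  by (simp add: average_def scaleR_add_left integral_unique)

lemma average_scale:
  assumes "\<phi> \<in> test_functions"
  shows "average (\<lambda>x. s * \<phi> x) v = s *\<^sub>R average \<phi> v"
  using has_integral_cmul[OF average_has_integral[OF assms, of v], of s]
  by (simp add: average_def integral_unique)

text \<open>On averages the derived action of \<open>A\<close> becomes this first-order operator on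
  the density: minus the divergence of \<phi> times the field \<open>x \<mapsto> A x\<close>, the
  formal adjoint of differentiation along left translations.\<close>

definition lie_action :: "complex^'n^'n \<Rightarrow> (complex^'n^'n \<Rightarrow> real) \<Rightarrow> complex^'n^'n \<Rightarrow> real" where
  "lie_action A \<phi> x = - linear_divergence ((**) A) \<phi> x"

lemma lie_action_mem:
  assumes "\<phi> \<in> test_functions"
  shows "lie_action A \<phi> \<in> test_functions"
proof -
  have "Ck_on k (lie_action A \<phi>) UNIV" for k
    unfolding lie_action_def[abs_def]
    using assms by (intro Ck_on_minus Ck_on_linear_divergence mm.bounded_linear_right open_UNIV)
      (auto simp: test_functions_def)
  moreover have "lie_action A \<phi> x = 0" if "x \<notin> cball idm d" for x
  proof -
    have "(\<phi> has_derivative (\<lambda>h. 0)) (at x)"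
      by (rule has_derivative_transform_within_open[of "\<lambda>_. 0" _ x UNIV "- cball idm d"])
        (use that assms in \<open>auto simp: test_functions_def\<close>)
    from frechet_derivative_at[OF this, symmetric] show ?thesis
      using assms that by (simp add: lie_action_def linear_divergence_def test_functions_def)
  qed
  ultimately show ?thesis by (auto simp: test_functions_def)
qed

lemma lie_action_linear:
  assumes "\<phi> \<in> test_functions"
  shows "lie_action (A + B) \<phi> = (\<lambda>x. lie_action A \<phi> x + lie_action B \<phi> x)"
    and "lie_action (s *\<^sub>R A) \<phi> = (\<lambda>x. s * lie_action A \<phi> x)"
proof -
  have "linear (frechet_derivative \<phi> (at x))" for x
    using assms Ck_on_SucD[of 0 \<phi> UNIV x] by (auto simp: test_functions_def intro: has_derivative_linear)
  then show "lie_action (A + B) \<phi> = (\<lambda>x. lie_action A \<phi> x + lie_action B \<phi> x)"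
    "lie_action (s *\<^sub>R A) \<phi> = (\<lambda>x. s * lie_action A \<phi> x)"
    by (auto simp: fun_eq_iff lie_action_def linear_divergence_def mm.add_left mm.scaleR_left linear_add linear_cmul
        inner_add_left sum.distrib algebra_simps sum_distrib_left)
qed

text \<open>By equivariance, translating an average by a small group element moves the argument of the
  integrand, so that the flow formula applies to matrix coefficients.\<close>

lemma Re_cinner_rep_average:
  assumes \<phi>: "\<phi> \<in> test_functions" and h: "h \<in> G" "dist h idm < \<delta>"
    and m: "\<And>x. x \<in> cball idm d \<Longrightarrow> m (h ** x) = Re (cinner (\<pi> (\<rho> (h ** x)) v) u)"
  shows "Re (cinner (\<pi> h (average \<phi> v)) u) = integral (cbox a b) (\<lambda>x. \<phi> x * m (h ** x))"
proof -
  have bl: "bounded_linear (\<lambda>w. Re (cinner (\<pi> h w) u))"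
    by (rule bounded_linear_compose[OF bounded_linear_Re_cinner bounded_linear_rep[OF h(1)]])
  have e: "Re (cinner (\<pi> h (\<phi> x *\<^sub>R \<pi> (\<rho> x) v)) u) = \<phi> x * m (h ** x)" for x
  proof (cases "x \<in> cball idm d")
    case True
    then have x: "dist x idm < \<delta>" "x \<in> ball idm r" using radii by (auto simp: dist_commute)
    have "\<pi> (\<rho> (h ** x)) v = \<pi> h (\<pi> (\<rho> x) v)"
      using equivariant[OF h x(1)] rep_mult[OF h(1) retraction(2)[OF x(2)]] by simp
    then show ?thesis using m[OF True] by (simp add: rep_scaleR[OF h(1)] cinner_scaleR_left)
  next
    case False
    then have "\<phi> x = 0" using \<phi> by (simp add: test_functions_def)
    then show ?thesis using linear_simps(3)[OF bl] by simp
  qed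
  from has_integral_linear[OF average_has_integral[OF \<phi>, where v = v] bl]
  have "((\<lambda>x. \<phi> x * m (h ** x)) has_integral Re (cinner (\<pi> h (average \<phi> v)) u)) (cbox a b)"
    by (simp add: o_def e)
  then show ?thesis by (simp add: integral_unique)
qed

text \<open>Differentiating under the integral would require a derivative of the orbit map of
  \<open>v\<close>, which is only continuous. The identity is proved in integrated form instead, one
  matrix coefficient at a time, where \<open>flow_integral\<close> asks for continuity
  alone.\<close>

lemma average_derivative:
  assumes \<phi>: "\<phi> \<in> test_functions" and A: "A \<in> \<gg>"
  shows "((\<lambda>t. \<pi> (matrix_exp (t *\<^sub>R A)) (average \<phi> v)) has_vector_derivative average (lie_action A \<phi>) v) (at 0)"
proof -
  let ?E = "\<lambda>t. matrix_exp (t *\<^sub>R A)" and ?w = "average \<phi> v" and ?w' = "average (lie_action A \<phi>) v"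
  have E: "?E t \<in> G" for t by (rule exp_mem[OF A])
  have cE: "continuous_on UNIV ?E"
    by (intro continuous_on_compose2[OF continuous_on_matrix_exp[of UNIV]] continuous_intros subset_UNIV)
  obtain K where K: "K > 0" "\<And>(A :: complex^'n^'n) (B :: complex^'n^'n). norm (A ** B) \<le> norm A * norm B * K"
    using matrix_mult_bounded by blast
  define N where "N = norm (idm :: complex^'n^'n) + d"
  have N: "N > 0" unfolding N_def using radii by (simp add: add_nonneg_pos)
  have Kpos: "K * N > 0" using K(1) N by simp
  \<comment> \<open>\<delta> is what equivariance needs. The other bound makes multiplication by
    \<open>?E t\<close> move a point of the support by at most \<open>r / 4\<close>:
    \<open>N\<close> bounds the norms of such points and \<open>K\<close> is the constant of the
    matrix product.\<close>
  define \<epsilon> where "\<epsilon> = min \<delta> (r / 4 / (K * N))"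
  have \<epsilon>: "\<epsilon> > 0" using radii Kpos by (auto simp: \<epsilon>_def)
  have "isCont ?E 0" using cE by (simp add: continuous_on_eq_continuous_at)
  then obtain s0 where s0: "s0 > 0" "\<And>t. dist t 0 < s0 \<Longrightarrow> dist (?E t) (?E 0) < \<epsilon>"
    unfolding continuous_at_eps_delta using \<epsilon> by blast
  define s where "s = s0 / 2"
  have s: "s > 0" and small: "\<And>t. t \<in> {-s..s} \<Longrightarrow> dist (?E t) idm < \<epsilon>"
    using s0 by (auto simp: s_def dist_real_def)
  have inC: "?E t ** x \<in> cball idm (r / 2)" if "t \<in> {-s..s}" "x \<in> cball idm d" for t x
  proof -
    have nx: "norm x \<le> N" using that(2) norm_triangle_sub[of x idm] by (simp add: N_def dist_norm norm_minus_commute)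
    have "norm ((?E t - idm) ** x) \<le> norm (?E t - idm) * norm x * K" by (rule K(2))
    also have "\<dots> \<le> norm (?E t - idm) * N * K" using nx K(1) by (intro mult_right_mono mult_left_mono) auto
    also have "\<dots> = norm (?E t - idm) * (K * N)" by simp
    also have "\<dots> \<le> (r / 4 / (K * N)) * (K * N)"
      using small[OF that(1)] Kpos by (intro mult_right_mono) (auto simp: \<epsilon>_def dist_norm)
    also have "\<dots> = r / 4" using K(1) N by simp
    finally have "norm (?E t ** x - x) \<le> r / 4" by (simp add: mm.diff_left)
    moreover have "norm (x - idm) \<le> r / 4" using that(2) radii by (simp add: dist_norm norm_minus_commute)
    moreover have "norm (?E t ** x - idm) \<le> norm (?E t ** x - x) + norm (x - idm)"
      using norm_triangle_ineq[of "?E t ** x - x" "x - idm"] by simp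
    ultimately show ?thesis by (simp add: dist_norm norm_minus_commute)
  qed
  define g where "g t = \<pi> (?E t) ?w'" for t
  have cg: "continuous_on {-s..s} g"
    unfolding g_def
    by (rule continuous_on_compose2[OF continuous_on_rep continuous_on_subset[OF cE]]) (use E in auto)
  have eq: "\<pi> (?E t) ?w = \<pi> (?E (-s)) ?w + integral {-s..t} g" if t: "t \<in> {-s..s}" for t
  proof (rule eq_if_Re_cinner_eq)
    fix u
    let ?m = "\<lambda>x. Re (cinner (\<pi> (\<rho> x) v) u)"
    have "continuous_on (cball idm (r / 2)) ?m"
      using radii
      by (intro bounded_linear.continuous_on[OF bounded_linear_Re_cinner] continuous_on_subset[OF rep_retraction_continuous])
        auto
    \<comment> \<open>The coefficient is known to be continuous only near the identity, whereas the
      flow formula wants a function on all matrices. Tietze's theorem extends it from the ball of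
      radius \<open>r / 2\<close>, which the translated support does not leave.\<close>
    then obtain m where m: "continuous_on UNIV m" "\<And>x. x \<in> cball idm (r / 2) \<Longrightarrow> m x = ?m x"
      by (rule Tietze_unbounded[of _ _ UNIV]) auto
    have I: "Re (cinner (\<pi> (?E q) (average \<psi> v)) u) = integral (cbox a b) (\<lambda>x. \<psi> x * m (?E q ** x))"
      if "\<psi> \<in> test_functions" "q \<in> {-s..s}" for \<psi> q
    proof (rule Re_cinner_rep_average[OF that(1) E])
      show "dist (?E q) idm < \<delta>" using small[OF that(2)] by (simp add: \<epsilon>_def)
      show "m (?E q ** x) = Re (cinner (\<pi> (\<rho> (?E q ** x)) v) u)" if "x \<in> cball idm d" for x
        using m(2)[OF inC] that \<open>q \<in> {-s..s}\<close> by blast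
    qed
    have "Ck_on 1 \<phi> UNIV" "\<And>x. x \<notin> cball idm d \<Longrightarrow> \<phi> x = 0"
      using \<phi> by (auto simp: test_functions_def)
    moreover have "d < r" using radii by simp
    ultimately have "((\<lambda>q. integral (cbox a b) (\<lambda>x. lie_action A \<phi> x * m (?E q ** x))) has_integral
        integral (cbox a b) (\<lambda>x. \<phi> x * m (?E t ** x)) - integral (cbox a b) (\<lambda>x. \<phi> x * m (?E (-s) ** x))) {-s..t}"
      unfolding lie_action_def using t m(1) by (intro flow_integral[OF _ _ _ box]) auto
    moreover have "integral (cbox a b) (\<lambda>x. lie_action A \<phi> x * m (?E q ** x)) = Re (cinner (g q) u)" if "q \<in> {-s..t}" for q
      using I[OF lie_action_mem[OF \<phi>], of q A] that t by (simp add: g_def)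
    ultimately have "((\<lambda>q. Re (cinner (g q) u)) has_integral
        integral (cbox a b) (\<lambda>x. \<phi> x * m (?E t ** x)) - integral (cbox a b) (\<lambda>x. \<phi> x * m (?E (-s) ** x))) {-s..t}"
      by (rule has_integral_eq[rotated])
    moreover have "Re (cinner (\<pi> (?E t) ?w) u) - Re (cinner (\<pi> (?E (-s)) ?w) u) =
          integral (cbox a b) (\<lambda>x. \<phi> x * m (?E t ** x)) - integral (cbox a b) (\<lambda>x. \<phi> x * m (?E (-s) ** x))"
      using I[OF \<phi> t] I[OF \<phi>, of "-s"] s by simp
    ultimately have "((\<lambda>q. Re (cinner (g q) u)) has_integral
        Re (cinner (\<pi> (?E t) ?w) u) - Re (cinner (\<pi> (?E (-s)) ?w) u)) {-s..t}"
      by (rule has_integral_eq_rhs)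
    moreover have "(g has_integral integral {-s..t} g) {-s..t}"
      using t by (intro integrable_integral integrable_continuous_interval continuous_on_subset[OF cg]) auto
    from has_integral_linear[OF this bounded_linear_Re_cinner[of u]]
    have "((\<lambda>q. Re (cinner (g q) u)) has_integral Re (cinner (integral {-s..t} g) u)) {-s..t}" by (simp add: o_def)
    ultimately have "Re (cinner (\<pi> (?E t) ?w) u) - Re (cinner (\<pi> (?E (-s)) ?w) u) = Re (cinner (integral {-s..t} g) u)"
      by (rule has_integral_unique)
    then show "Re (cinner (\<pi> (?E t) ?w) u) = Re (cinner (\<pi> (?E (-s)) ?w + integral {-s..t} g) u)"
      by (simp add: cinner_add_left)
  qed
  show ?thesis
    using integral_equation_derivative[OF s cg eq] by (simp add: g_def rep_one)
qed

lemma dpi_lie_average: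
  "\<phi> \<in> test_functions \<Longrightarrow> A \<in> \<gg> \<Longrightarrow> dpi_lie \<pi> A (average \<phi> v) = average (lie_action A \<phi>) v"
  unfolding dpi_lie_def by (rule vector_derivative_at[OF average_derivative])

text \<open>\<open>dpi_lie\<close> carries averages to averages, because \<open>lie_action\<close>
  preserves test functions; hence the averages satisfy the criterion with \<open>dpi_lie\<close> as
  candidate derivative.\<close>

lemma average_smooth:
  assumes "\<phi> \<in> test_functions"
  shows "average \<phi> v \<in> smooth_vectors G \<pi>"
proof -
  interpret derivative_family G \<pi> "{average \<phi> v | \<phi> v. \<phi> \<in> test_functions}" "dpi_lie \<pi>"
  proof
    fix w X Y r assume "w \<in> {average \<phi> v | \<phi> v. \<phi> \<in> test_functions}"
    then obtain \<phi> v where \<phi>: "\<phi> \<in> test_functions" and w: "w = average \<phi> v" by blast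
    assume X: "X \<in> \<gg>"
    show "dpi_lie \<pi> X w \<in> {average \<phi> v | \<phi> v. \<phi> \<in> test_functions}"
      unfolding w dpi_lie_average[OF \<phi> X] using lie_action_mem[OF \<phi>] by blast
    show "((\<lambda>t. \<pi> (matrix_exp (t *\<^sub>R X)) w) has_vector_derivative dpi_lie \<pi> X w) (at 0)"
      unfolding w dpi_lie_average[OF \<phi> X] by (rule average_derivative[OF \<phi> X])
    show "dpi_lie \<pi> (r *\<^sub>R X) w = r *\<^sub>R dpi_lie \<pi> X w"
      unfolding w using X subspace_scale[OF subspace_lie_algebra X]
      by (simp add: dpi_lie_average[OF \<phi>] lie_action_linear[OF \<phi>] average_scale lie_action_mem[OF \<phi>])
    assume Y: "Y \<in> \<gg>"
    show "dpi_lie \<pi> (X + Y) w = dpi_lie \<pi> X w + dpi_lie \<pi> Y w"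
      unfolding w using X Y subspace_add[OF subspace_lie_algebra X Y]
      by (simp add: dpi_lie_average[OF \<phi>] lie_action_linear[OF \<phi>] average_add lie_action_mem[OF \<phi>])
  qed
  show ?thesis using mem_smooth_vectors assms by blast
qed

text \<open>If \<open>u\<close> were nonzero, its coefficient
  \<open>Re (cinner (\<pi> (\<rho> x) u) u)\<close> would be positive near the identity, and
  averaging \<open>u\<close> against a bump supported there would give a vector not orthogonal to
  \<open>u\<close>.\<close>

lemma eq_zero_if_orthogonal_averages:
  assumes u: "\<And>\<phi> v. \<phi> \<in> test_functions \<Longrightarrow> cinner (average \<phi> v) u = 0"
  shows "u = 0"
proof (rule ccontr)
  assume "u \<noteq> 0"
  let ?m = "\<lambda>x. Re (cinner (\<pi> (\<rho> x) u) u)"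
  have pos: "?m idm > 0"
    using \<open>u \<noteq> 0\<close> by (simp add: retraction(3) rep_one power2_norm_eq_cinner[symmetric])
  have r: "r > 0" using radii by simp
  have cm: "continuous_on (ball idm r) ?m"
    by (rule bounded_linear.continuous_on[OF bounded_linear_Re_cinner rep_retraction_continuous])
  then have "isCont ?m idm" using r by (simp add: continuous_on_eq_continuous_at)
  then have "(?m \<longlongrightarrow> ?m idm) (nhds idm)"
    unfolding isCont_def tendsto_at_iff_tendsto_nhds[of ?m idm] .
  then have "\<forall>\<^sub>F x in nhds idm. 0 < ?m x" using pos by (rule order_tendstoD)
  then obtain e where e: "e > 0" "\<And>x. dist x idm < e \<Longrightarrow> 0 < ?m x"
    unfolding eventually_nhds_metric by blast
  define d' where "d' = min d (e / 2)"
  have d': "d' > 0" "d' \<le> d" "d' < e" using radii e by (auto simp: d'_def)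
  obtain \<phi> :: "complex^'n^'n \<Rightarrow> real" where \<phi>: "\<And>k. Ck_on k \<phi> UNIV" "\<And>x. x \<notin> cball idm d' \<Longrightarrow> \<phi> x = 0"
    "\<And>x. \<phi> x \<ge> 0" "\<phi> idm > 0"
    using smooth_bump_exists[OF d'(1)] by metis
  have t: "\<phi> \<in> test_functions" using \<phi> d' by (auto simp: test_functions_def)
  let ?f = "\<lambda>x. \<phi> x *\<^sub>R ?m x"
  have "(?f has_integral Re (cinner (average \<phi> u) u)) (cbox a b)"
    using has_integral_linear[OF average_has_integral[OF t] bounded_linear_Re_cinner[of u]]
    by (simp add: o_def cinner_scaleR_left)
  then have int: "(?f has_integral 0) (cbox a b)" by (simp add: u[OF t])
  have "continuous_on UNIV ?f"
    by (rule continuous_on_cutoff[OF continuous_on_test[OF t] _ _ cm, where d = d']) (use \<phi> d' radii in auto)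
  then have cf: "continuous_on (cbox a b) ?f" by (rule continuous_on_subset) simp
  have nn: "0 \<le> ?f x" for x
  proof (cases "x \<in> cball idm d'")
    case True
    then show ?thesis using e(2)[of x] d' \<phi>(3)[of x] by (auto simp: dist_commute intro!: mult_nonneg_nonneg less_imp_le)
  qed (use \<phi> in auto)
  have "ball idm r \<subseteq> interior (cbox a b)" using box by (intro interior_maximal) auto
  then have b: "idm \<in> box a b" using r by (auto simp: interior_cbox)
  have "?f idm = 0"
    by (rule has_integral_0_cbox_imp_0[OF cf nn int]) (use b box_subset_cbox[of a b] in auto)
  then show False using pos \<phi>(4) by simp
qed

end

lemma (in unitary_rep) eq_zero_if_orthogonal_smooth:
  assumes u: "\<And>w. w \<in> smooth_vectors G \<pi> \<Longrightarrow> cinner w u = 0"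
  shows "u = 0"
proof -
  obtain r \<delta> \<rho> where r: "r > 0" and \<rho>: "\<And>k. Ck_on k \<rho> (ball idm r)"
    "\<And>x. x \<in> ball idm r \<Longrightarrow> \<rho> x \<in> G" "\<And>x. x \<in> G \<Longrightarrow> x \<in> ball idm r \<Longrightarrow> \<rho> x = x"
    and \<delta>: "\<delta> > 0" "\<delta> \<le> r"
    "\<And>h x. h \<in> G \<Longrightarrow> dist h idm < \<delta> \<Longrightarrow> dist x idm < \<delta> \<Longrightarrow> h ** x \<in> ball idm r \<and> \<rho> (h ** x) = h ** \<rho> x"
    using local_retraction by metis
  obtain b :: "complex^'n^'n" where b: "cball idm r \<subseteq> cbox (- b) b"
    using bounded_subset_cbox_symmetric[OF bounded_cball] by blast
  \<comment> \<open>Since \<open>\<delta> \<le> r\<close>, the value \<open>\<delta> / 4\<close> for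
    \<open>d\<close> meets both \<open>d < \<delta>\<close> and
    \<open>d \<le> r / 4\<close>.\<close>
  interpret garding G \<pi> \<rho> r \<delta> "\<delta> / 4" "- b" b
    by unfold_locales
      (use r \<rho> \<delta> b one_mem Ck_on_continuous[OF \<rho>(1)[of 0]] in auto)
  show ?thesis using eq_zero_if_orthogonal_averages average_smooth u by blast
qed

section \<open>The derived representation on smooth vectors\<close>

lemma bounded_linear_scaleC: "bounded_linear (\<lambda>x :: 'h::complex_hilbert_space. c *\<^sub>C x)"
proof (rule bounded_linear_intro[where K = "norm c"])
  show "c *\<^sub>C (r *\<^sub>R x) = r *\<^sub>R (c *\<^sub>C x)" for r and x :: 'h
    by (simp add: scaleR_eq_scaleC scaleC_scaleC mult.commute)
qed (simp_all add: scaleC_add_right norm_scaleC mult.commute)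

lemma has_vector_derivative_transform_eventually:
  assumes "(f has_vector_derivative y) (at x)" "\<forall>\<^sub>F t in at x. f t = g t" "f x = g x"
  shows "(g has_vector_derivative y) (at x)"
  using assms unfolding has_vector_derivative_def by (auto intro: has_derivative_transform_eventually)

context unitary_rep
begin

abbreviation smooth :: "'h set" where "smooth \<equiv> smooth_vectors G \<pi>"

lemma smooth_local_extension:
  assumes "w \<in> smooth" "g \<in> G"
  obtains U \<Phi> where "open U" "g \<in> U" "\<And>k. Ck_on k \<Phi> U" "\<And>x. x \<in> U \<Longrightarrow> x \<in> G \<Longrightarrow> \<Phi> x = \<pi> x w"
  using assms unfolding smooth_vectors_def smooth_on_group_def by blast

lemma smoothI:
  assumes "\<And>g. g \<in> G \<Longrightarrow> \<exists>U \<Phi>. open U \<and> g \<in> U \<and> (\<forall>k. Ck_on k \<Phi> U) \<and> (\<forall>x\<in>U \<inter> G. \<Phi> x = \<pi> x w)"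
  shows "w \<in> smooth"
  using assms unfolding smooth_vectors_def smooth_on_group_def by blast

lemma smooth_add:
  assumes "w \<in> smooth" "w' \<in> smooth"
  shows "w + w' \<in> smooth"
proof (rule smoothI)
  fix g assume g: "g \<in> G"
  obtain U \<Phi> where 1: "open U" "g \<in> U" "\<And>k. Ck_on k \<Phi> U" "\<And>x. x \<in> U \<Longrightarrow> x \<in> G \<Longrightarrow> \<Phi> x = \<pi> x w"
    using smooth_local_extension[OF assms(1) g] by blast
  obtain U' \<Phi>' where 2: "open U'" "g \<in> U'" "\<And>k. Ck_on k \<Phi>' U'" "\<And>x. x \<in> U' \<Longrightarrow> x \<in> G \<Longrightarrow> \<Phi>' x = \<pi> x w'"
    using smooth_local_extension[OF assms(2) g] by blast
  have "Ck_on k (\<lambda>x. \<Phi> x + \<Phi>' x) (U \<inter> U')" for k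
    by (intro Ck_on_add open_Int 1 2 Ck_on_subset[OF 1(3)] Ck_on_subset[OF 2(3)]) auto
  moreover have "\<Phi> x + \<Phi>' x = \<pi> x (w + w')" if "x \<in> U \<inter> U' \<inter> G" for x
    using that 1 2 by (simp add: rep_add)
  ultimately show "\<exists>U \<Phi>. open U \<and> g \<in> U \<and> (\<forall>k. Ck_on k \<Phi> U) \<and> (\<forall>x\<in>U \<inter> G. \<Phi> x = \<pi> x (w + w'))"
    using 1(1,2) 2(1,2) by (intro exI[of _ "U \<inter> U'"] exI[of _ "\<lambda>x. \<Phi> x + \<Phi>' x"]) auto
qed

lemma smooth_scaleC:
  assumes "w \<in> smooth"
  shows "c *\<^sub>C w \<in> smooth"
proof (rule smoothI)
  fix g assume g: "g \<in> G"
  obtain U \<Phi> where 1: "open U" "g \<in> U" "\<And>k. Ck_on k \<Phi> U" "\<And>x. x \<in> U \<Longrightarrow> x \<in> G \<Longrightarrow> \<Phi> x = \<pi> x w"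
    using smooth_local_extension[OF assms(1) g] by blast
  then show "\<exists>U \<Phi>. open U \<and> g \<in> U \<and> (\<forall>k. Ck_on k \<Phi> U) \<and> (\<forall>x\<in>U \<inter> G. \<Phi> x = \<pi> x (c *\<^sub>C w))"
    by (intro exI[of _ U] exI[of _ "\<lambda>x. c *\<^sub>C \<Phi> x"])
      (auto simp: rep_scaleC intro: Ck_on_bounded_linear_compose[OF bounded_linear_scaleC])
qed

lemma smooth_scaleR: "w \<in> smooth \<Longrightarrow> r *\<^sub>R w \<in> smooth"
  by (simp add: scaleR_eq_scaleC smooth_scaleC)

lemma smooth_minus: "w \<in> smooth \<Longrightarrow> - w \<in> smooth"
  using smooth_scaleR[of w "-1"] by simp

lemma smooth_diff: "w \<in> smooth \<Longrightarrow> w' \<in> smooth \<Longrightarrow> w - w' \<in> smooth"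
  using smooth_add[OF _ smooth_minus, of w w'] by simp

lemma curve_derivative:
  assumes U: "open U" "x \<in> U" "\<And>k. Ck_on k \<Phi> U" "\<And>y. y \<in> U \<Longrightarrow> y \<in> G \<Longrightarrow> \<Phi> y = \<pi> y w"
    and \<gamma>: "\<And>t. \<gamma> t \<in> G" "\<gamma> 0 = x" "(\<gamma> has_vector_derivative Y) (at 0)"
  shows "((\<lambda>t. \<pi> (\<gamma> t) w) has_vector_derivative frechet_derivative \<Phi> (at x) Y) (at 0)"
proof (rule has_vector_derivative_transform_eventually)
  have "(\<Phi> has_derivative frechet_derivative \<Phi> (at x)) (at (\<gamma> 0) within range \<gamma>)"
    using Ck_on_SucD[OF U(3) U(2)] \<gamma>(2) by (simp add: has_derivative_at_withinI)
  from vector_derivative_diff_chain_within[OF \<gamma>(3) this]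
  show "((\<lambda>t. \<Phi> (\<gamma> t)) has_vector_derivative frechet_derivative \<Phi> (at x) Y) (at 0)" by (simp add: o_def)
  have "isCont \<gamma> 0" using has_vector_derivative_continuous[OF \<gamma>(3)] .
  then have "\<forall>\<^sub>F t in at 0. \<gamma> t \<in> U"
    unfolding isCont_def using U(1,2) \<gamma>(2) by (intro topological_tendstoD) auto
  then show "\<forall>\<^sub>F t in at 0. \<Phi> (\<gamma> t) = \<pi> (\<gamma> t) w"
    by (rule eventually_mono) (use U(4) \<gamma>(1) in auto)
  show "\<Phi> (\<gamma> 0) = \<pi> (\<gamma> 0) w" using U(2,4) \<gamma>(1)[of 0] \<gamma>(2) by simp
qed

text \<open>\<open>dpi_lie\<close> is defined one direction at a time, so linearity in
  \<open>X\<close> is not visible. It comes from the Frechet derivative of a smooth extension at the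
  identity, which also differentiates the orbit map along arbitrary curves in the group.\<close>

lemma dpi_lie_eq_linear:
  assumes w: "w \<in> smooth"
  obtains \<Lambda> where "bounded_linear \<Lambda>" "\<And>X. X \<in> \<gg> \<Longrightarrow> dpi_lie \<pi> X w = \<Lambda> X"
    "\<And>X. X \<in> \<gg> \<Longrightarrow> ((\<lambda>t. \<pi> (matrix_exp (t *\<^sub>R X)) w) has_vector_derivative \<Lambda> X) (at 0)"
    "\<And>\<gamma> Y. (\<And>t. \<gamma> t \<in> G) \<Longrightarrow> \<gamma> 0 = idm \<Longrightarrow> (\<gamma> has_vector_derivative Y) (at 0) \<Longrightarrow>
      ((\<lambda>t. \<pi> (\<gamma> t) w) has_vector_derivative \<Lambda> Y) (at 0)"
proof -
  obtain U \<Phi> where U: "open U" "idm \<in> U" "\<And>k. Ck_on k \<Phi> U" "\<And>x. x \<in> U \<Longrightarrow> x \<in> G \<Longrightarrow> \<Phi> x = \<pi> x w"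
    using smooth_local_extension[OF w one_mem] by blast
  define \<Lambda> where "\<Lambda> = frechet_derivative \<Phi> (at idm)"
  have "bounded_linear \<Lambda>"
    unfolding \<Lambda>_def by (rule has_derivative_bounded_linear[OF Ck_on_SucD[OF U(3) U(2)]])
  moreover have "\<And>\<gamma> Y. (\<And>t. \<gamma> t \<in> G) \<Longrightarrow> \<gamma> 0 = idm \<Longrightarrow> (\<gamma> has_vector_derivative Y) (at 0) \<Longrightarrow>
      ((\<lambda>t. \<pi> (\<gamma> t) w) has_vector_derivative \<Lambda> Y) (at 0)"
    unfolding \<Lambda>_def by (rule curve_derivative[OF U])
  ultimately have \<Lambda>: "bounded_linear \<Lambda>" "\<And>\<gamma> Y. (\<And>t. \<gamma> t \<in> G) \<Longrightarrow> \<gamma> 0 = idm \<Longrightarrow>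
      (\<gamma> has_vector_derivative Y) (at 0) \<Longrightarrow> ((\<lambda>t. \<pi> (\<gamma> t) w) has_vector_derivative \<Lambda> Y) (at 0)"
    by blast+
  have d: "((\<lambda>t. \<pi> (matrix_exp (t *\<^sub>R X)) w) has_vector_derivative \<Lambda> X) (at 0)" if "X \<in> \<gg>" for X
    by (rule \<Lambda>(2)) (use exp_mem[OF that] matrix_exp_derivative_0 in auto)
  then have "dpi_lie \<pi> X w = \<Lambda> X" if "X \<in> \<gg>" for X
    unfolding dpi_lie_def using vector_derivative_at that by blast
  with \<Lambda> d show thesis using that by blast
qed

lemma dpi_lie_derivative:
  assumes "w \<in> smooth" "X \<in> \<gg>"
  shows "((\<lambda>t. \<pi> (matrix_exp (t *\<^sub>R X)) w) has_vector_derivative dpi_lie \<pi> X w) (at 0)"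
proof -
  obtain \<Lambda> where "dpi_lie \<pi> X w = \<Lambda> X"
    "((\<lambda>t. \<pi> (matrix_exp (t *\<^sub>R X)) w) has_vector_derivative \<Lambda> X) (at 0)"
    using dpi_lie_eq_linear[OF assms(1)] assms(2) by metis
  then show ?thesis by simp
qed

lemma dpi_lie_left:
  assumes w: "w \<in> smooth" and X: "X \<in> \<gg>"
  shows "Y \<in> \<gg> \<Longrightarrow> dpi_lie \<pi> (X + Y) w = dpi_lie \<pi> X w + dpi_lie \<pi> Y w"
    and "dpi_lie \<pi> (r *\<^sub>R X) w = r *\<^sub>R dpi_lie \<pi> X w"
proof -
  obtain \<Lambda> where \<Lambda>: "bounded_linear \<Lambda>" "\<And>X. X \<in> \<gg> \<Longrightarrow> dpi_lie \<pi> X w = \<Lambda> X"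
    using dpi_lie_eq_linear[OF w] by metis
  note l = bounded_linear.linear[OF \<Lambda>(1)]
  show "Y \<in> \<gg> \<Longrightarrow> dpi_lie \<pi> (X + Y) w = dpi_lie \<pi> X w + dpi_lie \<pi> Y w"
    using X by (simp add: \<Lambda>(2) subspace_add[OF subspace_lie_algebra] linear_add[OF l])
  show "dpi_lie \<pi> (r *\<^sub>R X) w = r *\<^sub>R dpi_lie \<pi> X w"
    using X by (simp add: \<Lambda>(2) subspace_scale[OF subspace_lie_algebra] linear_cmul[OF l])
qed

lemma dpi_lie_add:
  assumes "w \<in> smooth" "w' \<in> smooth" "X \<in> \<gg>"
  shows "dpi_lie \<pi> X (w + w') = dpi_lie \<pi> X w + dpi_lie \<pi> X w'"
  using has_vector_derivative_add[OF dpi_lie_derivative[OF assms(1,3)] dpi_lie_derivative[OF assms(2,3)]]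
  unfolding rep_add[OF exp_mem[OF assms(3)], symmetric] by (simp add: dpi_lie_def vector_derivative_at)

lemma dpi_lie_scaleC:
  assumes "w \<in> smooth" "X \<in> \<gg>"
  shows "dpi_lie \<pi> X (c *\<^sub>C w) = c *\<^sub>C dpi_lie \<pi> X w"
  using bounded_linear.has_vector_derivative[OF bounded_linear_scaleC dpi_lie_derivative[OF assms], of c]
  unfolding rep_scaleC[OF exp_mem[OF assms(2)], symmetric] by (simp add: dpi_lie_def vector_derivative_at)

lemma dpi_lie_scaleR:
  "w \<in> smooth \<Longrightarrow> X \<in> \<gg> \<Longrightarrow> dpi_lie \<pi> X (r *\<^sub>R w) = r *\<^sub>R dpi_lie \<pi> X w"
  by (simp add: scaleR_eq_scaleC dpi_lie_scaleC)

text \<open>The orbit map of the derived vector extends as the derivative of \<Phi> along the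
  left-invariant field \<open>x ** X\<close>, which is smooth on the same open set.\<close>

lemma dpi_lie_smooth:
  assumes w: "w \<in> smooth" and X: "X \<in> \<gg>"
  shows "dpi_lie \<pi> X w \<in> smooth"
proof (rule smoothI)
  fix g assume g: "g \<in> G"
  obtain U \<Phi> where U: "open U" "g \<in> U" "\<And>k. Ck_on k \<Phi> U" "\<And>x. x \<in> U \<Longrightarrow> x \<in> G \<Longrightarrow> \<Phi> x = \<pi> x w"
    using smooth_local_extension[OF w g] by blast
  let ?\<Phi>' = "\<lambda>x. frechet_derivative \<Phi> (at x) (x ** X)"
  have "Ck_on k ?\<Phi>' U" for k
    by (rule Ck_on_frechet_derivative_apply[OF U(3) U(1) Ck_on_linear[OF mm.bounded_linear_left U(1)]])
  moreover have "?\<Phi>' x = \<pi> x (dpi_lie \<pi> X w)" if x: "x \<in> U" "x \<in> G" for x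
  proof -
    let ?\<gamma> = "\<lambda>t. x ** matrix_exp (t *\<^sub>R X)"
    have \<gamma>': "(?\<gamma> has_vector_derivative x ** X) (at 0)"
      by (rule bounded_linear.has_vector_derivative[OF mm.bounded_linear_right matrix_exp_derivative_0])
    have E: "matrix_exp (t *\<^sub>R X) \<in> G" for t by (rule exp_mem[OF X])
    have "((\<lambda>t. \<pi> (?\<gamma> t) w) has_vector_derivative ?\<Phi>' x) (at 0)"
      by (rule curve_derivative[OF U(1) x(1) U(3,4) _ _ \<gamma>']) (use x E in \<open>auto simp: mult_mem\<close>)
    then have 2: "((\<lambda>t. \<pi> x (\<pi> (matrix_exp (t *\<^sub>R X)) w)) has_vector_derivative ?\<Phi>' x) (at 0)"
      by (simp add: rep_mult[OF x(2) E])
    have "((\<lambda>t. \<pi> x (\<pi> (matrix_exp (t *\<^sub>R X)) w)) has_vector_derivative \<pi> x (dpi_lie \<pi> X w)) (at 0)"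
      by (rule bounded_linear.has_vector_derivative[OF bounded_linear_rep[OF x(2)] dpi_lie_derivative[OF w X]])
    from vector_derivative_unique_at[OF 2 this] show ?thesis .
  qed
  ultimately show "\<exists>U \<Phi>. open U \<and> g \<in> U \<and> (\<forall>k. Ck_on k \<Phi> U) \<and> (\<forall>x\<in>U \<inter> G. \<Phi> x = \<pi> x (dpi_lie \<pi> X w))"
    using U(1,2) by (intro exI[of _ U] exI[of _ ?\<Phi>']) auto
qed

lemma rep_smooth:
  assumes w: "w \<in> smooth" and h: "h \<in> G"
  shows "\<pi> h w \<in> smooth"
proof (rule smoothI)
  fix g assume g: "g \<in> G"
  obtain U \<Phi> where U: "open U" "g ** h \<in> U" "\<And>k. Ck_on k \<Phi> U" "\<And>x. x \<in> U \<Longrightarrow> x \<in> G \<Longrightarrow> \<Phi> x = \<pi> x w"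
    using smooth_local_extension[OF w mult_mem[OF g h]] by blast
  have o: "open ((\<lambda>x. x ** h) -` U)"
    by (intro open_vimage U linear_continuous_on mm.bounded_linear_left)
  moreover have "Ck_on k (\<lambda>x. \<Phi> (x ** h)) ((\<lambda>x. x ** h) -` U)" for k
    by (rule Ck_on_compose_linear[OF mm.bounded_linear_left o U(3)]) simp
  moreover have "\<Phi> (x ** h) = \<pi> x (\<pi> h w)" if "x \<in> (\<lambda>x. x ** h) -` U \<inter> G" for x
    using that U(4) h by (simp add: mult_mem rep_mult)
  ultimately show "\<exists>U \<Phi>. open U \<and> g \<in> U \<and> (\<forall>k. Ck_on k \<Phi> U) \<and> (\<forall>x\<in>U \<inter> G. \<Phi> x = \<pi> x (\<pi> h w))"
    using U(2) by (intro exI[of _ "(\<lambda>x. x ** h) -` U"] exI[of _ "\<lambda>x. \<Phi> (x ** h)"]) auto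
qed

text \<open>Both sides are the velocity of the same curve: \<open>\<pi>\<close> along
  \<open>g exp (tX) g^-1\<close>, applied to \<open>\<pi> g w\<close>, equals \<open>\<pi> g\<close>
  applied to the orbit of \<open>w\<close> along \<open>exp (tX)\<close>.\<close>

lemma rep_dpi_lie:
  assumes w: "w \<in> smooth" and X: "X \<in> \<gg>" and g: "g \<in> G"
  shows "\<pi> g (dpi_lie \<pi> X w) = dpi_lie \<pi> (g ** X ** matrix_inv g) (\<pi> g w)"
proof -
  obtain \<Lambda> where \<Lambda>: "\<And>X. X \<in> \<gg> \<Longrightarrow> dpi_lie \<pi> X (\<pi> g w) = \<Lambda> X"
    "\<And>\<gamma> Y. (\<And>t. \<gamma> t \<in> G) \<Longrightarrow> \<gamma> 0 = idm \<Longrightarrow> (\<gamma> has_vector_derivative Y) (at 0) \<Longrightarrow>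
      ((\<lambda>t. \<pi> (\<gamma> t) (\<pi> g w)) has_vector_derivative \<Lambda> Y) (at 0)"
    using dpi_lie_eq_linear[OF rep_smooth[OF w g]] by metis
  let ?\<gamma> = "\<lambda>t. g ** matrix_exp (t *\<^sub>R X) ** matrix_inv g"
  have E: "matrix_exp (t *\<^sub>R X) \<in> G" for t by (rule exp_mem[OF X])
  have "(?\<gamma> has_vector_derivative g ** X ** matrix_inv g) (at 0)"
    using bounded_linear.has_vector_derivative[OF bounded_linear_compose[OF mm.bounded_linear_left[of "matrix_inv g"]
          mm.bounded_linear_right[of g]] matrix_exp_derivative_0[of X]] .
  then have "((\<lambda>t. \<pi> (?\<gamma> t) (\<pi> g w)) has_vector_derivative \<Lambda> (g ** X ** matrix_inv g)) (at 0)"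
    using g E by (intro \<Lambda>(2)) (auto simp: mult_mem inv_mem mult_inv)
  moreover have "\<pi> (?\<gamma> t) (\<pi> g w) = \<pi> g (\<pi> (matrix_exp (t *\<^sub>R X)) w)" for t
    using rep_mult[OF mult_mem[OF mult_mem[OF g E] inv_mem[OF g]] g, of t w, symmetric]
    by (simp add: matrix_mul_assoc[symmetric] inv_mult[OF g] rep_mult[OF g E])
  ultimately have "((\<lambda>t. \<pi> g (\<pi> (matrix_exp (t *\<^sub>R X)) w)) has_vector_derivative \<Lambda> (g ** X ** matrix_inv g)) (at 0)"
    by simp
  moreover have "((\<lambda>t. \<pi> g (\<pi> (matrix_exp (t *\<^sub>R X)) w)) has_vector_derivative \<pi> g (dpi_lie \<pi> X w)) (at 0)"
    by (rule bounded_linear.has_vector_derivative[OF bounded_linear_rep[OF g] dpi_lie_derivative[OF w X]])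
  ultimately have "\<pi> g (dpi_lie \<pi> X w) = \<Lambda> (g ** X ** matrix_inv g)"
    using vector_derivative_unique_at by blast
  then show ?thesis using \<Lambda>(1)[OF Ad_mem[OF g X]] by simp
qed

text \<open>By unitarity the pairing of the two orbits is constant in \<open>t\<close>; its
  derivative at 0 is the sum of the two terms.\<close>

lemma dpi_lie_skew:
  assumes "w \<in> smooth" "w' \<in> smooth" and X: "X \<in> \<gg>"
  shows "cinner (dpi_lie \<pi> X w) w' = - cinner w (dpi_lie \<pi> X w')"
proof -
  have "((\<lambda>t. cinner (\<pi> (matrix_exp (t *\<^sub>R X)) w) (\<pi> (matrix_exp (t *\<^sub>R X)) w')) has_vector_derivative
      cinner (\<pi> (matrix_exp (0 *\<^sub>R X)) w) (dpi_lie \<pi> X w') + cinner (dpi_lie \<pi> X w) (\<pi> (matrix_exp (0 *\<^sub>R X)) w')) (at 0)"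
    by (rule ci.has_vector_derivative[OF dpi_lie_derivative[OF assms(1) X] dpi_lie_derivative[OF assms(2) X]])
  then have "((\<lambda>t. cinner w w') has_vector_derivative
      cinner w (dpi_lie \<pi> X w') + cinner (dpi_lie \<pi> X w) w') (at 0)"
    by (simp add: cinner_rep[OF exp_mem[OF X]] rep_one)
  from vector_derivative_unique_at[OF this has_vector_derivative_const]
  show ?thesis by (simp add: eq_neg_iff_add_eq_0 add.commute)
qed

text \<open>Tested against smooth vectors, the bracket relation is the derivative at \<open>0\<close> of
  \<open>\<langle>\<pi>(exp tX) d\<pi>(Y) w, w'\<rangle> = - \<langle>\<pi>(exp tX) w, d\<pi>(Ad(exp tX) Y) w'\<rangle>\<close>; no symmetry of second
  derivatives is needed.\<close>

lemma dpi_lie_bracket: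
  assumes w: "w \<in> smooth" and X: "X \<in> \<gg>" and Y: "Y \<in> \<gg>"
  shows "dpi_lie \<pi> X (dpi_lie \<pi> Y w) - dpi_lie \<pi> Y (dpi_lie \<pi> X w) = dpi_lie \<pi> (X ** Y - Y ** X) w"
proof -
  let ?d = "dpi_lie \<pi>" and ?E = "\<lambda>t. matrix_exp (t *\<^sub>R X)"
  have E: "?E t \<in> G" for t by (rule exp_mem[OF X])
  note B = bracket_mem[OF X Y]
  have eq: "cinner (?d X (?d Y w)) w' = cinner (?d (X ** Y - Y ** X) w) w' + cinner (?d Y (?d X w)) w'"
    if w': "w' \<in> smooth" for w'
  proof -
    \<comment> \<open>On the fixed vector \<open>w'\<close> the derived action is a linear function
      of the Lie algebra element, so the moving element \<open>?Ad t\<close> can be differentiated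
      inside it.\<close>
    obtain \<Lambda> where \<Lambda>: "bounded_linear \<Lambda>" "\<And>X. X \<in> \<gg> \<Longrightarrow> ?d X w' = \<Lambda> X"
      using dpi_lie_eq_linear[OF w'] by metis
    let ?Ad = "\<lambda>t. ?E t ** Y ** matrix_exp (- t *\<^sub>R X)"
    have Ad: "?Ad t \<in> \<gg>" for t using Ad_mem[OF E Y, of t] by (simp add: inv_exp[OF X])
    have "cinner (\<pi> (?E t) (?d Y w)) w' = - cinner (\<pi> (?E t) w) (\<Lambda> (?Ad t))" for t
    proof -
      have "\<pi> (?E t) (?d Y w) = ?d (?Ad t) (\<pi> (?E t) w)"
        using rep_dpi_lie[OF w Y E, of t] by (simp add: inv_exp[OF X])
      then show ?thesis using dpi_lie_skew[OF rep_smooth[OF w E] w' Ad] \<Lambda>(2)[OF Ad] by simp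
    qed
    moreover have "((\<lambda>t. - cinner (\<pi> (?E t) w) (\<Lambda> (?Ad t))) has_vector_derivative
        - (cinner (\<pi> (?E 0) w) (\<Lambda> (X ** Y - Y ** X)) + cinner (?d X w) (\<Lambda> (?Ad 0)))) (at 0)"
      by (intro has_vector_derivative_minus ci.has_vector_derivative dpi_lie_derivative[OF w X]
          bounded_linear.has_vector_derivative[OF \<Lambda>(1)] Ad_exp_derivative)
    moreover have "((\<lambda>t. cinner (\<pi> (?E t) (?d Y w)) w') has_vector_derivative cinner (?d X (?d Y w)) w') (at 0)"
      by (rule bounded_linear.has_vector_derivative[OF ci.bounded_linear_left
            dpi_lie_derivative[OF dpi_lie_smooth[OF w Y] X]])
    ultimately have "cinner (?d X (?d Y w)) w'
        = - (cinner w (\<Lambda> (X ** Y - Y ** X)) + cinner (?d X w) (\<Lambda> Y))"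
      using vector_derivative_unique_at by (fastforce simp: rep_one)
    then show ?thesis
      using dpi_lie_skew[OF w w' B] dpi_lie_skew[OF dpi_lie_smooth[OF w X] w' Y] \<Lambda>(2)[OF B] \<Lambda>(2)[OF Y] by simp
  qed
  have "?d X (?d Y w) - ?d Y (?d X w) - ?d (X ** Y - Y ** X) w = 0"
  proof (rule eq_zero_if_orthogonal_smooth)
    fix w' assume "w' \<in> smooth"
    from eq[OF this] show "cinner w' (?d X (?d Y w) - ?d Y (?d X w) - ?d (X ** Y - Y ** X) w) = 0"
      by (subst cinner_commute) (simp add: ci.diff_left)
  qed
  then show ?thesis by simp
qed

end

section \<open>The action of the enveloping algebra\<close>

text \<open>The linear extension of a function on words to the free algebra; both actions of the
  enveloping algebra have this shape.\<close>

definition word_sum :: "('a list \<Rightarrow> 'b::real_vector) \<Rightarrow> 'a free_algebra \<Rightarrow> 'b" where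
  "word_sum l p = (\<Sum>xs\<in>Poly_Mapping.keys p. Poly_Mapping.lookup p xs *\<^sub>R l xs)"

lemma word_sum_superset:
  assumes "finite K" "Poly_Mapping.keys p \<subseteq> K"
  shows "word_sum l p = (\<Sum>xs\<in>K. Poly_Mapping.lookup p xs *\<^sub>R l xs)"
  unfolding word_sum_def by (rule sum.mono_neutral_left) (use assms in \<open>auto simp: in_keys_iff\<close>)

lemma word_sum_add: "word_sum l (p + q) = word_sum l p + word_sum l q"
proof -
  let ?K = "Poly_Mapping.keys p \<union> Poly_Mapping.keys q"
  have "Poly_Mapping.keys (p + q) \<subseteq> ?K" by (rule Poly_Mapping.keys_add)
  then show ?thesis
    by (simp add: word_sum_superset[of ?K] lookup_add scaleR_add_left sum.distrib)
qed

lemma word_sum_single: "word_sum l (Poly_Mapping.single w c) = c *\<^sub>R l w"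
  by (simp add: word_sum_superset[of "{w}"])

lemma word_sum_zero [simp]: "word_sum l 0 = 0"
  by (simp add: word_sum_def)

lemma word_sum_diff: "word_sum l (p - q) = word_sum l p - word_sum l q"
  using word_sum_add[of l "p - q" q] by simp

lemma word_sum_sum: "word_sum l (\<Sum>i\<in>I. f i) = (\<Sum>i\<in>I. word_sum l (f i))"
  by (induction I rule: infinite_finite_induct) (simp_all add: word_sum_add)

lemma word_sum_free_mult:
  "word_sum l (free_mult p q) = (\<Sum>a\<in>Poly_Mapping.keys p. \<Sum>b\<in>Poly_Mapping.keys q.
    (Poly_Mapping.lookup p a * Poly_Mapping.lookup q b) *\<^sub>R l (a @ b))"
  by (simp add: free_mult_def word_sum_sum word_sum_single)

text \<open>The ideal is closed under multiplication from both sides, so the induction is run for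
  words framed by an arbitrary prefix \<open>a\<close> and suffix \<open>b\<close>: a factor on the
  left lengthens the prefix, a factor on the right the suffix.\<close>

lemma uea_ideal_word_sum:
  fixes l :: "(complex^'n^'n) list \<Rightarrow> 'b::real_vector"
  assumes p: "p \<in> uea_ideal \<gg>"
    and add: "\<And>a b X Y. set a \<subseteq> \<gg> \<Longrightarrow> set b \<subseteq> \<gg> \<Longrightarrow> X \<in> \<gg> \<Longrightarrow> Y \<in> \<gg> \<Longrightarrow>
      l (a @ (X + Y) # b) = l (a @ X # b) + l (a @ Y # b)"
    and scale: "\<And>a b X r. set a \<subseteq> \<gg> \<Longrightarrow> set b \<subseteq> \<gg> \<Longrightarrow> X \<in> \<gg> \<Longrightarrow> l (a @ (r *\<^sub>R X) # b) = r *\<^sub>R l (a @ X # b)"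
    and bracket: "\<And>a b X Y. set a \<subseteq> \<gg> \<Longrightarrow> set b \<subseteq> \<gg> \<Longrightarrow> X \<in> \<gg> \<Longrightarrow> Y \<in> \<gg> \<Longrightarrow>
      l (a @ X # Y # b) - l (a @ Y # X # b) = l (a @ (X ** Y - Y ** X) # b)"
  shows "word_sum l p = 0"
proof -
  have "word_sum (\<lambda>xs. l (a @ xs @ b)) p = 0" if "set a \<subseteq> \<gg>" "set b \<subseteq> \<gg>" for a b
    using p that
  proof (induction arbitrary: a b)
    case (left p c)
    have "word_sum (\<lambda>xs. l (a @ xs @ b)) (free_mult c p) = (\<Sum>u\<in>Poly_Mapping.keys c.
        Poly_Mapping.lookup c u *\<^sub>R word_sum (\<lambda>xs. l ((a @ u) @ xs @ b)) p)"
      unfolding word_sum_free_mult by (simp add: word_sum_def scaleR_sum_right)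
    also have "\<dots> = 0"
    proof (rule sum.neutral, rule ballI)
      fix u assume "u \<in> Poly_Mapping.keys c"
      then have "set (a @ u) \<subseteq> \<gg>" using left.hyps(2) left.prems by (auto simp: free_carrier_def)
      from left.IH[OF this left.prems(2)]
      show "Poly_Mapping.lookup c u *\<^sub>R word_sum (\<lambda>xs. l ((a @ u) @ xs @ b)) p = 0" by simp
    qed
    finally show ?case .
  next
    case (right p c)
    have "word_sum (\<lambda>xs. l (a @ xs @ b)) (free_mult p c) = (\<Sum>u\<in>Poly_Mapping.keys c.
        Poly_Mapping.lookup c u *\<^sub>R word_sum (\<lambda>xs. l (a @ xs @ (u @ b))) p)"
      unfolding word_sum_free_mult
      by (subst sum.swap) (simp add: word_sum_def scaleR_sum_right mult.commute)
    also have "\<dots> = 0"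
    proof (rule sum.neutral, rule ballI)
      fix u assume "u \<in> Poly_Mapping.keys c"
      then have "set (u @ b) \<subseteq> \<gg>" using right.hyps(2) right.prems by (auto simp: free_carrier_def)
      from right.IH[OF right.prems(1) this]
      show "Poly_Mapping.lookup c u *\<^sub>R word_sum (\<lambda>xs. l (a @ xs @ (u @ b))) p = 0" by simp
    qed
    finally show ?case .
  qed (simp_all add: word_sum_add word_sum_diff word_sum_single add scale bracket)
  from this[of "[]" "[]"] show ?thesis by simp
qed

definition uea_class :: "(complex^'n^'n) set \<Rightarrow> (complex^'n^'n) free_algebra \<Rightarrow> (complex^'n^'n) free_algebra set" where
  "uea_class \<gg> p = {q \<in> free_carrier \<gg>. p - q \<in> uea_ideal \<gg>}"

lemma uea_class_mem:
  assumes "p \<in> free_carrier \<gg>"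
  shows "uea_class \<gg> p \<in> enveloping_algebra \<gg>"
proof -
  have "uea_class \<gg> p = {(p, q). p \<in> free_carrier \<gg> \<and> q \<in> free_carrier \<gg> \<and> p - q \<in> uea_ideal \<gg>} `` {p}"
    using assms by (auto simp: uea_class_def)
  then show ?thesis unfolding enveloping_algebra_def by (simp only: quotientI[OF assms])
qed

lemma quotient_lift_uea_class:
  assumes "p \<in> free_carrier \<gg>" "\<And>q. q \<in> uea_class \<gg> p \<Longrightarrow> f q = f p"
  shows "quotient_lift f (uea_class \<gg> p) = f p"
proof -
  have "p \<in> uea_class \<gg> p" using assms(1) by (simp add: uea_class_def uea_ideal.zero)
  moreover have "f ` uea_class \<gg> p = (\<lambda>_. f p) ` uea_class \<gg> p"
    by (rule image_cong[OF refl assms(2)])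
  ultimately have "f ` uea_class \<gg> p = {f p}" by (simp add: image_constant)
  then show ?thesis by (simp add: quotient_lift_def)
qed

section \<open>Well-defined actions on smooth vectors and on distribution vectors\<close>

context unitary_rep
begin

lemma foldr_dpi_lie_smooth: "w \<in> smooth \<Longrightarrow> set xs \<subseteq> \<gg> \<Longrightarrow> foldr (dpi_lie \<pi>) xs w \<in> smooth"
  by (induction xs) (auto simp: dpi_lie_smooth)

lemma foldr_dpi_lie_linear:
  assumes "set xs \<subseteq> \<gg>" "w \<in> smooth"
  shows "w' \<in> smooth \<Longrightarrow> foldr (dpi_lie \<pi>) xs (w + w') = foldr (dpi_lie \<pi>) xs w + foldr (dpi_lie \<pi>) xs w'"
    and "foldr (dpi_lie \<pi>) xs (r *\<^sub>R w) = r *\<^sub>R foldr (dpi_lie \<pi>) xs w"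
  using assms
  by (induction xs) (auto simp: dpi_lie_add dpi_lie_scaleR foldr_dpi_lie_smooth)

text \<open>The relations of the ideal hold in the middle of a word because the letters to the right
  produce a smooth vector and those to the left act linearly on smooth vectors. So the value does
  not depend on the representative, as \<open>quotient_lift\<close> requires.\<close>

lemma dpi_uea_class:
  assumes p: "p \<in> free_carrier \<gg>" and w: "w \<in> smooth"
  shows "dpi G \<pi> (uea_class \<gg> p) w = word_sum (\<lambda>xs. foldr (dpi_lie \<pi>) xs w) p"
proof -
  let ?l = "\<lambda>w xs. foldr (dpi_lie \<pi>) xs w"
  have const: "word_sum (?l w) q = word_sum (?l w) p" if "q \<in> uea_class \<gg> p" and w: "w \<in> smooth" for q w
  proof -
    have "p - q \<in> uea_ideal \<gg>" using that(1) by (simp add: uea_class_def)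
    then have "word_sum (?l w) (p - q) = 0"
    proof (rule uea_ideal_word_sum)
      fix a b :: "(complex^'n^'n) list" and X Y r
      assume a: "set a \<subseteq> \<gg>" and b: "set b \<subseteq> \<gg>" and X: "X \<in> \<gg>"
      note z = foldr_dpi_lie_smooth[OF w b]
      note D = dpi_lie_smooth[OF z]
      show "?l w (a @ (r *\<^sub>R X) # b) = r *\<^sub>R ?l w (a @ X # b)"
        using foldr_dpi_lie_linear(2)[OF a D[OF X]] by (simp add: dpi_lie_left(2)[OF z X])
      assume Y: "Y \<in> \<gg>"
      show "?l w (a @ (X + Y) # b) = ?l w (a @ X # b) + ?l w (a @ Y # b)"
        using foldr_dpi_lie_linear(1)[OF a D[OF X] D[OF Y]] by (simp add: dpi_lie_left(1)[OF z X Y])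
      have "?l w (a @ (X ** Y - Y ** X) # b) + ?l w (a @ Y # X # b) = ?l w (a @ X # Y # b)"
        using foldr_dpi_lie_linear(1)[OF a D[OF bracket_mem[OF X Y]] dpi_lie_smooth[OF D[OF X] Y]]
        by (simp add: dpi_lie_bracket[OF z X Y, symmetric])
      then show "?l w (a @ X # Y # b) - ?l w (a @ Y # X # b) = ?l w (a @ (X ** Y - Y ** X) # b)"
        by (simp add: algebra_simps)
    qed
    then show ?thesis by (simp add: word_sum_diff)
  qed
  have "dpi G \<pi> (uea_class \<gg> p) = (\<lambda>w\<in>smooth. word_sum (?l w) p)"
    unfolding dpi_def word_sum_def[symmetric]
    by (rule quotient_lift_uea_class[OF p]) (auto simp: const intro!: restrict_ext)
  then show ?thesis using w by simp
qed

text \<open>The transpose of the action on functionals: for linear \<psi>,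
  \<open>dpi_dist_lie G \<pi> X \<psi>\<close> is \<psi> composed with this operator on smooth
  vectors.\<close>

definition neg_dpi :: "complex^'n^'n \<Rightarrow> 'h \<Rightarrow> 'h" where
  "neg_dpi X w = - dpi_lie \<pi> X w"

lemma neg_dpi_smooth: "w \<in> smooth \<Longrightarrow> X \<in> \<gg> \<Longrightarrow> neg_dpi X w \<in> smooth"
  by (simp add: neg_dpi_def smooth_minus dpi_lie_smooth)

lemma fold_neg_dpi_smooth: "w \<in> smooth \<Longrightarrow> set xs \<subseteq> \<gg> \<Longrightarrow> fold neg_dpi xs w \<in> smooth"
  by (induction xs arbitrary: w) (auto simp: neg_dpi_smooth)

lemma neg_dpi_linear:
  assumes "w \<in> smooth" "X \<in> \<gg>"
  shows "w' \<in> smooth \<Longrightarrow> neg_dpi X (w + w') = neg_dpi X w + neg_dpi X w'"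
    and "neg_dpi X (r *\<^sub>R w) = r *\<^sub>R neg_dpi X w"
    and "Y \<in> \<gg> \<Longrightarrow> neg_dpi (X + Y) w = neg_dpi X w + neg_dpi Y w"
    and "neg_dpi (r *\<^sub>R X) w = r *\<^sub>R neg_dpi X w"
  using assms by (simp_all add: neg_dpi_def dpi_lie_add dpi_lie_scaleR dpi_lie_left)

lemma fold_neg_dpi_linear:
  assumes "set xs \<subseteq> \<gg>" "w \<in> smooth"
  shows "w' \<in> smooth \<Longrightarrow> fold neg_dpi xs (w + w') = fold neg_dpi xs w + fold neg_dpi xs w'"
    and "fold neg_dpi xs (r *\<^sub>R w) = r *\<^sub>R fold neg_dpi xs w"
  using assms
  by (induction xs arbitrary: w w') (auto simp: neg_dpi_linear neg_dpi_smooth)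

text \<open>The two signs cancel in each product but one survives on the bracket, so the order of
  \<open>X\<close> and \<open>Y\<close> is reversed compared with the relation for
  \<open>dpi_lie\<close>. This matches \<open>fold\<close>, which applies the first letter
  first.\<close>

lemma neg_dpi_bracket:
  assumes w: "w \<in> smooth" and X: "X \<in> \<gg>" and Y: "Y \<in> \<gg>"
  shows "neg_dpi (X ** Y - Y ** X) w + neg_dpi X (neg_dpi Y w) = neg_dpi Y (neg_dpi X w)"
proof -
  have neg: "neg_dpi A (neg_dpi B w) = dpi_lie \<pi> A (dpi_lie \<pi> B w)" if "A \<in> \<gg>" "B \<in> \<gg>" for A B
    using dpi_lie_scaleR[OF dpi_lie_smooth[OF w that(2)] that(1), of "-1"] by (simp add: neg_dpi_def)
  show ?thesis
    unfolding neg[OF X Y] neg[OF Y X] neg_dpi_def[of "X ** Y - Y ** X"] dpi_lie_bracket[OF w X Y, symmetric] by simp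
qed

lemma dpi_dist_lie_apply: "w \<in> smooth \<Longrightarrow> dpi_dist_lie G \<pi> X \<psi> w = - \<psi> (dpi_lie \<pi> X w)"
  by (simp add: dpi_dist_lie_def)

text \<open>Transposition reverses products: the first letter of a word acts last on functionals,
  hence first on the vector, and \<open>foldr\<close> becomes \<open>fold\<close>.\<close>

lemma dpi_dist_uea_class:
  assumes p: "p \<in> free_carrier \<gg>" and \<psi>: "\<psi> \<in> distribution_vectors G \<pi>" and w: "w \<in> smooth"
  shows "dpi_dist G \<pi> (uea_class \<gg> p) \<psi> w = word_sum (\<lambda>xs. \<psi> (fold neg_dpi xs w)) p"
proof -
  let ?l = "\<lambda>\<psi> w xs. foldr (dpi_dist_lie G \<pi>) xs \<psi> w"
  have l: "?l \<psi> w xs = \<psi> (fold neg_dpi xs w)"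
    if \<psi>: "\<psi> \<in> distribution_vectors G \<pi>" and "w \<in> smooth" "set xs \<subseteq> \<gg>" for \<psi> w xs
    using that(2,3)
  proof (induction xs arbitrary: w)
    case (Cons X xs)
    then have X: "X \<in> \<gg>" and xs: "set xs \<subseteq> \<gg>" by auto
    have d: "dpi_lie \<pi> X w \<in> smooth" by (rule dpi_lie_smooth[OF Cons.prems(1) X])
    have "?l \<psi> w (X # xs) = - \<psi> (fold neg_dpi xs (dpi_lie \<pi> X w))"
      using Cons.IH[OF d xs] Cons.prems(1) by (simp add: dpi_dist_lie_apply)
    also have "\<dots> = \<psi> ((- 1) *\<^sub>R fold neg_dpi xs (dpi_lie \<pi> X w))"
      using \<psi> fold_neg_dpi_smooth[OF d xs] unfolding distribution_vectors_def scaleR_eq_scaleC by simp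
    also have "(- 1) *\<^sub>R fold neg_dpi xs (dpi_lie \<pi> X w) = fold neg_dpi (X # xs) w"
      using fold_neg_dpi_linear(2)[OF xs d, of "- 1"] by (simp add: neg_dpi_def)
    finally show ?case .
  qed simp
  have const: "word_sum (?l \<psi> w) q = word_sum (?l \<psi> w) p"
    if "q \<in> uea_class \<gg> p" and \<psi>: "\<psi> \<in> distribution_vectors G \<pi>" and w: "w \<in> smooth" for q \<psi> w
  proof -
    have \<psi>add: "\<psi> (x + y) = \<psi> x + \<psi> y" if "x \<in> smooth" "y \<in> smooth" for x y
      using \<psi> that by (simp add: distribution_vectors_def)
    have \<psi>scale: "\<psi> (r *\<^sub>R x) = r *\<^sub>R \<psi> x" if "x \<in> smooth" for r x
      using \<psi> that by (simp add: distribution_vectors_def scaleR_eq_scaleC scaleR_conv_of_real)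
    have "p - q \<in> uea_ideal \<gg>" using that(1) by (simp add: uea_class_def)
    then have "word_sum (?l \<psi> w) (p - q) = 0"
    proof (rule uea_ideal_word_sum)
      fix a b :: "(complex^'n^'n) list" and X Y r
      assume a: "set a \<subseteq> \<gg>" and b: "set b \<subseteq> \<gg>" and X: "X \<in> \<gg>"
      note z = fold_neg_dpi_smooth[OF w a]
      note D = neg_dpi_smooth[OF z]
      note F = fold_neg_dpi_smooth[OF _ b]
      show "?l \<psi> w (a @ (r *\<^sub>R X) # b) = r *\<^sub>R ?l \<psi> w (a @ X # b)"
        using a b X by (simp only: l[OF \<psi> w] set_append list.set Un_subset_iff insert_subset subspace_scale[OF subspace_lie_algebra]
            fold_append fold.simps o_apply neg_dpi_linear[OF z X] fold_neg_dpi_linear[OF b D[OF X]] \<psi>scale[OF F[OF D[OF X]]])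
      assume Y: "Y \<in> \<gg>"
      have XY: "X + Y \<in> \<gg>" by (rule subspace_add[OF subspace_lie_algebra X Y])
      have e: "?l \<psi> w (a @ A # b) = \<psi> (fold neg_dpi b (neg_dpi A (fold neg_dpi a w)))" if "A \<in> \<gg>" for A
        using l[OF \<psi> w, of "a @ A # b"] a b that by simp
      have e2: "?l \<psi> w (a @ A # B # b) = \<psi> (fold neg_dpi b (neg_dpi B (neg_dpi A (fold neg_dpi a w))))"
        if "A \<in> \<gg>" "B \<in> \<gg>" for A B
        using l[OF \<psi> w, of "a @ A # B # b"] a b that by simp
      show "?l \<psi> w (a @ (X + Y) # b) = ?l \<psi> w (a @ X # b) + ?l \<psi> w (a @ Y # b)"
        unfolding e[OF X] e[OF Y] e[OF XY] neg_dpi_linear(3)[OF z X Y] fold_neg_dpi_linear(1)[OF b D[OF X] D[OF Y]]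
        by (rule \<psi>add[OF F[OF D[OF X]] F[OF D[OF Y]]])
      have DD: "neg_dpi X (neg_dpi Y (fold neg_dpi a w)) \<in> smooth" by (rule neg_dpi_smooth[OF D[OF Y] X])
      show "?l \<psi> w (a @ X # Y # b) - ?l \<psi> w (a @ Y # X # b) = ?l \<psi> w (a @ (X ** Y - Y ** X) # b)"
        unfolding e2[OF X Y] e2[OF Y X] e[OF bracket_mem[OF X Y]] neg_dpi_bracket[OF z X Y, symmetric]
          fold_neg_dpi_linear(1)[OF b D[OF bracket_mem[OF X Y]] DD]
          \<psi>add[OF F[OF D[OF bracket_mem[OF X Y]]] F[OF DD]]
        by simp
    qed
    then show ?thesis by (simp add: word_sum_diff)
  qed
  have "dpi_dist G \<pi> (uea_class \<gg> p) = (\<lambda>\<psi>\<in>distribution_vectors G \<pi>. \<lambda>w\<in>smooth. word_sum (?l \<psi> w) p)"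
    unfolding dpi_dist_def scaleR_conv_of_real[symmetric] word_sum_def[symmetric]
    by (rule quotient_lift_uea_class[OF p]) (auto simp: const intro!: restrict_ext)
  then have "dpi_dist G \<pi> (uea_class \<gg> p) \<psi> w = word_sum (?l \<psi> w) p" using \<psi> w by simp
  also have "\<dots> = word_sum (\<lambda>xs. \<psi> (fold neg_dpi xs w)) p"
    unfolding word_sum_def using p l[OF \<psi> w] by (intro sum.cong) (auto simp: free_carrier_def)
  finally show ?thesis .
qed

text \<open>The topology on smooth vectors refines the norm topology, since the norm is the
  semi-norm of the unit of the enveloping algebra; and the inner product with \<open>v\<close> is
  norm continuous.\<close>

lemma hilbert_embed_distribution: "hilbert_embed G \<pi> v \<in> distribution_vectors G \<pi>"
proof -
  let ?\<psi> = "hilbert_embed G \<pi> v" and ?T = "smooth_topology G \<pi>"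
  define B where "B u w0 e = {w \<in> smooth. norm (dpi G \<pi> u (w - w0)) < e}" for u w0 e
  have openB: "openin ?T (B u w0 e)" if "u \<in> enveloping_algebra \<gg>" "w0 \<in> smooth" "e > 0" for u w0 e
    unfolding smooth_topology_def B_def using that by (intro topology_generated_by_Basis) blast
  \<comment> \<open>The empty word represents the unit and acts as the identity, so its basic open
    sets are norm balls within the smooth vectors.\<close>
  let ?p = "Poly_Mapping.single [] 1 :: (complex^'n^'n) free_algebra" and ?u = "uea_class \<gg> (Poly_Mapping.single [] 1)"
  have p: "?p \<in> free_carrier \<gg>" by (simp add: free_carrier_def)
  have u: "?u \<in> enveloping_algebra \<gg>" by (rule uea_class_mem[OF p])
  have dpi1: "dpi G \<pi> ?u w = w" if "w \<in> smooth" for w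
    using dpi_uea_class[OF p that] by (simp add: word_sum_single)
  have B: "B ?u w0 e = {w \<in> smooth. norm (w - w0) < e}" if "w0 \<in> smooth" for w0 e
    unfolding B_def using that by (auto simp: dpi1 smooth_diff)
  have top: "topspace ?T = smooth"
  proof
    show "topspace ?T \<subseteq> smooth" unfolding smooth_topology_def by auto
    show "smooth \<subseteq> topspace ?T"
    proof
      fix w assume w: "w \<in> smooth"
      have "openin ?T (B ?u w 1)" by (rule openB[OF u w]) simp
      moreover have "w \<in> B ?u w 1" using w by (simp add: B)
      ultimately show "w \<in> topspace ?T" using openin_subset by blast
    qed
  qed
  have "continuous_map ?T euclidean ?\<psi>"
    unfolding continuous_map_def
  proof (intro conjI allI impI)
    fix V :: "complex set" assume "openin euclidean V"
    then have V: "open V" by simp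
    show "openin ?T {x \<in> topspace ?T. ?\<psi> x \<in> V}"
    proof (subst openin_subopen, intro ballI)
      fix w0 assume "w0 \<in> {x \<in> topspace ?T. ?\<psi> x \<in> V}"
      then have w0: "w0 \<in> smooth" "cinner w0 v \<in> V" by (auto simp: top hilbert_embed_def)
      have "continuous_on UNIV (\<lambda>w. cinner w v)" by (intro linear_continuous_on ci.bounded_linear_left)
      then have "open ((\<lambda>w. cinner w v) -` V)" using V by (simp add: continuous_on_open_vimage)
      then obtain e where e: "e > 0" "\<And>w. dist w w0 < e \<Longrightarrow> cinner w v \<in> V"
        using w0(2) unfolding open_dist by (metis vimage_eq)
      have "openin ?T (B ?u w0 e)" by (rule openB[OF u w0(1) e(1)])
      moreover have "w0 \<in> B ?u w0 e" using w0 e by (simp add: B)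
      moreover have "B ?u w0 e \<subseteq> {x \<in> topspace ?T. ?\<psi> x \<in> V}"
        unfolding B[OF w0(1)] using e(2) by (auto simp: top hilbert_embed_def dist_norm)
      ultimately show "\<exists>W. openin ?T W \<and> w0 \<in> W \<and> W \<subseteq> {x \<in> topspace ?T. ?\<psi> x \<in> V}" by blast
    qed
  qed simp
  then show ?thesis
    by (auto simp: distribution_vectors_def hilbert_embed_def smooth_add smooth_scaleC cinner_add_left cinner_scaleC_left)
qed

section \<open>Vectors all of whose weak derivatives lie in the Hilbert space\<close>

text \<open>All words are quantified over, not only single letters, so that the set is stable under
  weak derivatives. Words span the enveloping algebra, and \<open>fold neg_dpi\<close> is the
  transposed action of a word.\<close>

definition weakly_smooth :: "'h set" where
  "weakly_smooth = {u. \<forall>xs. set xs \<subseteq> \<gg> \<longrightarrow> (\<exists>u'. \<forall>w\<in>smooth. cinner (fold neg_dpi xs w) u = cinner w u')}"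

text \<open>Where such a vector exists it is unique, because smooth vectors separate the points of
  the Hilbert space.\<close>

definition weak_derivative :: "complex^'n^'n \<Rightarrow> 'h \<Rightarrow> 'h" where
  "weak_derivative X u = (SOME u'. \<forall>w\<in>smooth. cinner (neg_dpi X w) u = cinner w u')"

lemma eq_if_cinner_smooth_eq:
  assumes "\<And>w. w \<in> smooth \<Longrightarrow> cinner w x = cinner w y"
  shows "x = y"
proof -
  have "x - y = 0" by (rule eq_zero_if_orthogonal_smooth) (simp add: ci.diff_right assms)
  then show ?thesis by simp
qed

lemma weak_derivative:
  assumes "u \<in> weakly_smooth" "X \<in> \<gg>" "w \<in> smooth"
  shows "cinner w (weak_derivative X u) = cinner (neg_dpi X w) u"
proof -
  have "\<exists>u'. \<forall>w\<in>smooth. cinner (neg_dpi X w) u = cinner w u'"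
  proof -
    have "\<forall>xs. set xs \<subseteq> \<gg> \<longrightarrow> (\<exists>u'. \<forall>w\<in>smooth. cinner (fold neg_dpi xs w) u = cinner w u')"
      using assms(1) unfolding weakly_smooth_def by blast
    from this[rule_format, of "[X]"] show ?thesis using assms(2) by simp
  qed
  from someI_ex[OF this] show ?thesis using assms(3) by (simp add: weak_derivative_def)
qed

lemma weak_derivative_mem:
  assumes u: "u \<in> weakly_smooth" and X: "X \<in> \<gg>"
  shows "weak_derivative X u \<in> weakly_smooth"
  unfolding weakly_smooth_def
proof (intro CollectI allI impI)
  fix xs assume xs: "set xs \<subseteq> \<gg>"
  \<comment> \<open>\<open>fold\<close> applies the last letter last, so the appended
    \<open>X\<close> is the operator that \<open>weak_derivative\<close> transfers from the smooth
    side to \<open>u\<close>.\<close>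
  then have "set (xs @ [X]) \<subseteq> \<gg>" using X by simp
  then obtain u' where "\<And>w. w \<in> smooth \<Longrightarrow> cinner (fold neg_dpi (xs @ [X]) w) u = cinner w u'"
    using u unfolding weakly_smooth_def by blast
  then show "\<exists>u'. \<forall>w\<in>smooth. cinner (fold neg_dpi xs w) (weak_derivative X u) = cinner w u'"
    using weak_derivative[OF u X fold_neg_dpi_smooth[OF _ xs]] by auto
qed

lemma cinner_rep_exp:
  assumes X: "X \<in> \<gg>"
  shows "cinner w (\<pi> (matrix_exp (t *\<^sub>R X)) u) = cinner (\<pi> (matrix_exp (t *\<^sub>R - X)) w) u"
proof -
  have E: "matrix_exp (t *\<^sub>R X) \<in> G" "matrix_exp (- t *\<^sub>R X) \<in> G" by (rule exp_mem[OF X])+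
  have "\<pi> (matrix_exp (t *\<^sub>R X)) (\<pi> (matrix_exp (- t *\<^sub>R X)) w) = w"
    using rep_inv(1)[OF E(1), of w] by (simp add: inv_exp[OF X])
  then show ?thesis using cinner_rep[OF E(1), of "\<pi> (matrix_exp (- t *\<^sub>R X)) w" u] by simp
qed

lemma rep_exp_derivative:
  assumes w: "w \<in> smooth" and X: "X \<in> \<gg>"
  shows "((\<lambda>t. \<pi> (matrix_exp (t *\<^sub>R X)) w) has_vector_derivative dpi_lie \<pi> X (\<pi> (matrix_exp (t *\<^sub>R X)) w)) (at t)"
  by (rule rep_exp_derivative_shift[OF X dpi_lie_derivative[OF rep_smooth[OF w exp_mem[OF X]] X]])

lemma weak_derivative_is_derivative:
  assumes u: "u \<in> weakly_smooth" and X: "X \<in> \<gg>"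
  shows "((\<lambda>t. \<pi> (matrix_exp (t *\<^sub>R X)) u) has_vector_derivative weak_derivative X u) (at 0)"
proof -
  let ?E = "\<lambda>t. matrix_exp (t *\<^sub>R X)"
  define g where "g t = \<pi> (?E t) (weak_derivative X u)" for t
  have X': "- X \<in> \<gg>" using subspace_neg[OF subspace_lie_algebra X] .
  have "continuous_on UNIV ?E"
    by (intro continuous_on_compose2[OF continuous_on_matrix_exp[of UNIV]] continuous_intros subset_UNIV)
  then have cg: "continuous_on UNIV g"
    unfolding g_def by (rule continuous_on_compose2[OF continuous_on_rep]) (use exp_mem[OF X] in auto)
  have eq: "\<pi> (?E t) u = \<pi> (?E (- 1)) u + integral {-1..t} g" if t: "t \<in> {-1..1}" for t
  proof (rule eq_if_cinner_smooth_eq)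
    fix w assume w: "w \<in> smooth"
    have "((\<lambda>s. cinner w (\<pi> (?E s) u)) has_vector_derivative cinner w (g s)) (at s)" for s
    proof -
      \<comment> \<open>Unitarity moves the group element to the smooth vector \<open>w\<close>,
        whose orbit can be differentiated, while only continuity is known so far for the orbit of
        \<open>u\<close>.\<close>
      let ?w = "\<pi> (matrix_exp (s *\<^sub>R - X)) w"
      have sw: "?w \<in> smooth" by (rule rep_smooth[OF w exp_mem[OF X']])
      have "((\<lambda>s. cinner (\<pi> (matrix_exp (s *\<^sub>R - X)) w) u) has_vector_derivative cinner (dpi_lie \<pi> (- X) ?w) u) (at s)"
        by (rule bounded_linear.has_vector_derivative[OF ci.bounded_linear_left rep_exp_derivative[OF w X']])
      moreover have "dpi_lie \<pi> (- X) ?w = neg_dpi X ?w"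
        using dpi_lie_left(2)[OF sw X, of "- 1"] by (simp add: neg_dpi_def)
      then have "cinner (dpi_lie \<pi> (- X) ?w) u = cinner w (g s)"
        using weak_derivative[OF u X sw] by (simp only: g_def cinner_rep_exp[OF X])
      ultimately show ?thesis by (simp only: cinner_rep_exp[OF X])
    qed
    then have "((\<lambda>s. cinner w (g s)) has_integral cinner w (\<pi> (?E t) u) - cinner w (\<pi> (?E (- 1)) u)) {-1..t}"
      using t by (intro fundamental_theorem_of_calculus) (auto intro: has_vector_derivative_at_within)
    moreover have "(g has_integral integral {-1..t} g) {-1..t}"
      by (intro integrable_integral integrable_continuous_interval continuous_on_subset[OF cg]) simp
    from has_integral_linear[OF this ci.bounded_linear_right[of w]]
    have "((\<lambda>s. cinner w (g s)) has_integral cinner w (integral {-1..t} g)) {-1..t}" by (simp add: o_def)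
    ultimately have "cinner w (\<pi> (?E t) u) - cinner w (\<pi> (?E (- 1)) u) = cinner w (integral {-1..t} g)"
      by (rule has_integral_unique)
    then show "cinner w (\<pi> (?E t) u) = cinner w (\<pi> (?E (- 1)) u + integral {-1..t} g)"
      by (simp add: cinner_add_right algebra_simps)
  qed
  have "((\<lambda>t. \<pi> (?E t) u) has_vector_derivative g 0) (at 0)"
  proof (rule integral_equation_derivative[where s = 1])
    show "continuous_on {-1..1} g" by (rule continuous_on_subset[OF cg subset_UNIV])
    show "\<pi> (?E t) u = \<pi> (?E (- 1)) u + integral {-1..t} g" if "t \<in> {-1..1}" for t by (rule eq[OF that])
  qed simp
  then show ?thesis by (simp add: g_def rep_one)
qed

text \<open>Linearity of the weak derivative in \<open>X\<close> is checked on smooth test vectors,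
  where it is the linearity of \<open>neg_dpi\<close>.\<close>

lemma weakly_smooth_imp_smooth:
  assumes "v \<in> weakly_smooth"
  shows "v \<in> smooth"
proof -
  interpret derivative_family G \<pi> weakly_smooth weak_derivative
  proof
    fix u X Y r assume u: "u \<in> weakly_smooth" and X: "X \<in> \<gg>"
    show "weak_derivative X u \<in> weakly_smooth" by (rule weak_derivative_mem[OF u X])
    show "((\<lambda>t. \<pi> (matrix_exp (t *\<^sub>R X)) u) has_vector_derivative weak_derivative X u) (at 0)"
      by (rule weak_derivative_is_derivative[OF u X])
    show "weak_derivative (r *\<^sub>R X) u = r *\<^sub>R weak_derivative X u"
    proof (rule eq_if_cinner_smooth_eq)
      fix w assume w: "w \<in> smooth"
      show "cinner w (weak_derivative (r *\<^sub>R X) u) = cinner w (r *\<^sub>R weak_derivative X u)"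
        by (simp add: weak_derivative[OF u _ w] X subspace_scale[OF subspace_lie_algebra] neg_dpi_linear[OF w X]
            cinner_scaleR_left cinner_scaleR_right)
    qed
    assume Y: "Y \<in> \<gg>"
    show "weak_derivative (X + Y) u = weak_derivative X u + weak_derivative Y u"
    proof (rule eq_if_cinner_smooth_eq)
      fix w assume w: "w \<in> smooth"
      show "cinner w (weak_derivative (X + Y) u) = cinner w (weak_derivative X u + weak_derivative Y u)"
        by (simp add: weak_derivative[OF u _ w] X Y subspace_add[OF subspace_lie_algebra] neg_dpi_linear[OF w X]
            cinner_add_left cinner_add_right)
    qed
  qed
  show ?thesis by (rule mem_smooth_vectors[OF assms])
qed

lemma smooth_if_dpi_dist_in_range:
  assumes "\<forall>u \<in> enveloping_algebra \<gg>. dpi_dist G \<pi> u (hilbert_embed G \<pi> v) \<in> range (hilbert_embed G \<pi>)"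
  shows "v \<in> smooth"
proof (rule weakly_smooth_imp_smooth, unfold weakly_smooth_def, intro CollectI allI impI)
  fix xs assume xs: "set xs \<subseteq> \<gg>"
  \<comment> \<open>A single word as an element of the free algebra: its class turns the hypothesis
    into the existence of the weak derivative along this word.\<close>
  let ?p = "Poly_Mapping.single xs 1 :: (complex^'n^'n) free_algebra"
  have p: "?p \<in> free_carrier \<gg>" using xs by (simp add: free_carrier_def)
  obtain u' where u': "dpi_dist G \<pi> (uea_class \<gg> ?p) (hilbert_embed G \<pi> v) = hilbert_embed G \<pi> u'"
    using assms uea_class_mem[OF p] by blast
  have "cinner (fold neg_dpi xs w) v = cinner w u'" if w: "w \<in> smooth" for w
    using fun_cong[OF u', of w] w fold_neg_dpi_smooth[OF w xs]
    unfolding dpi_dist_uea_class[OF p hilbert_embed_distribution w] word_sum_single by (simp add: hilbert_embed_def)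
  then show "\<exists>u'. \<forall>w\<in>smooth. cinner (fold neg_dpi xs w) v = cinner w u'" by blast
qed

end

section \<open>Rational points of algebraic groups\<close>

lemma continuous_on_GL_regular:
  assumes "f \<in> GL_regular k"
  shows "continuous_on {A :: complex^'n^'n. invertible A} f"
  using assms unfolding GL_regular_def
proof (induction rule: generated_algebra.induct)
  case (gen f)
  have "continuous_on {A :: complex^'n^'n. invertible A} (\<lambda>A. inverse (Determinants.det A))"
  proof (rule continuous_on_inverse)
    show "continuous_on {A :: complex^'n^'n. invertible A} Determinants.det"
      unfolding Determinants.det_def
      by (intro continuous_intros)
    show "\<forall>A\<in>{A :: complex^'n^'n. invertible A}. Determinants.det A \<noteq> 0"
      by (simp add: invertible_det_nz)
  qed
  moreover have "continuous_on S (\<lambda>A :: complex^'n^'n. A $ i $ j)" for S i j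
    by (intro continuous_intros)
  ultimately show ?case using gen by auto
qed (auto intro: continuous_intros)

text \<open>Both conditions on a rational point survive limits within the invertible matrices:
  \<open>k\<close> is closed in the complex numbers, and regular functions are continuous where the
  determinant does not vanish.\<close>

lemma closed_linear_group_rational_points:
  fixes \<G> :: "(complex^'n^'n) set"
  assumes k: "k = \<real> \<or> k = UNIV" and alg: "algebraic_subgroup GL (GL_regular k) \<G>"
  shows "closed_linear_group (rational_points k \<G>)"
proof
  have sub: "subgroup \<G> GL" and closed: "zariski_closed GL (GL_regular k) \<G>"
    using alg by (auto simp: algebraic_subgroup_def)
  interpret subgroup \<G> GL by (rule sub)
  obtain P where P: "P \<subseteq> GL_regular k" "\<G> = {x. invertible x \<and> (\<forall>f\<in>P. f x = 0)}"
    using closed unfolding zariski_closed_def by (auto simp: GL_def)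
  have k_closed: "closed k" using k by (auto intro: closed_complex_Reals)
  have k_alg: "0 \<in> k" "1 \<in> k" "\<And>x y. x \<in> k \<Longrightarrow> y \<in> k \<Longrightarrow> x + y \<in> k" "\<And>x y. x \<in> k \<Longrightarrow> y \<in> k \<Longrightarrow> x * y \<in> k"
    using k by auto
  have k_sum: "(\<Sum>i\<in>I. f i) \<in> k" if "\<And>i. i \<in> I \<Longrightarrow> f i \<in> k" for I and f :: "'n \<Rightarrow> complex"
    using that by (induction I rule: infinite_finite_induct) (auto simp: k_alg)
  show "idm \<in> rational_points k \<G>"
    using one_closed by (auto simp: rational_points_def GL_def Finite_Cartesian_Product.mat_def k_alg)
  show mult: "g ** h \<in> rational_points k \<G>" if "g \<in> rational_points k \<G>" "h \<in> rational_points k \<G>" for g h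
    using that m_closed[of g h]
    by (auto simp: rational_points_def GL_def matrix_matrix_mult_def intro!: k_sum k_alg)
  show "\<exists>h\<in>rational_points k \<G>. g ** h = idm \<and> h ** g = idm" if g: "g \<in> rational_points k \<G>" for g
  proof -
    have g\<G>: "g \<in> \<G>" and gk: "\<And>i j. g $ i $ j \<in> k" using g by (auto simp: rational_points_def)
    have "invertible idm" unfolding invertible_def by (intro exI[of _ idm]) simp
    have "group (GL :: (complex^'n^'n) monoid)"
    proof (rule groupI)
      show "\<exists>y\<in>carrier GL. y \<otimes>\<^bsub>GL\<^esub> x = \<one>\<^bsub>GL\<^esub>" if "x \<in> carrier (GL :: (complex^'n^'n) monoid)" for x
        using that by (auto simp: GL_def invertible_def)
    qed (use \<open>invertible idm\<close> in \<open>auto simp: GL_def matrix_mul_assoc invertible_mult\<close>)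
    then interpret GL: group "GL :: (complex^'n^'n) monoid" .
    define h where "h = inv\<^bsub>GL\<^esub> g"
    have gc: "g \<in> carrier GL" using g\<G> subset by blast
    have h: "h \<in> \<G>" unfolding h_def by (rule m_inv_closed[OF g\<G>])
    have gh: "g ** h = idm" "h ** g = idm"
      using GL.r_inv[OF gc] GL.l_inv[OF gc] by (auto simp: GL_def h_def)
    have "h $ i $ j \<in> k" for i j
    proof (cases "k = UNIV")
      case False
      then have kR: "k = \<real>" using k by simp
      \<comment> \<open>For real points the inverse must be shown to be real: its entrywise
        conjugate is again a left inverse of \<open>g\<close>, so the two agree.\<close>
      define c where "c A = (\<chi> i j. cnj (A $ i $ j))" for A :: "complex^'n^'n"
      have c_mult: "c A ** c B = c (A ** B)" for A B
        by (simp add: c_def matrix_matrix_mult_def Finite_Cartesian_Product.vec_eq_iff)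
      have "c g = g" using gk by (simp add: c_def kR Finite_Cartesian_Product.vec_eq_iff Reals_cnj_iff)
      then have "c h ** g = c idm" using c_mult[of h g] gh(2) by simp
      also have "c idm = idm" by (simp add: c_def Finite_Cartesian_Product.mat_def Finite_Cartesian_Product.vec_eq_iff)
      finally have "c h = h" using gh(1) by (metis matrix_mul_assoc matrix_mul_lid matrix_mul_rid)
      then have "cnj (h $ i $ j) = h $ i $ j" by (simp add: c_def Finite_Cartesian_Product.vec_eq_iff)
      then show ?thesis by (simp add: kR Reals_cnj_iff)
    qed simp
    with h have "h \<in> rational_points k \<G>" by (simp add: rational_points_def)
    with gh show ?thesis by blast
  qed
  show "g \<in> rational_points k \<G>"
    if X: "\<And>n. X n \<in> rational_points k \<G>" and lim: "X \<longlonglongrightarrow> g" and g: "invertible g" for X g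
  proof -
    have X\<G>: "invertible (X n)" "\<And>f. f \<in> P \<Longrightarrow> f (X n) = 0" and Xk: "X n $ i $ j \<in> k" for n i j
      using X[of n] P(2) by (auto simp: rational_points_def)
    have "f g = 0" if f: "f \<in> P" for f
    proof -
      have "continuous_on {A. invertible A} f" using continuous_on_GL_regular P(1) f by blast
      then have "(\<lambda>n. f (X n)) \<longlonglongrightarrow> f g"
        by (rule continuous_on_tendsto_compose[OF _ lim]) (use g X\<G>(1) in auto)
      then show ?thesis using X\<G>(2)[OF f] by (simp add: LIMSEQ_const_iff)
    qed
    moreover have "g $ i $ j \<in> k" for i j
    proof (rule closed_sequentially[OF k_closed Xk])
      show "(\<lambda>n. X n $ i $ j) \<longlonglongrightarrow> g $ i $ j" by (intro tendsto_vec_nth lim)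
    qed
    ultimately show ?thesis using g P(2) by (simp add: rational_points_def)
  qed
qed

theorem proposition6p1:
  fixes k :: "complex set"
    and \<G> G :: "(complex^'n^'n) set"
    and \<pi> :: "complex^'n^'n \<Rightarrow> 'h::complex_hilbert_space \<Rightarrow> 'h"
    and v :: 'h
  assumes archimedean: "k = \<real> \<or> k = UNIV"
    and defined_over: "algebraic_subgroup GL (GL_regular k) \<G>"
    and absolutely_simple: "simple_algebraic_group GL (GL_regular UNIV) \<G>"
    and simply_connected: "simply_connected_group GL (GL_regular UNIV) \<G>"
    and points: "G = rational_points k \<G>"
    and unitary: "unitary_representation G \<pi>"
    and dist: "\<forall>u \<in> enveloping_algebra (lie_algebra G).
                 dpi_dist G \<pi> u (hilbert_embed G \<pi> v) \<in> range (hilbert_embed G \<pi>)"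
  shows "v \<in> smooth_vectors G \<pi>"
proof -
  interpret closed_linear_group G
    unfolding points by (rule closed_linear_group_rational_points[OF archimedean defined_over])
  interpret unitary_rep G \<pi> by unfold_locales (rule unitary)
  show ?thesis by (rule smooth_if_dpi_dist_in_range[OF dist])
qed

end
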